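(* Let $G$ be a group, and let $H_{1},\ldots,H_{n}$ be finitely generated subgroups of $G$. For $i=1,\ldots,n$, let $X_{i}$ be a nontrivial $H_{i}$-almost invariant subset of $G$, and let $\mathcal{X}$ denote the family $\{X_{i}\}_{1\leq i\leq n}$. 1. If $G$ is finitely generated, then the algebraic regular neighbourhood $\Gamma(\mathcal{X}:G)$ exists. 2. If $(G,\mathcal{S})$ is a group system of finite type, and each $X_{i}$ is $\mathcal{S}$-adapted, then the algebraic regular neighbourhood $\Gamma(\mathcal{X}:G)$ exists.
   Context: For a subgroup $H$ of $G$, a subset of $G$ is $H$-finite if it lies in a finite union of cosets $Hg$ (otherwise $H$-infinite); two subsets are $H$-almost equal if their symmetric difference is $H$-finite. $X^{\ast}=G-X$. $X$ is $H$-almost invariant if $HX=X$ and $X$, $Xg$ are $H$-almost equal for all $g\in G$; nontrivial if $X$, $X^{\ast}$ are $H$-infinite. A nontrivial $H$-almost invariant set and a nontrivial $K$-almost invariant set are equivalent if they are $H$-almost equal. A group system $(G,\mathcal{S})$ is a group with a family $\mathcal{S}$ of subgroups (repetitions allowed); it is of finite type if $G$ is countable, $\mathcal{S}$ is finite, and $G$ is generated by the union of the groups in $\mathcal{S}$ and some finite subset. $X$ is strictly adapted to $S$ if for all $g\in G$, $gS\subset X$ or $gS\subset X^{\ast}$; adapted to $S$ if it is equivalent to an $H'$-almost invariant set strictly adapted to $S$; $\mathcal{S}$-adapted if adapted to every group in $\mathcal{S}$. Corners of $(U,V)$: $U\cap V$, $U^{\ast}\cap V$, $U\cap V^{\ast}$,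 $U^{\ast}\cap V^{\ast}$. If $U$ is $H$-almost invariant and $V$ is $K$-almost invariant, $U$ crosses $V$ if all four corners are $K$-infinite. $U,V$ are nested if some corner is empty. Crossing on a family is corner symmetric if for all such $U,V$ in the family a corner of $(U,V)$ is $H$-finite iff it is $K$-finite. Algebraic regular neighbourhood. For a family $\mathcal{X}=\{X_\lambda\}$ of nontrivial almost invariant subsets of $G$, $E(\mathcal{X})=\{gX_\lambda,gX_\lambda^{\ast}\}_{g\in G,\lambda}$, and $F(\mathcal{X})$ is $E(\mathcal{X})$ together with every almost invariant set equivalent to an element of $E(\mathcal{X})$ that crosses some element of $E(\mathcal{X})$. An element of $F(\mathcal{X})$ is isolated if it crosses no element of $F(\mathcal{X})$. $\mathcal{X}$ is RN-ready if crossing in $F(\mathcal{X})$ is corner symmetric and the family of isolated elements of $F(\mathcal{X})$ is nested. If so, the cross-connected components (CCCs) are the equivalence classes of $F(\mathcal{X})$ under the relation generated by crossing and complementation; the set $P$ of CCCs, with $y$ between $x$ and $z$ if $y\neq x,z$ and there are $X\in x,Y\in y,Z\in z$ with $X\subset Y\subset Z$, is a pretree. $P$ is discrete if there are only finitely many elements between any two. If $P$ is discrete, let $T$ be the bipartite $G$-tree whose $V_0$-vertices are the elements of $P$, whose $V_1$-vertices are the stars of $P$ (maximal subsets of pairwise adjacent distinct elements, having at least two elements, where adjacent means no element in between), an edge joining a star to each of its elements. $\Gamma(\mathcal{X}:G)$ is the graph of groups $G\backslash T$, modified as follows: for each $X_\lambda$ that is isolated and invertible ($kX_\lambda=X_\lambda^{\ast}$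 for some $k\in G$), insert a $V_0$-vertex in the centre of the corresponding edge of $G\backslash T$ and change the adjacent $V_0$-vertex to a $V_1$-vertex. For general $\mathcal{X}$, $\Gamma(\mathcal{X}:G)$ exists if each $X_\lambda$ is equivalent to some $Y_\lambda$ such that $\mathcal{Y}=\{Y_\lambda\}$ is RN-ready with discrete pretree, and then $\Gamma(\mathcal{X}:G)=\Gamma(\mathcal{Y}:G)$. *)

theory Defs
  imports "HOL-Algebra.Generated_Groups" "HOL-Library.Countable_Set"
begin

text \<open>All subsets of the group are subsets of \<open>carrier G\<close>; complements are taken in \<open>carrier G\<close>.\<close>

definition coset_finite :: "('a, 'b) monoid_scheme \<Rightarrow> 'a set \<Rightarrow> 'a set \<Rightarrow> bool" where
  "coset_finite G H A \<longleftrightarrow>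
     (\<exists>F. finite F \<and> F \<subseteq> carrier G \<and> A \<subseteq> (\<Union>g\<in>F. H #>\<^bsub>G\<^esub> g))"

definition almost_equal :: "('a, 'b) monoid_scheme \<Rightarrow> 'a set \<Rightarrow> 'a set \<Rightarrow> 'a set \<Rightarrow> bool" where
  "almost_equal G H A B \<longleftrightarrow> coset_finite G H (sym_diff A B)"

definition almost_invariant :: "('a, 'b) monoid_scheme \<Rightarrow> 'a set \<Rightarrow> 'a set \<Rightarrow> bool" where
  "almost_invariant G H X \<longleftrightarrow>
     subgroup H G \<and> X \<subseteq> carrier G \<and> H <#>\<^bsub>G\<^esub> X = X \<and>
     (\<forall>g\<in>carrier G. almost_equal G H X (X #>\<^bsub>G\<^esub> g))"

definition nontrivial_almost_invariant ::
    "('a, 'b) monoid_scheme \<Rightarrow> 'a set \<Rightarrow> 'a set \<Rightarrow> bool" where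
  "nontrivial_almost_invariant G H X \<longleftrightarrow>
     almost_invariant G H X \<and> \<not> coset_finite G H X \<and> \<not> coset_finite G H (carrier G - X)"

text \<open>
  Almost invariant sets are treated as plain sets, so that the families and cross-connected
  components below are families of subsets of the group. A set may be almost invariant over
  several subgroups; the choice among them does not affect \<open>equivalent\<close> and \<open>crosses\<close>
  (lemmas \<open>equivalent_iff\<close> and \<open>crosses_iff\<close>).
\<close>

definition equivalent :: "('a, 'b) monoid_scheme \<Rightarrow> 'a set \<Rightarrow> 'a set \<Rightarrow> bool" where
  "equivalent G X Y \<longleftrightarrow>
     (\<exists>H K. nontrivial_almost_invariant G H X \<and> nontrivial_almost_invariant G K Y \<and>
            almost_equal G H X Y)"

definition corners :: "('a, 'b) monoid_scheme \<Rightarrow> 'a set \<Rightarrow> 'a set \<Rightarrow> 'a set set" where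
  "corners G U V =
     {U \<inter> V, (carrier G - U) \<inter> V, U \<inter> (carrier G - V), (carrier G - U) \<inter> (carrier G - V)}"

definition crosses :: "('a, 'b) monoid_scheme \<Rightarrow> 'a set \<Rightarrow> 'a set \<Rightarrow> bool" where
  "crosses G U V \<longleftrightarrow>
     (\<exists>H K. almost_invariant G H U \<and> almost_invariant G K V \<and>
            (\<forall>C\<in>corners G U V. \<not> coset_finite G K C))"

definition nested :: "('a, 'b) monoid_scheme \<Rightarrow> 'a set \<Rightarrow> 'a set \<Rightarrow> bool" where
  "nested G U V \<longleftrightarrow> {} \<in> corners G U V"

definition corner_symmetric :: "('a, 'b) monoid_scheme \<Rightarrow> 'a set set \<Rightarrow> bool" where
  "corner_symmetric G \<F> \<longleftrightarrow>
     (\<forall>U\<in>\<F>. \<forall>V\<in>\<F>. \<forall>H K. almost_invariant G H U \<and> almost_invariant G K V \<longrightarrow>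
        (\<forall>C\<in>corners G U V. coset_finite G H C \<longleftrightarrow> coset_finite G K C))"


definition finitely_generated_in :: "('a, 'b) monoid_scheme \<Rightarrow> 'a set \<Rightarrow> bool" where
  "finitely_generated_in G H \<longleftrightarrow> (\<exists>A. finite A \<and> A \<subseteq> carrier G \<and> H = generate G A)"

definition group_system ::
    "('a, 'b) monoid_scheme \<Rightarrow> 'j set \<Rightarrow> ('j \<Rightarrow> 'a set) \<Rightarrow> bool" where
  "group_system G J S \<longleftrightarrow> group G \<and> (\<forall>j\<in>J. subgroup (S j) G)"

definition finite_type ::
    "('a, 'b) monoid_scheme \<Rightarrow> 'j set \<Rightarrow> ('j \<Rightarrow> 'a set) \<Rightarrow> bool" where
  "finite_type G J S \<longleftrightarrow>
     countable (carrier G) \<and> finite J \<and>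
     (\<exists>A. finite A \<and> A \<subseteq> carrier G \<and> carrier G = generate G ((\<Union>j\<in>J. S j) \<union> A))"

definition strictly_adapted :: "('a, 'b) monoid_scheme \<Rightarrow> 'a set \<Rightarrow> 'a set \<Rightarrow> bool" where
  "strictly_adapted G X S \<longleftrightarrow>
     (\<forall>g\<in>carrier G. g <#\<^bsub>G\<^esub> S \<subseteq> X \<or> g <#\<^bsub>G\<^esub> S \<subseteq> carrier G - X)"

definition adapted :: "('a, 'b) monoid_scheme \<Rightarrow> 'a set \<Rightarrow> 'a set \<Rightarrow> bool" where
  "adapted G X S \<longleftrightarrow>
     (\<exists>H' Y. almost_invariant G H' Y \<and> strictly_adapted G Y S \<and> equivalent G X Y)"

definition family_adapted ::
    "('a, 'b) monoid_scheme \<Rightarrow> 'j set \<Rightarrow> ('j \<Rightarrow> 'a set) \<Rightarrow> 'a set \<Rightarrow> bool" where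
  "family_adapted G J S X \<longleftrightarrow> (\<forall>j\<in>J. adapted G X (S j))"


definition translates :: "('a, 'b) monoid_scheme \<Rightarrow> 'i set \<Rightarrow> ('i \<Rightarrow> 'a set) \<Rightarrow> 'a set set" where
  "translates G I X =
     (\<Union>i\<in>I. \<Union>g\<in>carrier G. {g <#\<^bsub>G\<^esub> X i, g <#\<^bsub>G\<^esub> (carrier G - X i)})"

text \<open>
  The translates together with every almost invariant set equivalent to a translate that crosses
  some translate. That the set is almost invariant and nontrivial is part of \<open>equivalent\<close>.
\<close>

definition full_family :: "('a, 'b) monoid_scheme \<Rightarrow> 'i set \<Rightarrow> ('i \<Rightarrow> 'a set) \<Rightarrow> 'a set set" where
  "full_family G I X =
     translates G I X \<union>
     {Y. \<exists>Z\<in>translates G I X. equivalent G Y Z \<and> (\<exists>W\<in>translates G I X. crosses G Z W)}"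

definition isolated_elements :: "('a, 'b) monoid_scheme \<Rightarrow> 'a set set \<Rightarrow> 'a set set" where
  "isolated_elements G \<F> = {U \<in> \<F>. \<forall>V\<in>\<F>. \<not> crosses G U V}"

definition rn_ready :: "('a, 'b) monoid_scheme \<Rightarrow> 'i set \<Rightarrow> ('i \<Rightarrow> 'a set) \<Rightarrow> bool" where
  "rn_ready G I X \<longleftrightarrow>
     (\<forall>i\<in>I. \<exists>H. nontrivial_almost_invariant G H (X i)) \<and>
     corner_symmetric G (full_family G I X) \<and>
     (\<forall>U\<in>isolated_elements G (full_family G I X).
        \<forall>V\<in>isolated_elements G (full_family G I X). nested G U V)"

text \<open>The set of cross-connected components of a family of almost invariant sets.\<close>

definition cccs :: "('a, 'b) monoid_scheme \<Rightarrow> 'a set set \<Rightarrow> 'a set set set" where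
  "cccs G \<F> =
     \<F> // {(U, V) \<in> \<F> \<times> \<F>.
             equivclp (\<lambda>A B. A \<in> \<F> \<and> B \<in> \<F> \<and> (crosses G A B \<or> B = carrier G - A)) U V}"

definition ccc_between :: "'a set set \<Rightarrow> 'a set set \<Rightarrow> 'a set set \<Rightarrow> bool" where
  "ccc_between x y z \<longleftrightarrow>
     y \<noteq> x \<and> y \<noteq> z \<and> (\<exists>X\<in>x. \<exists>Y\<in>y. \<exists>Z\<in>z. X \<subseteq> Y \<and> Y \<subseteq> Z)"

definition discrete_betweenness :: "'a set set set \<Rightarrow> bool" where
  "discrete_betweenness P \<longleftrightarrow> (\<forall>x\<in>P. \<forall>z\<in>P. finite {y\<in>P. ccc_between x y z})"

text \<open>
  Existence of the algebraic regular neighbourhood: the given sets can be replaced by equivalent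
  ones forming an RN-ready family whose pretree of cross-connected components is discrete. The
  pretree axioms themselves are a consequence of RN-readiness, so only discreteness is required;
  the graph of groups is then constructed from this pretree.
\<close>

definition regular_neighbourhood_exists ::
    "('a, 'b) monoid_scheme \<Rightarrow> 'i set \<Rightarrow> ('i \<Rightarrow> 'a set) \<Rightarrow> bool" where
  "regular_neighbourhood_exists G I X \<longleftrightarrow>
     (\<exists>Y. (\<forall>i\<in>I. equivalent G (X i) (Y i)) \<and> rn_ready G I Y \<and>
          discrete_betweenness (cccs G (full_family G I Y)))"


subsection \<open>Independence of the subgroups\<close>

lemma coset_finite_subset:
  "coset_finite G H B \<Longrightarrow> A \<subseteq> B \<Longrightarrow> coset_finite G H A"
  unfolding coset_finite_def by blast

lemma coset_finite_Un:
  assumes "coset_finite G H A" "coset_finite G H B"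
  shows "coset_finite G H (A \<union> B)"
proof -
  obtain E F where "finite E" "E \<subseteq> carrier G" "A \<subseteq> (\<Union>g\<in>E. H #>\<^bsub>G\<^esub> g)"
    "finite F" "F \<subseteq> carrier G" "B \<subseteq> (\<Union>g\<in>F. H #>\<^bsub>G\<^esub> g)"
    using assms unfolding coset_finite_def by blast
  then show ?thesis unfolding coset_finite_def by (intro exI[of _ "E \<union> F"]) auto
qed

lemma coset_finite_rcoset:
  assumes "group G" "subgroup H G" "coset_finite G H A" "a \<in> carrier G"
  shows "coset_finite G H (A #>\<^bsub>G\<^esub> a)"
proof -
  interpret group G by fact
  have HG: "H \<subseteq> carrier G" using assms(2) by (rule subgroup.subset)
  obtain F where F: "finite F" "F \<subseteq> carrier G" "A \<subseteq> (\<Union>g\<in>F. H #>\<^bsub>G\<^esub> g)"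
    using assms unfolding coset_finite_def by blast
  have "A #>\<^bsub>G\<^esub> a \<subseteq> (\<Union>g\<in>(\<lambda>g. g \<otimes>\<^bsub>G\<^esub> a) ` F. H #>\<^bsub>G\<^esub> g)"
  proof
    fix y assume "y \<in> A #>\<^bsub>G\<^esub> a"
    then obtain x where x: "x \<in> A" "y = x \<otimes>\<^bsub>G\<^esub> a" unfolding r_coset_def by blast
    then obtain g h where "g \<in> F" "h \<in> H" "x = h \<otimes>\<^bsub>G\<^esub> g" using F unfolding r_coset_def by blast
    then have "y = h \<otimes>\<^bsub>G\<^esub> (g \<otimes>\<^bsub>G\<^esub> a)" using x F HG assms(4) by (auto simp: m_assoc subset_iff)
    then show "y \<in> (\<Union>g\<in>(\<lambda>g. g \<otimes>\<^bsub>G\<^esub> a) ` F. H #>\<^bsub>G\<^esub> g)"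
      using \<open>g \<in> F\<close> \<open>h \<in> H\<close> unfolding r_coset_def by blast
  qed
  moreover have "(\<lambda>g. g \<otimes>\<^bsub>G\<^esub> a) ` F \<subseteq> carrier G" using F assms(4) by auto
  ultimately show ?thesis using F(1) unfolding coset_finite_def by blast
qed

lemma coset_finite_mono:
  assumes G: "group G" and H: "subgroup H G" and K: "subgroup K G"
    and d: "d \<in> carrier G" "coset_finite G K (H #>\<^bsub>G\<^esub> d)" and A: "coset_finite G H A"
  shows "coset_finite G K A"
proof -
  interpret group G by fact
  have HG: "H \<subseteq> carrier G" using H by (rule subgroup.subset)
  have *: "coset_finite G K (H #>\<^bsub>G\<^esub> g)" if "g \<in> carrier G" for g
  proof -
    have "coset_finite G K ((H #>\<^bsub>G\<^esub> d) #>\<^bsub>G\<^esub> (inv\<^bsub>G\<^esub> d \<otimes>\<^bsub>G\<^esub> g))"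
      by (rule coset_finite_rcoset[OF G K d(2)]) (use that d in auto)
    also have "(H #>\<^bsub>G\<^esub> d) #>\<^bsub>G\<^esub> (inv\<^bsub>G\<^esub> d \<otimes>\<^bsub>G\<^esub> g) = H #>\<^bsub>G\<^esub> g"
      using that d HG by (simp add: coset_mult_assoc m_assoc[symmetric])
    finally show ?thesis .
  qed
  obtain F where F: "finite F" "F \<subseteq> carrier G" "A \<subseteq> (\<Union>g\<in>F. H #>\<^bsub>G\<^esub> g)"
    using A unfolding coset_finite_def by blast
  have "coset_finite G K (\<Union>g\<in>F. H #>\<^bsub>G\<^esub> g)" using F(1,2)
  proof (induction rule: finite_induct)
    case empty
    show ?case unfolding coset_finite_def by (intro exI[of _ "{}"]) auto
  next
    case (insert x F)
    then show ?case using coset_finite_Un[OF *[of x]] by simp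
  qed
  then show ?thesis using F(3) by (rule coset_finite_subset)
qed

lemma mem_rcosetI: "x \<in> A \<Longrightarrow> y = x \<otimes>\<^bsub>G\<^esub> g \<Longrightarrow> y \<in> A #>\<^bsub>G\<^esub> g"
  unfolding r_coset_def by blast

lemma almost_invariant_mult_closed:
  "almost_invariant G H X \<Longrightarrow> h \<in> H \<Longrightarrow> x \<in> X \<Longrightarrow> h \<otimes>\<^bsub>G\<^esub> x \<in> X"
  unfolding almost_invariant_def set_mult_def by blast

lemma almost_invariant_rcoset_mult_closed:
  assumes "group G" "almost_invariant G H X" "h \<in> H" "x \<in> X #>\<^bsub>G\<^esub> g" "g \<in> carrier G"
  shows "h \<otimes>\<^bsub>G\<^esub> x \<in> X #>\<^bsub>G\<^esub> g"
proof -
  interpret group G by fact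
  obtain u where u: "u \<in> X" "x = u \<otimes>\<^bsub>G\<^esub> g" using assms(4) unfolding r_coset_def by blast
  have "h \<in> carrier G" "u \<in> carrier G"
    using assms(2,3) u subgroup.subset unfolding almost_invariant_def by blast+
  then have "h \<otimes>\<^bsub>G\<^esub> x = (h \<otimes>\<^bsub>G\<^esub> u) \<otimes>\<^bsub>G\<^esub> g" using u assms(5) by (simp add: m_assoc)
  then show ?thesis using almost_invariant_mult_closed[OF assms(2,3) u(1)] by (rule mem_rcosetI[rotated])
qed

lemma almost_invariant_sym_diff_coset:
  assumes G: "group G" and X: "almost_invariant G H X" and g: "g \<in> carrier G"
    and d: "d \<in> sym_diff X (X #>\<^bsub>G\<^esub> g)"
  shows "H #>\<^bsub>G\<^esub> d \<subseteq> sym_diff X (X #>\<^bsub>G\<^esub> g)"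
proof -
  interpret group G by fact
  have H: "subgroup H G" and XG: "X \<subseteq> carrier G" using X unfolding almost_invariant_def by auto
  have dG: "d \<in> carrier G" using d XG g r_coset_subset_G by blast
  have cl: "h \<otimes>\<^bsub>G\<^esub> d \<in> B \<longleftrightarrow> d \<in> B"
    if "\<And>h x. h \<in> H \<Longrightarrow> x \<in> B \<Longrightarrow> h \<otimes>\<^bsub>G\<^esub> x \<in> B" "h \<in> H" for B h
  proof
    assume "h \<otimes>\<^bsub>G\<^esub> d \<in> B"
    then have "inv\<^bsub>G\<^esub> h \<otimes>\<^bsub>G\<^esub> (h \<otimes>\<^bsub>G\<^esub> d) \<in> B"
      using that subgroup.m_inv_closed[OF H] by blast
    moreover have "h \<in> carrier G" using that(2) H subgroup.subset by blast
    ultimately show "d \<in> B" using dG by (simp add: m_assoc[symmetric])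
  qed (use that in blast)
  show ?thesis
  proof
    fix y assume "y \<in> H #>\<^bsub>G\<^esub> d"
    then obtain h where h: "h \<in> H" "y = h \<otimes>\<^bsub>G\<^esub> d" unfolding r_coset_def by blast
    have "y \<in> X \<longleftrightarrow> d \<in> X"
      unfolding h(2) by (rule cl[OF almost_invariant_mult_closed[OF X] h(1)])
    moreover have "y \<in> X #>\<^bsub>G\<^esub> g \<longleftrightarrow> d \<in> X #>\<^bsub>G\<^esub> g"
      unfolding h(2) by (rule cl[OF almost_invariant_rcoset_mult_closed[OF G X _ _ g] h(1)])
    ultimately show "y \<in> sym_diff X (X #>\<^bsub>G\<^esub> g)" using d by blast
  qed
qed

lemma separating_translate:
  assumes "group G" "X \<subseteq> carrier G" "x \<in> X" "y \<in> carrier G" "y \<notin> X"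
  defines "g \<equiv> inv\<^bsub>G\<^esub> x \<otimes>\<^bsub>G\<^esub> y"
  shows "g \<in> carrier G" "x \<otimes>\<^bsub>G\<^esub> g = y" "y \<in> sym_diff X (X #>\<^bsub>G\<^esub> g)"
proof -
  interpret group G by fact
  have x: "x \<in> carrier G" using assms by auto
  show "g \<in> carrier G" unfolding g_def using x assms by auto
  show *: "x \<otimes>\<^bsub>G\<^esub> g = y" unfolding g_def using x assms by (simp add: m_assoc[symmetric])
  show "y \<in> sym_diff X (X #>\<^bsub>G\<^esub> g)" using assms(3,5) mem_rcosetI[OF assms(3) *[symmetric]] by blast
qed

lemma almost_invariant_coset_finite_imp:
  assumes G: "group G" and H: "almost_invariant G H X" and K: "almost_invariant G K X"
    and ne: "X \<noteq> {}" "X \<noteq> carrier G" and A: "coset_finite G H A"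
  shows "coset_finite G K A"
proof -
  have XG: "X \<subseteq> carrier G" using H unfolding almost_invariant_def by auto
  obtain x y where xy: "x \<in> X" "y \<in> carrier G" "y \<notin> X" using ne XG by blast
  note t = separating_translate[OF G XG xy]
  let ?D = "sym_diff X (X #>\<^bsub>G\<^esub> (inv\<^bsub>G\<^esub> x \<otimes>\<^bsub>G\<^esub> y))"
  have "H #>\<^bsub>G\<^esub> y \<subseteq> ?D" by (rule almost_invariant_sym_diff_coset[OF G H t(1,3)])
  moreover have "coset_finite G K ?D"
    using K t(1) unfolding almost_invariant_def almost_equal_def by blast
  ultimately have "coset_finite G K (H #>\<^bsub>G\<^esub> y)" using coset_finite_subset by blast
  moreover have "subgroup H G" "subgroup K G" using H K unfolding almost_invariant_def by auto
  ultimately show ?thesis using coset_finite_mono[OF G _ _ xy(2) _ A] by blast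
qed

lemma almost_invariant_coset_finite_iff:
  assumes "group G" "almost_invariant G H X" "almost_invariant G K X" "X \<noteq> {}" "X \<noteq> carrier G"
  shows "coset_finite G H A \<longleftrightarrow> coset_finite G K A"
  using almost_invariant_coset_finite_imp assms by blast

lemma coset_finite_empty: "coset_finite G H {}"
  unfolding coset_finite_def by (intro exI[of _ "{}"]) auto

lemma crosses_iff:
  assumes "group G" "almost_invariant G H U" "almost_invariant G K V"
  shows "crosses G U V \<longleftrightarrow> (\<forall>C\<in>corners G U V. \<not> coset_finite G K C)"
proof (cases "V = {} \<or> V = carrier G")
  case True
  then have "{} \<in> corners G U V" unfolding corners_def by auto
  then show ?thesis unfolding crosses_def using coset_finite_empty by blast
next
  case False
  then show ?thesis
    unfolding crosses_def using assms almost_invariant_coset_finite_iff[OF assms(1) _ assms(3)] by blast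
qed

lemma nontrivial_ne:
  assumes "nontrivial_almost_invariant G H X"
  shows "X \<noteq> {}" "X \<noteq> carrier G" "almost_invariant G H X"
  using assms coset_finite_empty unfolding nontrivial_almost_invariant_def by force+

lemma equivalent_iff:
  assumes "group G" "nontrivial_almost_invariant G H X" "nontrivial_almost_invariant G K Y"
  shows "equivalent G X Y \<longleftrightarrow> almost_equal G H X Y"
proof
  assume "equivalent G X Y"
  then obtain H' where H': "nontrivial_almost_invariant G H' X" "almost_equal G H' X Y"
    unfolding equivalent_def by blast
  show "almost_equal G H X Y"
    using H'(2) unfolding almost_equal_def
    by (rule almost_invariant_coset_finite_imp[OF assms(1) nontrivial_ne(3)[OF H'(1)]
          nontrivial_ne(3)[OF assms(2)] nontrivial_ne(1,2)[OF assms(2)]])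
qed (use assms in \<open>auto simp: equivalent_def\<close>)

lemma equivalent_sym:
  assumes G: "group G" and eq: "equivalent G X Y"
  shows "equivalent G Y X"
proof -
  interpret group G by fact
  obtain H K where H: "nontrivial_almost_invariant G H X" and K: "nontrivial_almost_invariant G K Y"
    and F0: "almost_equal G H X Y" using eq unfolding equivalent_def by blast
  define F where "F = sym_diff X Y"
  have F: "coset_finite G H F" using F0 unfolding F_def almost_equal_def .
  have sH: "subgroup H G" and sK: "subgroup K G" and XG: "X \<subseteq> carrier G" and YG: "Y \<subseteq> carrier G"
    using nontrivial_ne(3)[OF H] nontrivial_ne(3)[OF K] unfolding almost_invariant_def by auto
  obtain E where E: "finite E" "E \<subseteq> carrier G" "F \<subseteq> (\<Union>e\<in>E. H #>\<^bsub>G\<^esub> e)"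
    using F unfolding coset_finite_def by blast
  define C where "C = (\<Union>e\<in>E. H #>\<^bsub>G\<^esub> e)"
  have C: "coset_finite G H C" using E unfolding coset_finite_def C_def by blast
  have HG: "H \<subseteq> carrier G" using sH by (rule subgroup.subset)
  have CG: "C \<subseteq> carrier G" using E HG r_coset_subset_G unfolding C_def by blast
  have CH: "h \<otimes>\<^bsub>G\<^esub> c \<in> C \<Longrightarrow> h \<in> H \<Longrightarrow> c \<in> carrier G \<Longrightarrow> c \<in> C" for h c
  proof -
    assume a: "h \<otimes>\<^bsub>G\<^esub> c \<in> C" "h \<in> H" "c \<in> carrier G"
    obtain e k where ek: "e \<in> E" "k \<in> H" "h \<otimes>\<^bsub>G\<^esub> c = k \<otimes>\<^bsub>G\<^esub> e"
      using a(1) unfolding C_def r_coset_def by blast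
    have cG: "h \<in> carrier G" "k \<in> carrier G" "e \<in> carrier G" using a ek HG E by auto
    have "c = inv\<^bsub>G\<^esub> h \<otimes>\<^bsub>G\<^esub> (h \<otimes>\<^bsub>G\<^esub> c)" using a cG by (simp add: m_assoc[symmetric])
    also have "\<dots> = (inv\<^bsub>G\<^esub> h \<otimes>\<^bsub>G\<^esub> k) \<otimes>\<^bsub>G\<^esub> e" using ek cG by (simp add: m_assoc)
    finally show "c \<in> C"
      using ek a subgroup.m_inv_closed[OF sH] subgroup.m_closed[OF sH] unfolding C_def r_coset_def by blast
  qed
  have "\<not> X \<subseteq> C" "\<not> carrier G - X \<subseteq> C"
    using H C coset_finite_subset unfolding nontrivial_almost_invariant_def by blast+
  then obtain x y where xy: "x \<in> X" "y \<in> carrier G" "y \<notin> X" "x \<notin> C" "y \<notin> C" by blast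
  note t = separating_translate[OF G XG xy(1-3)]
  define g where "g = inv\<^bsub>G\<^esub> x \<otimes>\<^bsub>G\<^esub> y"
  have xG: "x \<in> carrier G" using xy XG by auto
  have gG: "g \<in> carrier G" and xg: "x \<otimes>\<^bsub>G\<^esub> g = y" and yD: "y \<in> sym_diff X (X #>\<^bsub>G\<^esub> g)"
    using t unfolding g_def by auto
  have "H #>\<^bsub>G\<^esub> y \<subseteq> sym_diff Y (Y #>\<^bsub>G\<^esub> g)"
  proof
    fix z assume z: "z \<in> H #>\<^bsub>G\<^esub> y"
    then obtain h where h: "h \<in> H" "z = h \<otimes>\<^bsub>G\<^esub> y" unfolding r_coset_def by blast
    have hG: "h \<in> carrier G" using h HG by auto
    have zD: "z \<in> sym_diff X (X #>\<^bsub>G\<^esub> g)"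
      using almost_invariant_sym_diff_coset[OF G nontrivial_ne(3)[OF H] gG yD] z by blast
    have "z \<notin> F" using CH[of h y] h xy E(3) unfolding C_def by blast
    moreover have "h \<otimes>\<^bsub>G\<^esub> x \<notin> F" using CH[of h x] h xy xG E(3) unfolding C_def by blast
    moreover have zx: "z = (h \<otimes>\<^bsub>G\<^esub> x) \<otimes>\<^bsub>G\<^esub> g" using h hG xG gG xg by (simp add: m_assoc)
    moreover have tr: "z \<in> B #>\<^bsub>G\<^esub> g \<longleftrightarrow> h \<otimes>\<^bsub>G\<^esub> x \<in> B" if "B \<subseteq> carrier G" for B
    proof
      assume "z \<in> B #>\<^bsub>G\<^esub> g"
      then obtain b where b: "b \<in> B" "z = b \<otimes>\<^bsub>G\<^esub> g" unfolding r_coset_def by blast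
      moreover have "b \<in> carrier G" "h \<otimes>\<^bsub>G\<^esub> x \<in> carrier G" using b that hG xG by auto
      ultimately have "b = h \<otimes>\<^bsub>G\<^esub> x" using zx gG right_cancel by metis
      then show "h \<otimes>\<^bsub>G\<^esub> x \<in> B" using b by simp
    qed (use zx mem_rcosetI in fast)
    ultimately show "z \<in> sym_diff Y (Y #>\<^bsub>G\<^esub> g)"
      using zD tr[OF XG] tr[OF YG] unfolding F_def by blast
  qed
  moreover have "coset_finite G K (sym_diff Y (Y #>\<^bsub>G\<^esub> g))"
    using nontrivial_ne(3)[OF K] gG unfolding almost_invariant_def almost_equal_def by blast
  ultimately have "coset_finite G K (H #>\<^bsub>G\<^esub> y)" using coset_finite_subset by blast
  then have "coset_finite G K F" using coset_finite_mono[OF G sH sK xy(2) _ F] by blast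
  then have "almost_equal G K Y X" unfolding almost_equal_def F_def by (simp add: Un_commute)
  then show ?thesis using H K unfolding equivalent_def by blast
qed

end

(*
  Write U <= V if U - V is finite modulo the stabilizer of U. Between nontrivial almost invariant
  sets this is a preorder compatible with complements, with no finiteness assumption at all: if A is
  K-finite and some coset K w misses U, then A meets U in a set covered by finitely many U - U g,
  because every coset of K is a right translate of K w. In particular crossing is corner symmetric.

  Finite generation enters once: if U and X have finitely generated stabilizing subgroups, then all
  translates of X outside finitely many orbits of the stabilizer of U are nested with U. The
  coboundaries of U and of the translate lie in coarsely connected sets that do not cut each other,
  and connectedness of the (relative) Cayley graph then empties a corner. Hence all translates V
  with U <= V and not V <= U contain U up to one exceptional set independent of V, and so share a
  point of U. As only finitely many translates separate two given points, intervals are finite;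
  this gives discreteness of the pretree.

  Isolated sets are made nested by passing to the dual tree. Equivalent sets are compared by counting
  cosets in U - V and V - U, which refines <= to a total invariant preorder on noncrossing sets.
  For a fixed isolated U, the set of all g for which the terminal vertex of the edge g U lies on the
  X side of the edge {X, X*} is equivalent to X, and these sets are nested.
*)
theory Submission
  imports Defs
begin

text \<open>Almost inclusion does not by itself give nested sets: it is not antisymmetric, and two
  sets that do not cross may still have four nonempty corners. Only isolated sets have to be
  repaired, since RN-readiness asks nestedness of them alone and \<open>full_family\<close> already
  contains every set equivalent to a translate that crosses something. The repair must commute with
  translation and complements and be monotone, so that comparability turns into inclusion; taking a
  side of an edge in a tree has these properties. No tree is constructed: the preorder records the
  position of edges. One isolated member can serve as reference for all, because its translates
  cross no translate in the family. The repaired set is equivalent to the old one because only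
  finitely many translates above the reference miss a given point; there equivalent translates have
  to be told apart. In the relative case a finite set of elements need not generate G, so its Cayley
  graph may be disconnected. Cone vertices over the cosets of the \<open>S j\<close> restore
  connectedness, and adaptedness keeps the coboundary finite modulo the stabilizer.\<close>

lemma coset_finite_UN:
  "finite I \<Longrightarrow> (\<And>i. i \<in> I \<Longrightarrow> coset_finite G H (A i)) \<Longrightarrow> coset_finite G H (\<Union>i\<in>I. A i)"
  by (induction I rule: finite_induct) (auto intro: coset_finite_Un coset_finite_empty)

lemma coset_finite_subgroup_mono:
  assumes "coset_finite G H A" "H \<subseteq> K" shows "coset_finite G K A"
proof -
  obtain F where F: "finite F" "F \<subseteq> carrier G" "A \<subseteq> (\<Union>f\<in>F. H #>\<^bsub>G\<^esub> f)"
    using assms unfolding coset_finite_def by blast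
  have "(\<Union>f\<in>F. H #>\<^bsub>G\<^esub> f) \<subseteq> (\<Union>f\<in>F. K #>\<^bsub>G\<^esub> f)"
    using assms(2) unfolding r_coset_def by blast
  with F(3) have "A \<subseteq> (\<Union>f\<in>F. K #>\<^bsub>G\<^esub> f)" by (rule subset_trans)
  with F(1,2) show ?thesis unfolding coset_finite_def by (intro exI[of _ F]) simp
qed

context group
begin

abbreviation compl :: "'a set \<Rightarrow> 'a set" where
  "compl U \<equiv> carrier G - U"

text \<open>The largest subgroup over which U can be almost invariant. It is a canonical choice, and
  for nontrivial U all possible subgroups have the same finite sets, so almost inclusion can be a
  relation between plain sets.\<close>

definition stab :: "'a set \<Rightarrow> 'a set" where
  "stab U = {g \<in> carrier G. g <# U = U}"

definition nontriv :: "'a set \<Rightarrow> bool" where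
  "nontriv U \<longleftrightarrow> (\<exists>H. nontrivial_almost_invariant G H U)"

definition almost_le :: "'a set \<Rightarrow> 'a set \<Rightarrow> bool" where
  "almost_le U V \<longleftrightarrow> coset_finite G (stab U) (U - V)"

subsection \<open>Translates and stabilizers\<close>

lemma inv_mult_cancel [simp]:
  "g \<in> carrier G \<Longrightarrow> x \<in> carrier G \<Longrightarrow> inv g \<otimes> (g \<otimes> x) = x"
  "g \<in> carrier G \<Longrightarrow> x \<in> carrier G \<Longrightarrow> g \<otimes> (inv g \<otimes> x) = x"
  by (simp_all add: m_assoc[symmetric])

lemma lcos_iff:
  "g \<in> carrier G \<Longrightarrow> U \<subseteq> carrier G \<Longrightarrow> x \<in> g <# U \<longleftrightarrow> x \<in> carrier G \<and> inv g \<otimes> x \<in> U"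
  unfolding l_coset_def by (auto simp: m_assoc[symmetric] subset_iff intro!: bexI[of _ "inv g \<otimes> x"])

lemma rcos_iff:
  "g \<in> carrier G \<Longrightarrow> U \<subseteq> carrier G \<Longrightarrow> x \<in> U #> g \<longleftrightarrow> x \<in> carrier G \<and> x \<otimes> inv g \<in> U"
  unfolding r_coset_def by (auto simp: m_assoc subset_iff intro!: bexI[of _ "x \<otimes> inv g"])

lemma lcos_sub: "g \<in> carrier G \<Longrightarrow> U \<subseteq> carrier G \<Longrightarrow> g <# U \<subseteq> carrier G"
  by (auto simp: lcos_iff)

lemma lcos_compl:
  "g \<in> carrier G \<Longrightarrow> U \<subseteq> carrier G \<Longrightarrow> g <# (compl U) = compl (g <# U)"
  by (auto simp: lcos_iff)

lemma lcos_diff: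
  "g \<in> carrier G \<Longrightarrow> U \<subseteq> carrier G \<Longrightarrow> V \<subseteq> carrier G \<Longrightarrow> g <# (U - V) = (g <# U) - (g <# V)"
  by (subst set_eq_iff, subst lcos_iff) (auto simp: lcos_iff)

lemma lcos_lcos:
  "g \<in> carrier G \<Longrightarrow> h \<in> carrier G \<Longrightarrow> U \<subseteq> carrier G \<Longrightarrow> g <# (h <# U) = (g \<otimes> h) <# U"
  by (rule lcos_m_assoc)

lemma lcos_inv:
  "g \<in> carrier G \<Longrightarrow> U \<subseteq> carrier G \<Longrightarrow> inv g <# (g <# U) = U"
  "g \<in> carrier G \<Longrightarrow> U \<subseteq> carrier G \<Longrightarrow> g <# (inv g <# U) = U"
  by (simp_all add: lcos_lcos lcos_mult_one)

lemma lcos_mono: "U \<subseteq> V \<Longrightarrow> g <# U \<subseteq> g <# V"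
  by (auto simp: l_coset_def)

lemma subgroup_stab:
  assumes U: "U \<subseteq> carrier G" shows "subgroup (stab U) G"
proof (rule subgroupI)
  have "\<one> \<in> stab U" using U by (simp add: stab_def lcos_mult_one)
  then show "stab U \<noteq> {}" by blast
  fix a assume a: "a \<in> stab U"
  then show "inv a \<in> stab U" using lcos_inv(1)[of a U] U unfolding stab_def by auto
next
  fix a b assume "a \<in> stab U" "b \<in> stab U"
  then show "a \<otimes> b \<in> stab U" using lcos_lcos[of a b U] U unfolding stab_def by auto
qed (auto simp: stab_def)

lemma stab_mem:
  assumes "U \<subseteq> carrier G" "g \<in> stab U" "x \<in> carrier G"
  shows "g \<otimes> x \<in> U \<longleftrightarrow> x \<in> U"
proof -
  have g: "g \<in> carrier G" "g <# U = U" using assms unfolding stab_def by auto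
  have "g \<otimes> x \<in> g <# U \<longleftrightarrow> x \<in> U"
    using g assms by (subst lcos_iff) (auto simp: m_assoc[symmetric])
  then show ?thesis using g by simp
qed

lemma stab_compl: "U \<subseteq> carrier G \<Longrightarrow> stab (compl U) = stab U"
proof -
  have "stab U \<subseteq> stab (compl U)" if "U \<subseteq> carrier G" for U
    using that lcos_compl unfolding stab_def by auto
  from this[of U] this[of "compl U"] show "U \<subseteq> carrier G \<Longrightarrow> ?thesis"
    by (simp add: double_diff)
qed

lemma subset_stab:
  assumes "almost_invariant G H U" shows "H \<subseteq> stab U"
proof
  fix h assume h: "h \<in> H"
  have H: "subgroup H G" and U: "U \<subseteq> carrier G" using assms unfolding almost_invariant_def by auto
  have hG: "h \<in> carrier G" using h H subgroup.subset by blast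
  have 1: "k <# U \<subseteq> U" if "k \<in> H" for k
    using almost_invariant_mult_closed[OF assms that] unfolding l_coset_def by blast
  have "h <# (inv h <# U) \<subseteq> h <# U"
    by (rule lcos_mono, rule 1, rule subgroup.m_inv_closed[OF H h])
  then show "h \<in> stab U" using 1[OF h] hG U unfolding stab_def by (simp add: lcos_inv)
qed

text \<open>Passing from H up to the stabilizer keeps finite sets finite, so U stays almost
  invariant. Conversely, as U is neither empty nor everything, a whole coset of the stabilizer lies
  in some symmetric difference of U and \<open>U #> g\<close>, which is H-finite.\<close>

lemma nontrivial_almost_invariant_stab:
  assumes "nontrivial_almost_invariant G H U"
  shows "nontrivial_almost_invariant G (stab U) U" "coset_finite G H A \<longleftrightarrow> coset_finite G (stab U) A"
proof -
  have a: "almost_invariant G H U" using assms nontrivial_ne(3) by blast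
  have U: "U \<subseteq> carrier G" using a unfolding almost_invariant_def by auto
  have s: "stab U <#> U = U"
    using stab_mem[OF U] U subgroup.one_closed[OF subgroup_stab[OF U]]
    unfolding set_mult_def by (auto simp: subset_iff)
  have b: "almost_invariant G (stab U) U"
    using a s subgroup_stab[OF U] coset_finite_subgroup_mono[OF _ subset_stab[OF a]]
    unfolding almost_invariant_def almost_equal_def by blast
  have iff: "coset_finite G H A \<longleftrightarrow> coset_finite G (stab U) A" for A
    by (rule almost_invariant_coset_finite_iff[OF is_group a b nontrivial_ne(1,2)[OF assms]])
  show "coset_finite G H A \<longleftrightarrow> coset_finite G (stab U) A" by (rule iff)
  show "nontrivial_almost_invariant G (stab U) U"
    using assms b iff unfolding nontrivial_almost_invariant_def by blast
qed

lemma nontrivD: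
  assumes "nontriv U"
  shows "nontrivial_almost_invariant G (stab U) U" "almost_invariant G (stab U) U" "U \<subseteq> carrier G"
    "subgroup (stab U) G" "\<not> coset_finite G (stab U) U" "\<not> coset_finite G (stab U) (compl U)"
    "\<And>g. g \<in> carrier G \<Longrightarrow> coset_finite G (stab U) (sym_diff U (U #> g))"
    "\<And>h. h \<in> stab U \<Longrightarrow> h \<in> carrier G" "U \<noteq> {}" "U \<noteq> carrier G"
proof -
  show *: "nontrivial_almost_invariant G (stab U) U" using assms nontrivial_almost_invariant_stab(1) unfolding nontriv_def by blast
  show "almost_invariant G (stab U) U" "U \<subseteq> carrier G"
    "subgroup (stab U) G" "\<not> coset_finite G (stab U) U" "\<not> coset_finite G (stab U) (compl U)"
    "\<And>g. g \<in> carrier G \<Longrightarrow> coset_finite G (stab U) (sym_diff U (U #> g))"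
    using * unfolding nontrivial_almost_invariant_def almost_invariant_def almost_equal_def by auto
  show "\<And>h. h \<in> stab U \<Longrightarrow> h \<in> carrier G" unfolding stab_def by simp
  show "U \<noteq> {}" "U \<noteq> carrier G" using nontrivial_ne[OF *] by auto
qed

lemma rcos_compl: "g \<in> carrier G \<Longrightarrow> U \<subseteq> carrier G \<Longrightarrow> compl U #> g = compl (U #> g)"
  by (auto simp: rcos_iff)

lemma sym_diff_compl:
  "U \<subseteq> carrier G \<Longrightarrow> V \<subseteq> carrier G \<Longrightarrow> sym_diff (compl U) (compl V) = sym_diff U V"
  by auto

lemma rcos_sub: "g \<in> carrier G \<Longrightarrow> U \<subseteq> carrier G \<Longrightarrow> U #> g \<subseteq> carrier G"
  by (auto simp: rcos_iff)

lemma nontrivial_almost_invariant_compl: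
  assumes "nontrivial_almost_invariant G H U"
  shows "nontrivial_almost_invariant G H (compl U)"
proof -
  have a: "almost_invariant G H U" using assms nontrivial_ne(3) by blast
  have U: "U \<subseteq> carrier G" and H: "subgroup H G" using a unfolding almost_invariant_def by auto
  have HG: "H \<subseteq> carrier G" using H by (rule subgroup.subset)
  have mem: "h \<otimes> x \<in> U \<longleftrightarrow> x \<in> U" if "h \<in> H" "x \<in> carrier G" for h x
    using stab_mem[OF U _ that(2)] subset_stab[OF a] that by auto
  have "H <#> compl U = compl U"
  proof
    show "H <#> compl U \<subseteq> compl U" using mem HG unfolding set_mult_def by auto
    show "compl U \<subseteq> H <#> compl U"
      using subgroup.one_closed[OF H] unfolding set_mult_def
      by (auto intro!: bexI[of _ "\<one>"])
  qed
  moreover have "almost_equal G H (compl U) (compl U #> g)" if "g \<in> carrier G" for g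
    using a that U rcos_sub[OF that U] unfolding almost_invariant_def almost_equal_def
    by (simp add: rcos_compl sym_diff_compl)
  ultimately show ?thesis
    using assms H U unfolding nontrivial_almost_invariant_def almost_invariant_def
    by (simp add: double_diff)
qed

lemma nontriv_compl: "nontriv U \<Longrightarrow> nontriv (compl U)"
  using nontrivial_almost_invariant_compl unfolding nontriv_def by blast

lemma stab_lcos:
  assumes "g \<in> carrier G" "U \<subseteq> carrier G" "h \<in> carrier G"
  shows "h \<in> stab (g <# U) \<longleftrightarrow> inv g \<otimes> h \<otimes> g \<in> stab U"
proof -
  have "h <# (g <# U) = g <# U \<longleftrightarrow> inv g <# (h <# (g <# U)) = U"
  proof
    assume *: "inv g <# (h <# (g <# U)) = U"
    have "g <# (inv g <# (h <# (g <# U))) = h <# (g <# U)"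
      using assms by (intro lcos_inv(2) lcos_sub) auto
    then show "h <# (g <# U) = g <# U" using * by simp
  qed (use assms lcos_inv in simp)
  also have "inv g <# (h <# (g <# U)) = (inv g \<otimes> h \<otimes> g) <# U"
    using assms lcos_sub[of g U] lcos_sub[of h "g <# U"] by (simp add: lcos_lcos m_assoc)
  finally show ?thesis using assms unfolding stab_def by simp
qed

lemma coset_finite_lcos:
  assumes g: "g \<in> carrier G" and U: "U \<subseteq> carrier G"
    and A: "A \<subseteq> carrier G" "coset_finite G (stab U) A"
  shows "coset_finite G (stab (g <# U)) (g <# A)"
proof -
  obtain F where F: "finite F" "F \<subseteq> carrier G" "A \<subseteq> (\<Union>f\<in>F. stab U #> f)"
    using A unfolding coset_finite_def by blast
  have "g <# A \<subseteq> (\<Union>f\<in>(\<lambda>f. g \<otimes> f) ` F. stab (g <# U) #> f)"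
  proof
    fix x assume "x \<in> g <# A"
    then obtain a where a: "a \<in> A" "x = g \<otimes> a" unfolding l_coset_def by blast
    then obtain f h where f: "f \<in> F" "h \<in> stab U" "a = h \<otimes> f" using F unfolding r_coset_def by blast
    have G: "h \<in> carrier G" "f \<in> carrier G" using f F unfolding stab_def by auto
    have "g \<otimes> h \<otimes> inv g \<in> stab (g <# U)"
      using G g U f by (subst stab_lcos) (auto simp: m_assoc)
    moreover have "x = (g \<otimes> h \<otimes> inv g) \<otimes> (g \<otimes> f)"
      using a f G g by (simp add: m_assoc)
    ultimately show "x \<in> (\<Union>f\<in>(\<lambda>f. g \<otimes> f) ` F. stab (g <# U) #> f)"
      using f unfolding r_coset_def by blast
  qed
  moreover have "(\<lambda>f. g \<otimes> f) ` F \<subseteq> carrier G" using F g by auto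
  ultimately show ?thesis using F(1) unfolding coset_finite_def by blast
qed

lemma nontriv_lcos:
  assumes g: "g \<in> carrier G" and U: "nontriv U" shows "nontriv (g <# U)"
proof -
  note UG = nontrivD(3)[OF U]
  let ?V = "g <# U"
  have VG: "?V \<subseteq> carrier G" using g UG by (rule lcos_sub)
  have fin: "coset_finite G (stab U) A" if "coset_finite G (stab ?V) (g <# A)" "A \<subseteq> carrier G" for A
    using coset_finite_lcos[OF _ VG _ that(1), of "inv g"] g that UG by (simp add: lcos_inv lcos_sub)
  have 1: "\<not> coset_finite G (stab ?V) ?V" using fin nontrivD(5)[OF U] UG by blast
  have 2: "\<not> coset_finite G (stab ?V) (compl ?V)"
    using fin[of "compl U"] nontrivD(6)[OF U] UG g lcos_compl by auto
  have s: "stab ?V <#> ?V = ?V"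
    using stab_mem[OF VG] VG subgroup.one_closed[OF subgroup_stab[OF VG]]
    unfolding set_mult_def by (auto simp: subset_iff)
  have "coset_finite G (stab ?V) (sym_diff ?V (?V #> x))" if x: "x \<in> carrier G" for x
  proof -
    have "?V #> x = g <# (U #> x)" using x g UG by (simp add: coset_assoc)
    then have "sym_diff ?V (?V #> x) = g <# (sym_diff U (U #> x))"
      using g UG rcos_sub[OF x UG] by (simp add: lcos_diff[symmetric]) (simp add: l_coset_def)
    then show ?thesis using coset_finite_lcos[OF g UG _ nontrivD(7)[OF U x]] UG rcos_sub[OF x UG] by auto
  qed
  then show ?thesis using 1 2 s VG subgroup_stab[OF VG]
    unfolding nontriv_def nontrivial_almost_invariant_def almost_invariant_def almost_equal_def by blast
qed

subsection \<open>The preorder of almost inclusion\<close>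

text \<open>Every coset of \<open>K\<close> is a right translate of \<open>K w\<close>, so a \<open>K\<close>-finite subset of \<open>U\<close> is covered by
  finitely many sets \<open>U - U g\<close>.\<close>

lemma coset_finite_Int_if_coset_disjoint:
  assumes U: "almost_invariant G H U" and K: "K \<subseteq> carrier G" and A: "coset_finite G K A"
    and w: "w \<in> carrier G" "(K #> w) \<inter> U = {}"
  shows "coset_finite G H (U \<inter> A)"
proof -
  have UG: "U \<subseteq> carrier G" using U unfolding almost_invariant_def by auto
  obtain F where F: "finite F" "F \<subseteq> carrier G" "A \<subseteq> (\<Union>f\<in>F. K #> f)"
    using A unfolding coset_finite_def by blast
  have "U \<inter> A \<subseteq> (\<Union>f\<in>F. sym_diff U (U #> (inv w \<otimes> f)))"
  proof
    fix x assume x: "x \<in> U \<inter> A"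
    then obtain f k where f: "f \<in> F" "k \<in> K" "x = k \<otimes> f" using F unfolding r_coset_def by blast
    have G: "k \<in> carrier G" "f \<in> carrier G" using f K F by auto
    have "k \<otimes> w \<notin> U" using f w unfolding r_coset_def by blast
    moreover have "x \<otimes> inv (inv w \<otimes> f) = k \<otimes> w"
      using f G w by (simp add: inv_mult_group m_assoc)
    ultimately have "x \<notin> U #> (inv w \<otimes> f)" using w G UG by (simp add: rcos_iff)
    then show "x \<in> (\<Union>f\<in>F. sym_diff U (U #> (inv w \<otimes> f)))" using x f by blast
  qed
  moreover have "coset_finite G H (\<Union>f\<in>F. sym_diff U (U #> (inv w \<otimes> f)))"
    using U F w unfolding almost_invariant_def almost_equal_def
    by (intro coset_finite_UN) auto
  ultimately show ?thesis by (rule coset_finite_subset[rotated])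
qed

lemma exists_coset_outside:
  assumes H: "subgroup H G" and A: "coset_finite G H A" and U: "U \<subseteq> carrier G" "\<not> coset_finite G H U"
  obtains w where "w \<in> U" "(H #> w) \<inter> A = {}"
proof -
  obtain F where F: "finite F" "F \<subseteq> carrier G" "A \<subseteq> (\<Union>f\<in>F. H #> f)"
    using A unfolding coset_finite_def by blast
  have "\<not> U \<subseteq> (\<Union>f\<in>F. H #> f)" using U(2) F(1,2) unfolding coset_finite_def by simp
  then obtain w where w: "w \<in> U" "w \<notin> (\<Union>f\<in>F. H #> f)" by blast
  have "x \<notin> H #> f" if f: "f \<in> F" and x: "x \<in> H #> w" for x f
  proof
    assume xf: "x \<in> H #> f"
    have G: "w \<in> carrier G" "f \<in> carrier G" using f w U F by auto
    have "H #> w = H #> f"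
      using repr_independence[OF x G(1) H] repr_independence[OF xf G(2) H] by simp
    then have "w \<in> H #> f" using rcos_self[OF G(1) H] by simp
    then show False using w f by simp
  qed
  then have "(H #> w) \<inter> A = {}" using F(3) by blast
  then show ?thesis using w that by blast
qed

lemma nontriv_coset_in:
  assumes "nontriv U" "w \<in> U" shows "stab U #> w \<subseteq> U"
  using stab_mem[OF nontrivD(3)[OF assms(1)]] nontrivD(3)[OF assms(1)] assms unfolding r_coset_def by auto

text \<open>Since U is infinite modulo its stabilizer and \<open>U \<inter> V\<close> is not, some
  coset of \<open>stab U\<close> lies in U and avoids V. This is the coset that
  \<open>coset_finite_Int_if_coset_disjoint\<close>, applied to V, asks for.\<close>

lemma coset_finite_Int_swap:
  assumes U: "nontriv U" and V: "nontriv V" and f: "coset_finite G (stab U) (U \<inter> V)"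
  shows "coset_finite G (stab V) (U \<inter> V)"
proof -
  obtain w where w: "w \<in> U" "(stab U #> w) \<inter> (U \<inter> V) = {}"
    using exists_coset_outside[OF nontrivD(4)[OF U] f nontrivD(3,5)[OF U]] by blast
  have "stab U #> w \<subseteq> U" using nontriv_coset_in U w by blast
  then have "(stab U #> w) \<inter> V = {}" using w by blast
  then have "coset_finite G (stab V) (V \<inter> (U \<inter> V))"
    using coset_finite_Int_if_coset_disjoint[OF nontrivD(2)[OF V] _ f] nontrivD(3)[OF U] w nontrivD(8)[OF U] by blast
  then show ?thesis by (simp add: Int_commute Int_left_commute)
qed

lemma coset_finite_Int_iff:
  "nontriv U \<Longrightarrow> nontriv V \<Longrightarrow> coset_finite G (stab U) (U \<inter> V) \<longleftrightarrow> coset_finite G (stab V) (U \<inter> V)"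
  using coset_finite_Int_swap by (metis Int_commute)

lemma almost_le_Int: "nontriv U \<Longrightarrow> almost_le U V \<longleftrightarrow> coset_finite G (stab U) (U \<inter> compl V)"
proof -
  assume "nontriv U"
  then have "U - V = U \<inter> compl V" using nontrivD(3) by blast
  then show ?thesis unfolding almost_le_def by simp
qed

lemma almost_le_iff_right:
  assumes "nontriv U" "nontriv V" shows "almost_le U V \<longleftrightarrow> coset_finite G (stab V) (U - V)"
proof -
  have "U - V = U \<inter> compl V" using assms nontrivD(3) by blast
  then show ?thesis using coset_finite_Int_iff[OF assms(1) nontriv_compl[OF assms(2)]] assms
    by (simp add: almost_le_Int stab_compl nontrivD(3))
qed

lemma almost_le_compl:
  assumes "nontriv U" "nontriv V" shows "almost_le (compl V) (compl U) \<longleftrightarrow> almost_le U V"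
proof -
  have "compl V - compl U = U - V" using assms nontrivD(3) by blast
  then show ?thesis using almost_le_iff_right[OF assms] assms by (simp add: almost_le_def stab_compl nontrivD(3))
qed

lemma compl_compl [simp]: "nontriv U \<Longrightarrow> compl (compl U) = U"
  using nontrivD(3) by blast

lemma almost_le_compl_left: "nontriv U \<Longrightarrow> nontriv V \<Longrightarrow> almost_le (compl V) U \<longleftrightarrow> almost_le (compl U) V"
  using almost_le_compl[of "compl U" V] nontriv_compl by simp

lemma almost_le_compl_right: "nontriv U \<Longrightarrow> nontriv V \<Longrightarrow> almost_le U (compl V) \<longleftrightarrow> almost_le V (compl U)"
  using almost_le_compl[of V "compl U"] nontriv_compl by simp

lemma subset_almost_le: "U \<subseteq> V \<Longrightarrow> almost_le U V"
  unfolding almost_le_def using coset_finite_empty by (metis Diff_eq_empty_iff)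

lemma not_almost_le_compl: "nontriv U \<Longrightarrow> \<not> almost_le U (compl U)"
proof -
  assume "nontriv U"
  moreover have "U - compl U = U" using nontrivD(3)[OF \<open>nontriv U\<close>] by blast
  ultimately show ?thesis using nontrivD(5)[of U] unfolding almost_le_def by simp
qed

text \<open>Both differences are first collected modulo \<open>stab V\<close>, to which either
  hypothesis can be transferred. A coset of \<open>stab V\<close> in the complement of V that avoids
  them misses U, and this moves finiteness from \<open>stab V\<close> to
  \<open>stab U\<close>.\<close>

lemma almost_le_trans:
  assumes U: "nontriv U" and V: "nontriv V" and W: "nontriv W" and UV: "almost_le U V" and VW: "almost_le V W"
  shows "almost_le U W"
proof -
  define A where "A = (U - V) \<union> (V - W)"
  have A: "coset_finite G (stab V) A"
    using UV VW almost_le_iff_right[OF U V] unfolding A_def almost_le_def by (intro coset_finite_Un) auto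
  obtain w where w: "w \<in> compl V" "(stab V #> w) \<inter> A = {}"
    using exists_coset_outside[OF nontrivD(4)[OF V] A _ nontrivD(6)[OF V]] by blast
  have "stab V #> w \<subseteq> compl V"
    using nontriv_coset_in[OF nontriv_compl[OF V] w(1)] V by (simp add: stab_compl nontrivD(3))
  then have "(stab V #> w) \<inter> U = {}" using w unfolding A_def by blast
  then have "coset_finite G (stab U) (U \<inter> A)"
    using coset_finite_Int_if_coset_disjoint[OF nontrivD(2)[OF U] _ A] w nontrivD(8)[OF V] by blast
  then show ?thesis unfolding almost_le_def A_def by (rule coset_finite_subset) blast
qed

lemma almost_le_lcos:
  assumes g: "g \<in> carrier G" and U: "nontriv U" and V: "nontriv V"
  shows "almost_le (g <# U) (g <# V) \<longleftrightarrow> almost_le U V"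
proof -
  have *: "almost_le (g <# U) (g <# V)" if "g \<in> carrier G" "nontriv U" "nontriv V" "almost_le U V" for g U V
    using coset_finite_lcos[OF that(1) nontrivD(3)[OF that(2)], of "U - V"] that nontrivD(3)
    unfolding almost_le_def by (auto simp: lcos_diff[symmetric])
  then show ?thesis
    using *[OF _ nontriv_lcos[OF g U] nontriv_lcos[OF g V], of "inv g"] assms by (auto simp: lcos_inv nontrivD(3))
qed

definition sim :: "'a set \<Rightarrow> 'a set \<Rightarrow> bool" where
  "sim U V \<longleftrightarrow> almost_le U V \<and> almost_le V U"

lemma equivalent_iff_sim: "equivalent G U V \<longleftrightarrow> nontriv U \<and> nontriv V \<and> sim U V"
proof
  assume "equivalent G U V"
  then obtain H K where *: "nontrivial_almost_invariant G H U" "nontrivial_almost_invariant G K V"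
    "almost_equal G H U V" unfolding equivalent_def by blast
  then have a: "nontriv U" "nontriv V" unfolding nontriv_def by auto
  have "coset_finite G (stab U) (sym_diff U V)"
    using * nontrivial_almost_invariant_stab(2)[OF *(1)] unfolding almost_equal_def by blast
  then have "coset_finite G (stab U) (U - V)" "coset_finite G (stab U) (V - U)"
    by (auto elim: coset_finite_subset)
  then show "nontriv U \<and> nontriv V \<and> sim U V" using a almost_le_iff_right[of V U] unfolding sim_def almost_le_def by auto
next
  assume *: "nontriv U \<and> nontriv V \<and> sim U V"
  then have "coset_finite G (stab U) (U - V)" "coset_finite G (stab U) (V - U)"
    using almost_le_iff_right[of V U] unfolding sim_def almost_le_def by auto
  then have "almost_equal G (stab U) U V" unfolding almost_equal_def by (rule coset_finite_Un)
  then show "equivalent G U V" using * nontrivD(1) unfolding equivalent_def by blast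
qed

text \<open>Each corner is a difference of two sets taken among U, V and their complements, so
  crossing is expressed by the preorder alone. Its symmetry and its invariance under complements,
  equivalence and translation then follow formally.\<close>

lemma crosses_iff_almost_le:
  assumes "nontriv U" "nontriv V"
  shows "crosses G U V \<longleftrightarrow>
    \<not> almost_le U V \<and> \<not> almost_le U (compl V) \<and> \<not> almost_le (compl U) V \<and> \<not> almost_le (compl U) (compl V)"
proof -
  have c: "nontriv (compl U)" "nontriv (compl V)" using assms nontriv_compl by auto
  have "U \<inter> V = U - compl V" "compl U \<inter> V = compl U - compl V"
    "U \<inter> compl V = U - V" "compl U \<inter> compl V = compl U - V"
    using assms nontrivD(3) by blast+
  then show ?thesis
    using crosses_iff[OF is_group nontrivD(2)[OF assms(1)] nontrivD(2)[OF assms(2)]] assms c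
    unfolding corners_def by (simp add: almost_le_iff_right stab_compl nontrivD(3)) blast
qed

lemma crosses_sym:
  assumes "nontriv U" "nontriv V" shows "crosses G U V \<longleftrightarrow> crosses G V U"
  using assms almost_le_compl[of U V] almost_le_compl[of V U] almost_le_compl_left[of U V] almost_le_compl_right[of U V]
  by (auto simp: crosses_iff_almost_le)

lemma crosses_compl: "nontriv U \<Longrightarrow> nontriv V \<Longrightarrow> crosses G (compl U) V \<longleftrightarrow> crosses G U V"
  using crosses_iff_almost_le[of U V] crosses_iff_almost_le[OF nontriv_compl[of U], of V] by auto

lemma crosses_sim:
  assumes U: "nontriv U" and V: "nontriv V" and U': "nontriv U'" and s: "sim U U'" and c: "crosses G U V"
  shows "crosses G U' V"
proof -
  have "almost_le U U'" "almost_le (compl U) (compl U')" using s almost_le_compl[OF U' U] unfolding sim_def by auto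
  then have "almost_le U' W \<Longrightarrow> almost_le U W" "almost_le (compl U') W \<Longrightarrow> almost_le (compl U) W" if "nontriv W" for W
    using almost_le_trans[OF U U' that] almost_le_trans[OF nontriv_compl[OF U] nontriv_compl[OF U'] that] by auto
  then show ?thesis
    using c crosses_iff_almost_le[OF U V] crosses_iff_almost_le[OF U' V] V nontriv_compl[OF V] by blast
qed

lemma crosses_lcos:
  assumes "g \<in> carrier G" "nontriv U" "nontriv V"
  shows "crosses G (g <# U) (g <# V) \<longleftrightarrow> crosses G U V"
  using assms almost_le_lcos nontriv_lcos nontriv_compl by (simp add: crosses_iff_almost_le lcos_compl[symmetric] nontrivD(3))

text \<open>In effect, equivalent sets have commensurable stabilizers. One coset of
  \<open>stab U\<close> lies in V and another misses V, so the covering argument for V makes the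
  first one finite modulo \<open>stab V\<close>; all other cosets are right translates of
  it.\<close>

lemma sim_coset_finite:
  assumes U: "nontriv U" and V: "nontriv V" and s: "sim U V" and A: "coset_finite G (stab U) A"
  shows "coset_finite G (stab V) A"
proof -
  define D where "D = (U - V) \<union> (V - U)"
  have D: "coset_finite G (stab U) D"
    using s almost_le_iff_right[OF V U] unfolding D_def sim_def almost_le_def by (intro coset_finite_Un) auto
  obtain x where x: "x \<in> U" "(stab U #> x) \<inter> D = {}"
    using exists_coset_outside[OF nontrivD(4)[OF U] D nontrivD(3,5)[OF U]] by blast
  obtain y where y: "y \<in> compl U" "(stab U #> y) \<inter> D = {}"
    using exists_coset_outside[OF nontrivD(4)[OF U] D _ nontrivD(6)[OF U]] by blast
  have "stab U #> y \<subseteq> compl U"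
    using nontriv_coset_in[OF nontriv_compl[OF U] y(1)] U by (simp add: stab_compl nontrivD(3))
  then have y': "(stab U #> y) \<inter> V = {}" using y unfolding D_def by blast
  have x': "stab U #> x \<subseteq> V" using nontriv_coset_in[OF U x(1)] x unfolding D_def by blast
  have xG: "x \<in> carrier G" using x nontrivD(3)[OF U] by blast
  then have "coset_finite G (stab U) (stab U #> x)"
    unfolding coset_finite_def by (intro exI[of _ "{x}"]) auto
  then have "coset_finite G (stab V) (V \<inter> (stab U #> x))"
    using coset_finite_Int_if_coset_disjoint[OF nontrivD(2)[OF V] _ _ _ y'] y nontrivD(8)[OF U] by blast
  then have "coset_finite G (stab V) (stab U #> x)" using x' by (simp add: Int_absorb1 inf.absorb2)
  then show ?thesis by (rule coset_finite_mono[OF is_group nontrivD(4)[OF U] nontrivD(4)[OF V] xG _ A])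
qed

subsection \<open>Comparing equivalent sets by counting cosets\<close>

text \<open>For A invariant under L this counts the cosets contained in A. Since \<open>card\<close>
  is 0 on infinite sets, comparing counts is meaningful only for sets that are finite modulo
  L.\<close>

abbreviation ncosets :: "'a set \<Rightarrow> 'a set \<Rightarrow> nat" where
  "ncosets L A \<equiv> card ((\<lambda>x. L #> x) ` A)"

definition invariant :: "'a set \<Rightarrow> 'a set \<Rightarrow> bool" where
  "invariant L A \<longleftrightarrow> (\<forall>l\<in>L. \<forall>x\<in>carrier G. l \<otimes> x \<in> A \<longleftrightarrow> x \<in> A)"

lemma invariant_stab: "U \<subseteq> carrier G \<Longrightarrow> L \<subseteq> stab U \<Longrightarrow> invariant L U"
  unfolding invariant_def using stab_mem by blast

lemma invariant_ops:
  assumes "invariant L A" "invariant L B"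
  shows "invariant L (A - B)" "invariant L (A \<inter> B)" "invariant L (A \<union> B)"
  using assms unfolding invariant_def by auto

lemma invariant_coset:
  assumes "invariant L A" "A \<subseteq> carrier G" "x \<in> A" shows "L #> x \<subseteq> A"
  using assms unfolding invariant_def r_coset_def by auto

lemma finite_cosets:
  assumes L: "subgroup L G" and A: "A \<subseteq> carrier G" "coset_finite G L A"
  shows "finite ((\<lambda>x. L #> x) ` A)"
proof -
  obtain F where F: "finite F" "F \<subseteq> carrier G" "A \<subseteq> (\<Union>f\<in>F. L #> f)"
    using A unfolding coset_finite_def by blast
  have "(\<lambda>x. L #> x) ` A \<subseteq> (\<lambda>x. L #> x) ` F"
  proof (rule image_subsetI)
    fix x assume "x \<in> A"
    then obtain f where f: "f \<in> F" "x \<in> L #> f" using F(3) by blast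
    then have "L #> f = L #> x" using repr_independence[OF f(2) _ L] F(2) by blast
    then show "L #> x \<in> (\<lambda>x. L #> x) ` F" using f by (metis imageI)
  qed
  then show ?thesis using F(1) finite_surj by blast
qed

lemma cosets_disjoint:
  assumes L: "subgroup L G" and A: "A \<subseteq> carrier G" "invariant L A" and B: "B \<subseteq> carrier G" "A \<inter> B = {}"
  shows "(\<lambda>x. L #> x) ` A \<inter> (\<lambda>x. L #> x) ` B = {}"
proof -
  have "L #> a \<noteq> L #> b" if "a \<in> A" "b \<in> B" for a b
  proof
    assume "L #> a = L #> b"
    then have "b \<in> L #> a" using rcos_self[OF _ L, of b] that B by auto
    then have "b \<in> A" using invariant_coset[OF A(2,1) that(1)] by blast
    then show False using that B by blast
  qed
  then show ?thesis by auto
qed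

lemma ncosets_Un:
  assumes "subgroup L G" "A \<subseteq> carrier G" "invariant L A" "B \<subseteq> carrier G" "A \<inter> B = {}"
    "coset_finite G L A" "coset_finite G L B"
  shows "ncosets L (A \<union> B) = ncosets L A + ncosets L B"
  unfolding image_Un
  by (rule card_Un_disjoint) (use assms finite_cosets cosets_disjoint in auto)

lemma ncosets_rcos:
  assumes M: "subgroup M G" and L: "L \<subseteq> carrier G" and x: "x \<in> carrier G"
  shows "ncosets M (L #> x) = ncosets M L"
proof -
  have MG: "M \<subseteq> carrier G" using M by (rule subgroup.subset)
  have eq: "(M #> l) #> x = M #> (l \<otimes> x)" if "l \<in> L" for l
    using that L x MG by (simp add: coset_mult_assoc subsetD)
  have "(\<lambda>y. M #> y) ` (L #> x) = (\<lambda>C. C #> x) ` (\<lambda>l. M #> l) ` L"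
    using eq unfolding r_coset_def[of G L x] by (force simp: image_iff)
  moreover have "inj_on (\<lambda>C. C #> x) ((\<lambda>l. M #> l) ` L)"
  proof (rule inj_onI)
    fix C D assume "C \<in> (\<lambda>l. M #> l) ` L" "D \<in> (\<lambda>l. M #> l) ` L" and e: "C #> x = D #> x"
    then have "C \<subseteq> carrier G" "D \<subseteq> carrier G" using L r_coset_subset_G[OF MG] by auto
    then have "C #> x #> inv x = C" "D #> x #> inv x = D"
      using x coset_mult_assoc[of _ x "inv x"] by simp_all
    then show "C = D" unfolding e by (rule trans[OF sym])
  qed
  ultimately show ?thesis by (simp add: card_image)
qed

text \<open>\<open>ncosets M L\<close> is the index of M in L, and A is a disjoint union of
  L-cosets, each a right translate of L that splits into that many M-cosets. If A is nonempty, its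
  finiteness modulo M forces the index to be finite.\<close>

lemma ncosets_index:
  assumes M: "subgroup M G" and L: "subgroup L G" and M_le_L: "M \<subseteq> L"
    and A: "A \<subseteq> carrier G" "invariant L A" "coset_finite G M A"
  shows "ncosets M A = ncosets L A * ncosets M L"
proof -
  have LG: "L \<subseteq> carrier G" using L by (rule subgroup.subset)
  have finM: "finite ((\<lambda>x. M #> x) ` A)" using finite_cosets[OF M A(1,3)] .
  have finL: "finite ((\<lambda>x. L #> x) ` A)"
    using finite_cosets[OF L A(1)] coset_finite_subgroup_mono[OF A(3) M_le_L] by blast
  have sub: "C \<subseteq> A" if "C \<in> (\<lambda>x. L #> x) ` A" for C using that invariant_coset[OF A(2,1)] by blast
  have "(\<lambda>x. M #> x) ` A = (\<Union>C\<in>(\<lambda>x. L #> x) ` A. (\<lambda>x. M #> x) ` C)"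
  proof
    show "(\<lambda>x. M #> x) ` A \<subseteq> (\<Union>C\<in>(\<lambda>x. L #> x) ` A. (\<lambda>x. M #> x) ` C)"
    proof (rule image_subsetI)
      fix x assume x: "x \<in> A"
      then have "x \<in> L #> x" using rcos_self[OF _ L] A(1) by blast
      then show "M #> x \<in> (\<Union>C\<in>(\<lambda>x. L #> x) ` A. (\<lambda>x. M #> x) ` C)" using x by (intro UN_I) auto
    qed
    show "(\<Union>C\<in>(\<lambda>x. L #> x) ` A. (\<lambda>x. M #> x) ` C) \<subseteq> (\<lambda>x. M #> x) ` A"
      using sub by (intro UN_least image_mono) auto
  qed
  moreover have "card (\<Union>C\<in>(\<lambda>x. L #> x) ` A. (\<lambda>x. M #> x) ` C)
    = (\<Sum>C\<in>(\<lambda>x. L #> x) ` A. ncosets M C)"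
  proof (rule card_UN_disjoint[OF finL])
    show "\<forall>C\<in>(\<lambda>x. L #> x) ` A. finite ((\<lambda>x. M #> x) ` C)"
      using sub finM by (meson finite_subset image_mono)
    show "\<forall>C\<in>(\<lambda>x. L #> x) ` A. \<forall>D\<in>(\<lambda>x. L #> x) ` A. C \<noteq> D \<longrightarrow>
      (\<lambda>x. M #> x) ` C \<inter> (\<lambda>x. M #> x) ` D = {}"
    proof (intro ballI impI)
      fix C D assume C: "C \<in> (\<lambda>x. L #> x) ` A" and D: "D \<in> (\<lambda>x. L #> x) ` A" and ne: "C \<noteq> D"
      have "C \<inter> D = {}"
      proof (rule ccontr)
        assume "C \<inter> D \<noteq> {}"
        then obtain z where z: "z \<in> C" "z \<in> D" by blast
        obtain a b where ab: "a \<in> A" "C = L #> a" "b \<in> A" "D = L #> b" using C D by blast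
        then have "C = L #> z" "D = L #> z"
          using repr_independence[OF _ _ L] z A(1) by blast+
        then show False using ne by simp
      qed
      moreover have "invariant M C"
      proof -
        obtain a where a: "a \<in> carrier G" "C = L #> a" using C A(1) by blast
        have "l \<otimes> x \<in> L #> a \<longleftrightarrow> x \<in> L #> a" if "l \<in> M" "x \<in> carrier G" for l x
        proof -
          have l: "l \<in> L" "l \<in> carrier G" "inv l \<in> L" using that M_le_L LG subgroup.m_inv_closed[OF L] by auto
          have "k \<otimes> y \<in> L #> a" if k: "k \<in> L" and y: "y \<in> L #> a" for k y
          proof -
            obtain m where m: "m \<in> L" "y = m \<otimes> a" using y unfolding r_coset_def by blast
            then have "k \<otimes> y = (k \<otimes> m) \<otimes> a" using k LG a by (simp add: m_assoc subsetD)
            then show ?thesis using subgroup.m_closed[OF L k m(1)] unfolding r_coset_def by blast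
          qed
          from this[of l x] this[of "inv l" "l \<otimes> x"] show ?thesis using l that by auto
        qed
        then show ?thesis unfolding invariant_def a by blast
      qed
      ultimately show "(\<lambda>x. M #> x) ` C \<inter> (\<lambda>x. M #> x) ` D = {}"
        using cosets_disjoint[OF M, of C D] sub[OF C] sub[OF D] A(1) by blast
    qed
  qed
  moreover have "(\<Sum>C\<in>(\<lambda>x. L #> x) ` A. ncosets M C) = (\<Sum>C\<in>(\<lambda>x. L #> x) ` A. ncosets M L)"
    using ncosets_rcos[OF M LG] A(1) by (intro sum.cong) auto
  ultimately show ?thesis by simp
qed

text \<open>Both counts are multiplied by the same index, which may be cancelled once it is
  positive. This lets sets with different stabilizers be compared over one common subgroup.\<close>

lemma ncosets_le_iff:
  assumes M: "subgroup M G" and L: "subgroup L G" and M_le_L: "M \<subseteq> L"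
    and A: "A \<subseteq> carrier G" "invariant L A" "coset_finite G M A"
    and B: "B \<subseteq> carrier G" "invariant L B" "coset_finite G M B"
  shows "ncosets L A \<le> ncosets L B \<longleftrightarrow> ncosets M A \<le> ncosets M B"
proof (cases "A \<union> B = {}")
  case False
  then obtain x where x: "x \<in> carrier G" "L #> x \<subseteq> A \<union> B"
    using A(1) B(1) invariant_coset[OF A(2,1)] invariant_coset[OF B(2,1)] by blast
  \<comment> \<open>The value 0 would stand for an infinite index. It is excluded because the
    nonempty set \<open>A \<union> B\<close> contains a whole L-coset and is finite modulo
    M.\<close>
  have "finite ((\<lambda>x. M #> x) ` (L #> x))"
    using finite_cosets[OF M _ coset_finite_Un[OF A(3) B(3)]] A(1) B(1) x(2)
    by (meson Un_least finite_subset image_mono)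
  moreover have "L #> x \<noteq> {}" using rcos_self[OF x(1) L] by blast
  ultimately have "0 < ncosets M (L #> x)" by (simp add: card_gt_0_iff)
  then have "0 < ncosets M L" using ncosets_rcos[OF M subgroup.subset[OF L] x(1)] by simp
  then show ?thesis using ncosets_index[OF M L M_le_L A] ncosets_index[OF M L M_le_L B] by simp
qed simp

text \<open>A coset of H and a coset of K meet in the empty set or in a single coset of the
  intersection, so the two finite covers have a common finite refinement.\<close>

lemma coset_finite_Int_subgroup:
  assumes H: "subgroup H G" and K: "subgroup K G" and A: "coset_finite G H A" "coset_finite G K A"
  shows "coset_finite G (H \<inter> K) A"
proof -
  obtain E where E: "finite E" "E \<subseteq> carrier G" "A \<subseteq> (\<Union>f\<in>E. H #> f)"
    using A unfolding coset_finite_def by blast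
  obtain F where F: "finite F" "F \<subseteq> carrier G" "A \<subseteq> (\<Union>f\<in>F. K #> f)"
    using A unfolding coset_finite_def by blast
  have c: "coset_finite G (H \<inter> K) ((H #> e) \<inter> (K #> f))" if "e \<in> E" "f \<in> F" for e f
  proof (cases "(H #> e) \<inter> (K #> f) = {}")
    case False
    then obtain x where x: "x \<in> H #> e" "x \<in> K #> f" by blast
    have xG: "x \<in> carrier G" using x(1) that E(2) r_coset_subset_G subgroup.subset[OF H] by blast
    have "H #> e = H #> x" "K #> f = K #> x"
      using repr_independence[OF x(1) _ H] repr_independence[OF x(2) _ K] that E(2) F(2) by auto
    moreover have "(H #> x) \<inter> (K #> x) \<subseteq> (H \<inter> K) #> x"
    proof
      fix y assume "y \<in> (H #> x) \<inter> (K #> x)"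
      then obtain h k where hk: "h \<in> H" "k \<in> K" "y = h \<otimes> x" "y = k \<otimes> x"
        unfolding r_coset_def by blast
      then have "h = k" using xG subgroup.subset[OF H] subgroup.subset[OF K] by (metis right_cancel subsetD)
      then show "y \<in> (H \<inter> K) #> x" using hk unfolding r_coset_def by blast
    qed
    ultimately show ?thesis using xG unfolding coset_finite_def by (intro exI[of _ "{x}"]) auto
  qed (simp add: coset_finite_empty)
  have "coset_finite G (H \<inter> K) (\<Union>e\<in>E. \<Union>f\<in>F. (H #> e) \<inter> (K #> f))"
    by (intro coset_finite_UN E(1) F(1) c)
  moreover have "A \<subseteq> (\<Union>e\<in>E. \<Union>f\<in>F. (H #> e) \<inter> (K #> f))" using E(3) F(3) by blast
  ultimately show ?thesis by (rule coset_finite_subset)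
qed

text \<open>For equivalent U and V this compares the numbers of cosets in the two sets after their
  infinite common part has been cancelled. Both differences are invariant under the intersection of
  the stabilizers, and finite modulo it.\<close>

definition count_le :: "'a set \<Rightarrow> 'a set \<Rightarrow> bool" where
  "count_le U V \<longleftrightarrow> ncosets (stab U \<inter> stab V) (U - V) \<le> ncosets (stab U \<inter> stab V) (V - U)"

text \<open>Inside a finite window T that contains both differences, the comparison is one of
  ordinary numbers attached to U and to V separately. With a window shared by three sets,
  transitivity becomes that of the natural numbers.\<close>

lemma count_le_iff:
  assumes U: "U \<subseteq> carrier G" and V: "V \<subseteq> carrier G"
    and M: "subgroup M G" "M \<subseteq> stab U" "M \<subseteq> stab V"
    and T: "T \<subseteq> carrier G" "invariant M T" "coset_finite G M T" "U - V \<subseteq> T" "V - U \<subseteq> T"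
  shows "count_le U V \<longleftrightarrow> ncosets M (U \<inter> T) \<le> ncosets M (V \<inter> T)"
proof -
  let ?L = "stab U \<inter> stab V"
  have L: "subgroup ?L G"
    by (rule subgroups_Inter_pair[OF subgroup_stab[OF U] subgroup_stab[OF V]])
  have iL: "invariant ?L U" "invariant ?L V" using invariant_stab U V by auto
  have iM: "invariant M U" "invariant M V" using invariant_stab U V M by auto
  have f: "coset_finite G M (U - V)" "coset_finite G M (V - U)" "coset_finite G M (U \<inter> V \<inter> T)"
    using T coset_finite_subset by blast+
  have "count_le U V \<longleftrightarrow> ncosets M (U - V) \<le> ncosets M (V - U)"
    unfolding count_le_def using U V M f iL
    by (intro ncosets_le_iff[OF M(1) L]) (auto intro!: invariant_ops)
  moreover have "ncosets M (U \<inter> T) = ncosets M (U - V) + ncosets M (U \<inter> V \<inter> T)"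
  proof -
    have "U \<inter> T = (U - V) \<union> (U \<inter> V \<inter> T)" using T(4) by blast
    then show ?thesis using U V iM f
      by (simp only:) (intro ncosets_Un[OF M(1)], auto intro!: invariant_ops)
  qed
  moreover have "ncosets M (V \<inter> T) = ncosets M (V - U) + ncosets M (U \<inter> V \<inter> T)"
  proof -
    have "V \<inter> T = (V - U) \<union> (U \<inter> V \<inter> T)" using T(5) by blast
    then show ?thesis using U V iM f
      by (simp only:) (intro ncosets_Un[OF M(1)], auto intro!: invariant_ops)
  qed
  ultimately show ?thesis by simp
qed

lemma count_le_total: "count_le U V \<or> count_le V U"
  unfolding count_le_def by (simp add: Int_commute) linarith

lemma count_le_compl:
  assumes "U \<subseteq> carrier G" "V \<subseteq> carrier G" shows "count_le (compl V) (compl U) \<longleftrightarrow> count_le U V"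
proof -
  have "compl V - compl U = U - V" "compl U - compl V = V - U" using assms by auto
  then show ?thesis unfolding count_le_def by (simp add: stab_compl assms Int_commute)
qed

text \<open>For V inside U only the cosets in \<open>U - V\<close> are left to count. Equivalence
  makes them finite in number, so a count of 0 really means that there are none.\<close>

lemma count_le_subset_eq:
  assumes U: "nontriv U" and V: "nontriv V" and s: "sim U V" and UV: "V \<subseteq> U" "count_le U V"
  shows "U = V"
proof -
  let ?L = "stab U \<inter> stab V"
  have L: "subgroup ?L G" by (rule subgroups_Inter_pair[OF nontrivD(4)[OF U] nontrivD(4)[OF V]])
  have "coset_finite G ?L (U - V)"
    using coset_finite_Int_subgroup[OF nontrivD(4)[OF U] nontrivD(4)[OF V]] s almost_le_iff_right[OF U V]
    unfolding sim_def almost_le_def by blast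
  then have "finite ((\<lambda>x. ?L #> x) ` (U - V))"
    using finite_cosets[OF L] nontrivD(3)[OF U] by blast
  moreover have "V - U = {}" using UV by blast
  then have "ncosets ?L (U - V) = 0" using UV(2) unfolding count_le_def by (simp only:) simp
  ultimately have "U - V = {}" by simp
  then show ?thesis using UV by blast
qed

lemma sim_sym: "sim U V \<Longrightarrow> sim V U" unfolding sim_def by blast

lemma sim_trans: "nontriv U \<Longrightarrow> nontriv V \<Longrightarrow> nontriv W \<Longrightarrow> sim U V \<Longrightarrow> sim V W \<Longrightarrow> sim U W"
  unfolding sim_def using almost_le_trans by blast

lemma sim_diff_finite:
  assumes "nontriv U" "nontriv V" "sim U V"
  shows "coset_finite G (stab U) (U - V)" "coset_finite G (stab U) (V - U)"
  using assms almost_le_iff_right[of V U] unfolding sim_def almost_le_def by auto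

lemma count_le_trans:
  assumes U: "nontriv U" and V: "nontriv V" and W: "nontriv W" and s: "sim U V" "sim V W"
    and p: "count_le U V" "count_le V W"
  shows "count_le U W"
proof -
  let ?M = "stab U \<inter> stab V \<inter> stab W"
  \<comment> \<open>The window consists of all differences among the three sets. Equivalence makes
    it finite modulo each stabilizer, hence modulo their intersection.\<close>
  let ?T = "(U - V) \<union> (V - U) \<union> (V - W) \<union> (W - V) \<union> (U - W) \<union> (W - U)"
  note UG = nontrivD(3)[OF U] and VG = nontrivD(3)[OF V] and WG = nontrivD(3)[OF W]
  have sUW: "sim U W" using sim_trans U V W s by blast
  have UT: "coset_finite G (stab U) ?T"
    using sim_diff_finite[OF U V s(1)] sim_diff_finite[OF U W sUW]
      sim_coset_finite[OF V U sim_sym[OF s(1)]] sim_diff_finite[OF V W s(2)]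
    by (intro coset_finite_Un) auto
  have VT: "coset_finite G (stab V) ?T" by (rule sim_coset_finite[OF U V s(1) UT])
  have WT: "coset_finite G (stab W) ?T" by (rule sim_coset_finite[OF U W sUW UT])
  have L: "subgroup (stab U \<inter> stab V) G"
    by (rule subgroups_Inter_pair[OF nontrivD(4)[OF U] nontrivD(4)[OF V]])
  have M: "subgroup ?M G" using subgroups_Inter_pair[OF L nontrivD(4)[OF W]] .
  have fM: "coset_finite G ?M ?T"
    by (rule coset_finite_Int_subgroup[OF L nontrivD(4)[OF W] _ WT])
      (rule coset_finite_Int_subgroup[OF nontrivD(4)[OF U] nontrivD(4)[OF V] UT VT])
  have i: "invariant ?M U" "invariant ?M V" "invariant ?M W"
    using UG VG WG by (auto intro!: invariant_stab)
  have iT: "invariant ?M ?T" using i by (intro invariant_ops)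
  have TG: "?T \<subseteq> carrier G" using UG VG WG by blast
  have "ncosets ?M (U \<inter> ?T) \<le> ncosets ?M (V \<inter> ?T)"
    using p(1) by (subst (asm) count_le_iff[OF UG VG M _ _ TG iT fM]) auto
  also have "\<dots> \<le> ncosets ?M (W \<inter> ?T)"
    using p(2) by (subst (asm) count_le_iff[OF VG WG M _ _ TG iT fM]) auto
  finally show ?thesis by (subst count_le_iff[OF UG WG M _ _ TG iT fM]) auto
qed

lemma count_le_lcos:
  assumes g: "g \<in> carrier G" and U: "U \<subseteq> carrier G" and V: "V \<subseteq> carrier G"
  shows "count_le (g <# U) (g <# V) \<longleftrightarrow> count_le U V"
proof -
  let ?L = "stab U \<inter> stab V" and ?L' = "stab (g <# U) \<inter> stab (g <# V)"
  have c: "ncosets ?L' (g <# A) = ncosets ?L A" if A: "A \<subseteq> carrier G" for A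
  proof -
    \<comment> \<open>The stabilizers of the translates are conjugate by g, so left multiplication
      by g is a bijection between the two sets of cosets.\<close>
    have eq: "?L' #> (g \<otimes> x) = g <# (?L #> x)" if x: "x \<in> carrier G" for x
    proof (rule Set.set_eqI)
      fix y
      have LG: "?L \<subseteq> carrier G" "?L' \<subseteq> carrier G" unfolding stab_def by auto
      have "y \<in> ?L' #> (g \<otimes> x) \<longleftrightarrow> y \<in> carrier G \<and> y \<otimes> inv (g \<otimes> x) \<in> ?L'"
        using g x LG by (subst rcos_iff) auto
      also have "\<dots> \<longleftrightarrow> y \<in> carrier G \<and> inv g \<otimes> y \<otimes> inv x \<in> ?L"
        using g x U V by (auto simp: stab_lcos inv_mult_group m_assoc)
      also have "\<dots> \<longleftrightarrow> y \<in> g <# (?L #> x)"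
        using g x LG rcos_sub[OF x LG(1)] by (auto simp: lcos_iff rcos_iff)
      finally show "y \<in> ?L' #> (g \<otimes> x) \<longleftrightarrow> y \<in> g <# (?L #> x)" .
    qed
    have "(\<lambda>x. ?L' #> x) ` (g <# A) = (\<lambda>C. g <# C) ` (\<lambda>x. ?L #> x) ` A"
    proof -
      have "g <# A = (\<lambda>x. g \<otimes> x) ` A" unfolding l_coset_def by auto
      then show ?thesis using eq A by (simp only: image_image) (rule image_cong, auto)
    qed
    moreover have "inj_on (\<lambda>C. g <# C) ((\<lambda>x. ?L #> x) ` A)"
    proof (rule inj_onI)
      fix C D assume "C \<in> (\<lambda>x. ?L #> x) ` A" "D \<in> (\<lambda>x. ?L #> x) ` A" and e: "g <# C = g <# D"
      moreover have "?L #> x \<subseteq> carrier G" if "x \<in> A" for x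
        using that A by (intro rcos_sub) (auto simp: stab_def)
      ultimately have "C \<subseteq> carrier G" "D \<subseteq> carrier G" by auto
      then show "C = D" using e lcos_inv(1)[OF g] by metis
    qed
    ultimately show ?thesis by (simp add: card_image)
  qed
  have "U - V \<subseteq> carrier G" "V - U \<subseteq> carrier G" using U V by auto
  from this[THEN c] show ?thesis unfolding count_le_def using g U V by (simp add: lcos_diff)
qed

text \<open>Without the coset count, infinitely many equivalent translates, as for a half plane in
  \<open>\<int> \<times> \<int>\<close>, would be identified and the intervals of the order would be infinite.\<close>

definition tree_le :: "'a set \<Rightarrow> 'a set \<Rightarrow> bool" where
  "tree_le U V \<longleftrightarrow> almost_le U V \<and> (almost_le V U \<longrightarrow> count_le U V)"

lemma tree_le_trans:
  assumes U: "nontriv U" and V: "nontriv V" and W: "nontriv W" and UV: "tree_le U V" and VW: "tree_le V W"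
  shows "tree_le U W"
proof -
  have l: "almost_le U V" "almost_le V W" using UV VW unfolding tree_le_def by auto
  have "almost_le U W" by (rule almost_le_trans[OF U V W l])
  moreover have "count_le U W" if WU: "almost_le W U"
  proof -
    have "almost_le V U" "almost_le W V" using almost_le_trans[OF V W U l(2) WU] almost_le_trans[OF W U V WU l(1)] by auto
    then show ?thesis
      using count_le_trans[OF U V W] UV VW l unfolding tree_le_def sim_def by blast
  qed
  ultimately show ?thesis unfolding tree_le_def by blast
qed

lemma tree_le_compl: "nontriv U \<Longrightarrow> nontriv V \<Longrightarrow> tree_le (compl V) (compl U) \<longleftrightarrow> tree_le U V"
  unfolding tree_le_def by (simp add: almost_le_compl count_le_compl nontrivD(3))

lemma tree_le_lcos: "g \<in> carrier G \<Longrightarrow> nontriv U \<Longrightarrow> nontriv V \<Longrightarrow> tree_le (g <# U) (g <# V) \<longleftrightarrow> tree_le U V"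
  unfolding tree_le_def by (simp add: almost_le_lcos count_le_lcos nontrivD(3))

lemma almost_le_imp_tree_le: "almost_le U V \<Longrightarrow> tree_le U V \<or> tree_le V U"
  unfolding tree_le_def using count_le_total[of U V] by blast

text \<open>A finite corner gives an almost inclusion, and where it holds in both directions the
  count, being total, picks one.\<close>

lemma tree_le_total:
  assumes U: "nontriv U" and V: "nontriv V" and c: "\<not> crosses G U V"
  shows "tree_le U V \<or> tree_le V U \<or> tree_le U (compl V) \<or> tree_le (compl V) U"
proof -
  consider "almost_le U V" | "almost_le U (compl V)" | "almost_le (compl V) U" | "almost_le V U"
    using c crosses_iff_almost_le[OF U V] almost_le_compl[OF V U] almost_le_compl_left[OF U V] by blast
  then show ?thesis using almost_le_imp_tree_le by cases blast+
qed

lemma not_tree_le_compl: "nontriv U \<Longrightarrow> \<not> tree_le U (compl U)"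
  unfolding tree_le_def using not_almost_le_compl by blast

subsection \<open>Finiteness of families of translates\<close>

abbreviation orbit :: "'a set \<Rightarrow> 'a set set" where
  "orbit X \<equiv> (\<lambda>g. g <# X) ` carrier G"

lemma nontriv_orbit: "nontriv X \<Longrightarrow> V \<in> orbit X \<Longrightarrow> nontriv V"
  using nontriv_lcos by auto

lemma lcos_orbit:
  assumes X: "X \<subseteq> carrier G" and V: "V \<in> orbit X" and h: "h \<in> carrier G"
  shows "h <# V \<in> orbit X"
proof -
  obtain g where g: "g \<in> carrier G" "V = g <# X" using V by auto
  then have "h <# V = (h \<otimes> g) <# X" using X h by (simp add: lcos_lcos)
  then show ?thesis using g h by blast
qed

text \<open>If g X contains a but not b, then \<open>inv g \<otimes> b\<close> lies in the symmetric
  difference of X and \<open>X #> (inv a \<otimes> b)\<close>, which meets only finitely many cosets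
  of \<open>stab X\<close>. Each of these cosets determines g X.\<close>

lemma finite_separating:
  assumes X: "nontriv X" and a: "a \<in> carrier G" and b: "b \<in> carrier G"
  shows "finite {V \<in> orbit X. a \<in> V \<and> b \<notin> V}"
proof -
  note XG = nontrivD(3)[OF X]
  have c: "inv a \<otimes> b \<in> carrier G" using a b by simp
  obtain F where F: "finite F" "F \<subseteq> carrier G"
    "sym_diff X (X #> (inv a \<otimes> b)) \<subseteq> (\<Union>f\<in>F. stab X #> f)"
    using nontrivD(7)[OF X c] unfolding coset_finite_def by blast
  have "{V \<in> orbit X. a \<in> V \<and> b \<notin> V} \<subseteq> (\<lambda>f. (b \<otimes> inv f) <# X) ` F"
  proof
    fix V assume "V \<in> {V \<in> orbit X. a \<in> V \<and> b \<notin> V}"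
    then obtain g where g: "g \<in> carrier G" "V = g <# X" "a \<in> V" "b \<notin> V" by blast
    have m: "inv g \<otimes> a \<in> X" "inv g \<otimes> b \<notin> X" using g a b XG by (auto simp: lcos_iff)
    have "inv g \<otimes> b \<otimes> inv (inv a \<otimes> b) = inv g \<otimes> a"
      using a b g by (simp add: inv_mult_group m_assoc)
    then have "inv g \<otimes> b \<in> X #> (inv a \<otimes> b)" using m a b g XG by (simp add: rcos_iff)
    then obtain f where f: "f \<in> F" "inv g \<otimes> b \<in> stab X #> f" using m F(3) by blast
    then obtain k where k: "k \<in> stab X" "inv g \<otimes> b = k \<otimes> f" unfolding r_coset_def by blast
    have G: "k \<in> carrier G" "f \<in> carrier G" using k f F nontrivD(8)[OF X] by auto
    have gb: "g \<otimes> (k \<otimes> f) = b" using g(1) b by (simp flip: k(2))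
    have "b \<otimes> inv f = g \<otimes> k" unfolding gb[symmetric] using G g(1) by (simp add: m_assoc)
    then have "(b \<otimes> inv f) <# X = g <# (k <# X)" using G g(1) XG by (simp add: lcos_lcos)
    also have "\<dots> = V" using k g unfolding stab_def by simp
    finally show "V \<in> (\<lambda>f. (b \<otimes> inv f) <# X) ` F" using f by blast
  qed
  then show ?thesis using F(1) finite_surj by blast
qed

text \<open>A finitely generated \<open>H\<close> makes \<open>H F\<close> coarsely connected: a translate cutting it separates
  \<open>h p\<close> from \<open>h q\<close> for some \<open>h \<in> H\<close> and \<open>p, q\<close> in a fixed finite set.\<close>

lemma finite_orbits_cutting:
  assumes B: "finite B" "B \<subseteq> carrier G" and X: "nontriv X" and F: "finite F" "F \<subseteq> carrier G"
  shows "\<exists>\<V>. finite \<V> \<and> \<V> \<subseteq> orbit X \<and> (\<forall>V\<in>orbit X. (\<exists>h\<in>generate G B. h <# V \<in> \<V>) \<or>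
    (\<Union>f\<in>F. generate G B #> f) \<subseteq> V \<or> (\<Union>f\<in>F. generate G B #> f) \<inter> V = {})"
proof -
  let ?H = "generate G B"
  note XG = nontrivD(3)[OF X]
  have H: "subgroup ?H G" using generate_is_subgroup[OF B(2)] .
  have HG: "?H \<subseteq> carrier G" using H by (rule subgroup.subset)
  \<comment> \<open>Within \<open>H F\<close>, with H generated by B, an elementary step goes from h
    f to h b f or to h f'. Both ends of such a step have the form h p with p in P.\<close>
  define P where "P = F \<union> (\<lambda>(b, f). b \<otimes> f) ` (B \<times> F)"
  have P: "finite P" "P \<subseteq> carrier G" using B F unfolding P_def by auto
  define \<V> where "\<V> = (\<Union>p\<in>P. \<Union>q\<in>P. {V \<in> orbit X. p \<in> V \<and> q \<notin> V})"
  have fin: "finite \<V>" unfolding \<V>_def using P finite_separating[OF X] by (intro finite_UN_I) auto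
  have sub: "\<V> \<subseteq> orbit X" unfolding \<V>_def by blast
  have main: "(\<Union>f\<in>F. ?H #> f) \<subseteq> V \<or> (\<Union>f\<in>F. ?H #> f) \<inter> V = {}"
    if V: "V \<in> orbit X" and n: "\<not> (\<exists>h\<in>?H. h <# V \<in> \<V>)" for V
  proof -
    have VG: "V \<subseteq> carrier G" using nontrivD(3)[OF nontriv_orbit[OF X V]] .
    have sep: "h \<otimes> p \<in> V \<longleftrightarrow> h \<otimes> q \<in> V" if h: "h \<in> ?H" and p: "p \<in> P" and q: "q \<in> P" for h p q
    proof -
      have hi: "inv h \<in> ?H" "h \<in> carrier G" using subgroup.m_inv_closed[OF H h] subsetD[OF HG h] by auto
      have m: "x \<in> inv h <# V \<longleftrightarrow> h \<otimes> x \<in> V" if "x \<in> P" for x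
        using that P hi VG by (subst lcos_iff) auto
      have "inv h <# V \<in> orbit X" using lcos_orbit[OF XG V] hi by simp
      then have "p \<in> inv h <# V \<longleftrightarrow> q \<in> inv h <# V"
        using n hi(1) p q unfolding \<V>_def by blast
      then show ?thesis using m p q by simp
    qed
    \<comment> \<open>The base point h is quantified inside the claim because a product k l is
      handled by moving the base point from h to h k.\<close>
    have step: "\<forall>h\<in>?H. \<forall>f\<in>F. h \<otimes> k \<otimes> f \<in> V \<longleftrightarrow> h \<otimes> f \<in> V" if "k \<in> ?H" for k
      using that
    proof (induction k rule: generate.induct)
      case one
      show ?case using HG by (auto simp: subsetD)
    next
      case (incl b)
      have "h \<otimes> b \<otimes> f \<in> V \<longleftrightarrow> h \<otimes> f \<in> V" if h: "h \<in> ?H" and f: "f \<in> F" for h f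
        using sep[OF h, of "b \<otimes> f" f] incl h f B F HG unfolding P_def by (force simp: m_assoc subsetD)
      then show ?case by blast
    next
      case (inv b)
      have "h \<otimes> inv b \<otimes> f \<in> V \<longleftrightarrow> h \<otimes> f \<in> V" if h: "h \<in> ?H" and f: "f \<in> F" for h f
      proof -
        have h': "h \<otimes> inv b \<in> ?H"
          using subgroup.m_closed[OF H h] generate.inv[OF inv] by blast
        have G: "b \<in> carrier G" "f \<in> carrier G" "h \<in> carrier G" using inv h f B F HG by auto
        have "b \<otimes> f \<in> P" "f \<in> P" using inv f unfolding P_def by auto
        from sep[OF h' this] show ?thesis using G by (simp add: m_assoc)
      qed
      then show ?case by blast
    next
      case (eng k l)
      have "h \<otimes> (k \<otimes> l) \<otimes> f \<in> V \<longleftrightarrow> h \<otimes> f \<in> V" if h: "h \<in> ?H" and f: "f \<in> F" for h f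
      proof -
        have hk: "h \<otimes> k \<in> ?H" using subgroup.m_closed[OF H h eng(1)] .
        have "h \<in> carrier G" "k \<in> carrier G" "l \<in> carrier G" using h eng HG by auto
        then have "h \<otimes> (k \<otimes> l) \<otimes> f = h \<otimes> k \<otimes> l \<otimes> f" by (simp add: m_assoc)
        then show ?thesis using eng.IH hk h f by metis
      qed
      then show ?case by blast
    qed
    have one: "\<one> \<in> ?H" by (rule generate.one)
    have 1: "k \<otimes> f \<in> V \<longleftrightarrow> f \<in> V" if "k \<in> ?H" "f \<in> F" for k f
    proof -
      have "\<one> \<otimes> k \<otimes> f \<in> V \<longleftrightarrow> \<one> \<otimes> f \<in> V" using step[OF that(1)] one that(2) by blast
      then show ?thesis using that HG F(2) by (simp add: subsetD)
    qed
    have 2: "f \<in> V \<longleftrightarrow> f' \<in> V" if "f \<in> F" "f' \<in> F" for f f'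
    proof -
      have "f \<in> P" "f' \<in> P" using that unfolding P_def by auto
      from sep[OF one this] show ?thesis using that F(2) by (simp add: subsetD)
    qed
    show ?thesis
    proof (cases "\<exists>f\<in>F. f \<in> V")
      case True
      then have "f \<in> V" if "f \<in> F" for f using 2 that by blast
      then have "(\<Union>f\<in>F. ?H #> f) \<subseteq> V" using 1 unfolding r_coset_def by auto
      then show ?thesis by blast
    next
      case False
      then have "(\<Union>f\<in>F. ?H #> f) \<inter> V = {}" using 1 unfolding r_coset_def by auto
      then show ?thesis by blast
    qed
  qed
  show ?thesis
    by (intro exI[of _ "\<V>"] conjI ballI fin sub, rule disj_imp[THEN iffD2], rule impI, rule main, assumption+)
qed

text \<open>Finite generation bounds the translates of another set that cut the coboundary;
  adaptedness makes the coboundary finite in the presence of the \<open>S j\<close>. The two are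
  bundled because complements and the new representatives inherit both.\<close>

definition tame :: "'j set \<Rightarrow> ('j \<Rightarrow> 'a set) \<Rightarrow> 'a set \<Rightarrow> bool" where
  "tame J S X \<longleftrightarrow>
     (\<exists>H. finitely_generated_in G H \<and> nontrivial_almost_invariant G H X) \<and> family_adapted G J S X"

lemma tame_nontriv: "tame J S X \<Longrightarrow> nontriv X"
  unfolding tame_def nontriv_def by blast

text \<open>The finitely generated subgroup may be smaller than \<open>stab U\<close>, but the two
  have the same finite sets, so D is covered by finitely many of its cosets.\<close>

lemma finite_orbits_cutting_tame:
  assumes U: "tame J S U" and X: "nontriv X" and D: "coset_finite G (stab U) D"
  shows "\<exists>\<V>. finite \<V> \<and> \<V> \<subseteq> orbit X \<and>
    (\<forall>V\<in>orbit X. (\<exists>h\<in>stab U. h <# V \<in> \<V>) \<or> D \<subseteq> V \<or> D \<inter> V = {})"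
proof -
  obtain H where H: "finitely_generated_in G H" "nontrivial_almost_invariant G H U"
    using U unfolding tame_def by blast
  obtain B where B: "finite B" "B \<subseteq> carrier G" "H = generate G B"
    using H(1) unfolding finitely_generated_in_def by blast
  have "coset_finite G H D" using nontrivial_almost_invariant_stab(2)[OF H(2)] D by blast
  then obtain F where F: "finite F" "F \<subseteq> carrier G" "D \<subseteq> (\<Union>f\<in>F. H #> f)"
    unfolding coset_finite_def by blast
  have HU: "H \<subseteq> stab U" using subset_stab nontrivial_ne(3)[OF H(2)] .
  obtain \<V> where V: "finite \<V>" "\<V> \<subseteq> orbit X" "\<forall>V\<in>orbit X. (\<exists>h\<in>H. h <# V \<in> \<V>) \<or>
    (\<Union>f\<in>F. H #> f) \<subseteq> V \<or> (\<Union>f\<in>F. H #> f) \<inter> V = {}"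
    using finite_orbits_cutting[OF B(1,2) X F(1,2)] unfolding B(3) by blast
  have "(\<exists>h\<in>stab U. h <# V \<in> \<V>) \<or> D \<subseteq> V \<or> D \<inter> V = {}" if "V \<in> orbit X" for V
    using V(3)[rule_format, OF that] HU F(3) by (meson disjoint_iff subset_trans subsetD)
  then show ?thesis by (intro exI[of _ "\<V>"] conjI ballI V(1,2))
qed

text \<open>\<open>D\<close> contains the coboundary of \<open>U\<close> in the relative Cayley graph, which has a cone vertex for
  every coset \<open>g (S j)\<close>. The set \<open>Z j\<close> decides on which side of \<open>U\<close> the cone vertices over \<open>S j\<close> lie.\<close>

definition coboundary_in ::
    "'j set \<Rightarrow> ('j \<Rightarrow> 'a set) \<Rightarrow> 'a set \<Rightarrow> 'a set \<Rightarrow> 'a set \<Rightarrow> ('j \<Rightarrow> 'a set) \<Rightarrow> bool" where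
  "coboundary_in J S A D U Z \<longleftrightarrow> U \<subseteq> carrier G \<and>
     (\<forall>a\<in>A. sym_diff U (U #> a) \<subseteq> D \<and> sym_diff U (U #> inv a) \<subseteq> D) \<and>
     (\<forall>j\<in>J. Z j \<subseteq> carrier G \<and> strictly_adapted G (Z j) (S j) \<and> sym_diff U (Z j) \<subseteq> D)"

section \<open>Coboundaries in the relative Cayley graph and empty corners\<close>

lemma strictly_adapted_compl:
  "Z \<subseteq> carrier G \<Longrightarrow> strictly_adapted G Z T \<Longrightarrow> strictly_adapted G (compl Z) T"
  unfolding strictly_adapted_def by (auto simp: double_diff)

lemma coboundary_in_compl:
  assumes A: "A \<subseteq> carrier G" and c: "coboundary_in J S A D U Z"
  shows "coboundary_in J S A D (compl U) (\<lambda>j. compl (Z j))"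
proof -
  have U: "U \<subseteq> carrier G" using c unfolding coboundary_in_def by blast
  have "sym_diff (compl U) (compl U #> a) = sym_diff U (U #> a)" if "a \<in> carrier G" for a
    using that U rcos_sub[OF that U] by (simp add: rcos_compl sym_diff_compl)
  moreover have "a \<in> carrier G" "inv a \<in> carrier G" if "a \<in> A" for a using that A by auto
  moreover have "sym_diff (compl U) (compl (Z j)) = sym_diff U (Z j)" if "j \<in> J" for j
    using that c U sym_diff_compl unfolding coboundary_in_def by blast
  ultimately show ?thesis using c strictly_adapted_compl unfolding coboundary_in_def by simp
qed

lemma strictly_adapted_lcos:
  assumes g: "g \<in> carrier G" and Z: "Z \<subseteq> carrier G" "strictly_adapted G Z T" and T: "T \<subseteq> carrier G"
  shows "strictly_adapted G (g <# Z) T"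
  unfolding strictly_adapted_def
proof
  fix x assume x: "x \<in> carrier G"
  have "(inv g \<otimes> x) <# T \<subseteq> Z \<or> (inv g \<otimes> x) <# T \<subseteq> compl Z"
    using Z x g unfolding strictly_adapted_def by simp
  moreover have "g <# ((inv g \<otimes> x) <# T) = x <# T" using g x T by (simp add: lcos_lcos)
  ultimately show "x <# T \<subseteq> g <# Z \<or> x <# T \<subseteq> compl (g <# Z)"
    using lcos_mono[of "(inv g \<otimes> x) <# T" _ g] lcos_compl[OF g Z(1)] by metis
qed

lemma lcos_sym_diff:
  assumes "g \<in> carrier G" "U \<subseteq> carrier G" "V \<subseteq> carrier G"
  shows "sym_diff (g <# U) (g <# V) = g <# (sym_diff U V)"
proof -
  have "g <# (sym_diff U V) = (g <# (U - V)) \<union> (g <# (V - U))" unfolding l_coset_def by blast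
  then show ?thesis using assms by (simp add: lcos_diff)
qed

lemma coboundary_in_lcos:
  assumes A: "A \<subseteq> carrier G" and S: "\<forall>j\<in>J. S j \<subseteq> carrier G"
    and g: "g \<in> carrier G" and c: "coboundary_in J S A D U Z"
  shows "coboundary_in J S A (g <# D) (g <# U) (\<lambda>j. g <# Z j)"
proof -
  have U: "U \<subseteq> carrier G" using c unfolding coboundary_in_def by blast
  have 1: "sym_diff (g <# U) (g <# U #> a) \<subseteq> g <# D"
    if "sym_diff U (U #> a) \<subseteq> D" "a \<in> carrier G" for a
  proof -
    have "g <# U #> a = g <# (U #> a)" using that U g by (simp add: coset_assoc)
    then show ?thesis using lcos_sym_diff[OF g U rcos_sub[OF that(2) U]] lcos_mono[OF that(1), of g] by simp
  qed
  have 2: "sym_diff (g <# U) (g <# Z j) \<subseteq> g <# D" if "j \<in> J" for j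
    using that c lcos_sym_diff[OF g U, of "Z j"] lcos_mono[of "sym_diff U (Z j)" D g]
    unfolding coboundary_in_def by simp
  have 3: "strictly_adapted G (g <# Z j) (S j)" "g <# Z j \<subseteq> carrier G" if "j \<in> J" for j
    using that c strictly_adapted_lcos[OF g _ _ S[rule_format, OF that]] lcos_sub[OF g]
    unfolding coboundary_in_def by auto
  show ?thesis using c 1 2 3 A lcos_sub[OF g U] unfolding coboundary_in_def by (auto simp: subsetD)
qed

text \<open>A point outside both U and V is in neither P nor Q, because P lies in V and Q in U. A
  step along a generator in A that leaves this corner would have to start in P or Q. So the corner
  is closed under right multiplication by all generators, hence empty or everything.\<close>

lemma corner_trivial:
  assumes S: "\<forall>j\<in>J. subgroup (S j) G" and A: "A \<subseteq> carrier G"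
    and gen: "carrier G = generate G ((\<Union>j\<in>J. S j) \<union> A)"
    and U: "coboundary_in J S A P U Y" and V: "coboundary_in J S A Q V Z"
    and PQ: "P \<subseteq> V" "Q \<subseteq> U" "P \<inter> Q = {}"
  shows "compl U \<inter> compl V = {} \<or> compl U \<inter> compl V = carrier G"
proof -
  let ?W = "compl U \<inter> compl V"
  have UG: "U \<subseteq> carrier G" and VG: "V \<subseteq> carrier G" using U V unfolding coboundary_in_def by auto
  have tA: "x \<otimes> a \<in> ?W" if x: "x \<in> ?W" and a: "a \<in> carrier G"
    and d: "sym_diff U (U #> inv a) \<subseteq> P" "sym_diff V (V #> inv a) \<subseteq> Q" for x a
  proof -
    have "x \<in> U #> inv a \<longleftrightarrow> x \<otimes> a \<in> U" "x \<in> V #> inv a \<longleftrightarrow> x \<otimes> a \<in> V"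
      using x a UG VG by (simp_all add: rcos_iff)
    then have "x \<otimes> a \<notin> U" "x \<otimes> a \<notin> V" using x d PQ by blast+
    then show ?thesis using x a by simp
  qed
  have tS: "x \<otimes> s \<in> ?W" if x: "x \<in> ?W" and j: "j \<in> J" and s: "s \<in> S j" for x s j
  proof -
    have d: "sym_diff U (Y j) \<subseteq> P" "sym_diff V (Z j) \<subseteq> Q" using U V j unfolding coboundary_in_def by auto
    have xG: "x \<in> carrier G" using x by simp
    have SG: "S j \<subseteq> carrier G" using subgroup.subset[OF S[rule_format, OF j]] .
    have "x \<otimes> \<one> \<in> x <# S j" "x \<otimes> s \<in> x <# S j"
      using s subgroup.one_closed[OF S[rule_format, OF j]] unfolding l_coset_def by blast+
    then have "x \<in> x <# S j" "x \<otimes> s \<in> x <# S j" using xG by simp_all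
    then have "x \<in> Y j \<longleftrightarrow> x \<otimes> s \<in> Y j" "x \<in> Z j \<longleftrightarrow> x \<otimes> s \<in> Z j"
      using U V j xG unfolding coboundary_in_def strictly_adapted_def by blast+
    moreover have "x \<otimes> s \<in> carrier G" using xG s SG by auto
    \<comment> \<open>A step along a coset of \<open>S j\<close> might end in P or Q. If x s were in
      U, it would be in U but not in \<open>Y j\<close>, hence in P and so in V, but not in
      \<open>Z j\<close>, hence in Q, against disjointness; likewise with U and V exchanged.\<close>
    ultimately show ?thesis using x d PQ by blast
  qed
  have gT: "x \<otimes> t \<in> ?W \<and> x \<otimes> inv t \<in> ?W" if x: "x \<in> ?W" and t: "t \<in> (\<Union>j\<in>J. S j) \<union> A" for x t
  proof (cases "t \<in> A")
    case True
    then have tG: "t \<in> carrier G" using A by blast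
    have "sym_diff U (U #> t) \<subseteq> P \<and> sym_diff U (U #> inv t) \<subseteq> P"
      "sym_diff V (V #> t) \<subseteq> Q \<and> sym_diff V (V #> inv t) \<subseteq> Q"
      using U V True unfolding coboundary_in_def by simp_all
    then show ?thesis using tA[OF x tG] tA[OF x, of "inv t"] tG by simp
  next
    case False
    then obtain j where j: "j \<in> J" "t \<in> S j" using t by blast
    have "inv t \<in> S j" using subgroup.m_inv_closed[OF S[rule_format, OF j(1)] j(2)] .
    then show ?thesis using tS[OF x j(1)] j(2) by simp
  qed
  have "\<forall>x\<in>?W. x \<otimes> t \<in> ?W" if "t \<in> generate G ((\<Union>j\<in>J. S j) \<union> A)" for t
    using that
  proof (induction t rule: generate.induct)
    case one
    then show ?case by simp
  next
    case (incl t)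
    then show ?case using gT by simp
  next
    case (inv t)
    then show ?case using gT by simp
  next
    case (eng s t)
    have "s \<in> carrier G" "t \<in> carrier G" using eng(1,2) gen by auto
    then have "x \<otimes> (s \<otimes> t) = x \<otimes> s \<otimes> t" if "x \<in> ?W" for x using that by (simp add: m_assoc)
    then show ?case using eng.IH by simp
  qed
  then have cl: "x \<otimes> t \<in> ?W" if "x \<in> ?W" "t \<in> carrier G" for x t using that gen by blast
  have "y \<in> ?W" if "x \<in> ?W" "y \<in> carrier G" for x y
    using cl[OF that(1), of "inv x \<otimes> y"] that by auto
  then show ?thesis by blast
qed

text \<open>Passing to complements reduces the four positions of P and Q to one. A full corner is
  excluded because U is neither empty nor everything.\<close>

lemma nested_if_uncut:
  assumes S: "\<forall>j\<in>J. subgroup (S j) G" and A: "A \<subseteq> carrier G"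
    and gen: "carrier G = generate G ((\<Union>j\<in>J. S j) \<union> A)"
    and U: "coboundary_in J S A P U Y" and V: "coboundary_in J S A Q V Z"
    and PQ: "P \<subseteq> carrier G" "Q \<subseteq> carrier G" "P \<subseteq> V \<or> P \<inter> V = {}" "Q \<subseteq> U \<or> Q \<inter> U = {}" "P \<inter> Q = {}"
    and ne: "U \<noteq> {}" "U \<noteq> carrier G"
  shows "nested G U V"
proof -
  have UG: "U \<subseteq> carrier G" and VG: "V \<subseteq> carrier G" using U V unfolding coboundary_in_def by auto
  note U' = coboundary_in_compl[OF A U] and V' = coboundary_in_compl[OF A V]
  note c = corner_trivial[OF S A gen]
  have n: "compl U \<inter> W \<noteq> carrier G" "U \<inter> W \<noteq> carrier G" for W using ne UG by auto
  consider "P \<subseteq> V" "Q \<subseteq> U" | "P \<subseteq> compl V" "Q \<subseteq> U" | "P \<subseteq> V" "Q \<subseteq> compl U" | "P \<subseteq> compl V" "Q \<subseteq> compl U"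
    using PQ(1-4) by auto
  then have "{} \<in> corners G U V"
  proof cases
    case 1
    then have "compl U \<inter> compl V = {} \<or> compl U \<inter> compl V = carrier G" by (rule c[OF U V _ _ PQ(5)])
    then show ?thesis using n unfolding corners_def by auto
  next
    case 2
    then have "compl U \<inter> V = {} \<or> compl U \<inter> V = carrier G"
      using c[OF U V' _ _ PQ(5)] VG by (simp add: double_diff)
    then show ?thesis using n unfolding corners_def by auto
  next
    case 3
    then have "U \<inter> compl V = {} \<or> U \<inter> compl V = carrier G"
      using c[OF U' V _ _ PQ(5)] UG by (simp add: double_diff)
    then show ?thesis using n unfolding corners_def by auto
  next
    case 4
    then have "U \<inter> V = {} \<or> U \<inter> V = carrier G"
      using c[OF U' V' _ _ PQ(5)] UG VG by (simp add: double_diff)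
    then show ?thesis using n unfolding corners_def by auto
  qed
  then show ?thesis unfolding nested_def .
qed

text \<open>Only finitely many generators and subgroups contribute to D, each with symmetric
  differences that are finite modulo \<open>stab U\<close>, by almost invariance or by
  adaptedness.\<close>

lemma tame_coboundary:
  assumes J: "finite J" and A: "finite A" "A \<subseteq> carrier G" and U: "tame J S U"
  obtains D Z where "coboundary_in J S A D U Z" "coset_finite G (stab U) D" "D \<subseteq> carrier G"
proof -
  note aU = tame_nontriv[OF U]
  note UG = nontrivD(3)[OF aU]
  have "\<exists>Z. Z \<subseteq> carrier G \<and> strictly_adapted G Z (S j) \<and> coset_finite G (stab U) (sym_diff U Z)"
    if j: "j \<in> J" for j
  proof -
    obtain Z where Z: "strictly_adapted G Z (S j)" "equivalent G U Z"
      using U j unfolding tame_def family_adapted_def adapted_def by blast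
    then have "nontriv Z" "sim U Z" using equivalent_iff_sim by auto
    then show ?thesis
      using Z(1) nontrivD(3) coset_finite_Un[OF sim_diff_finite[OF aU]] by blast
  qed
  then obtain Z where Z: "\<And>j. j \<in> J \<Longrightarrow> Z j \<subseteq> carrier G \<and> strictly_adapted G (Z j) (S j) \<and>
    coset_finite G (stab U) (sym_diff U (Z j))" by metis
  define D where "D = (\<Union>a\<in>A. sym_diff U (U #> a)) \<union> (\<Union>a\<in>A. sym_diff U (U #> inv a)) \<union>
    (\<Union>j\<in>J. sym_diff U (Z j))"
  have "coboundary_in J S A D U Z" using Z UG unfolding coboundary_in_def D_def by blast
  moreover have "coset_finite G (stab U) D"
    unfolding D_def
  proof (intro coset_finite_Un[of G "stab U" "_ \<union> _"] coset_finite_Un[of G "stab U" "\<Union> _"] coset_finite_UN A(1) J)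
    fix a assume "a \<in> A"
    then have a: "a \<in> carrier G" "inv a \<in> carrier G" using A by auto
    show "coset_finite G (stab U) (sym_diff U (U #> a))" "coset_finite G (stab U) (sym_diff U (U #> inv a))"
      using nontrivD(7)[OF aU] a by auto
  next
    fix j assume "j \<in> J"
    then show "coset_finite G (stab U) (sym_diff U (Z j))" using Z by blast
  qed
  moreover have "D \<subseteq> carrier G"
  proof -
    have "U #> a \<subseteq> carrier G" "U #> inv a \<subseteq> carrier G" if "a \<in> A" for a
      using that A rcos_sub[OF _ UG] by auto
    then show ?thesis using UG Z unfolding D_def by blast
  qed
  ultimately show ?thesis using that by blast
qed

lemma finite_orbits_not_nested:
  assumes J: "finite J" and S: "\<forall>j\<in>J. subgroup (S j) G" and A: "finite A" "A \<subseteq> carrier G"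
    and gen: "carrier G = generate G ((\<Union>j\<in>J. S j) \<union> A)"
    and U: "tame J S U" and X: "tame J S X"
  shows "\<exists>\<V>. finite \<V> \<and> (\<forall>V\<in>orbit X. (\<exists>h\<in>stab U. h <# V \<in> \<V>) \<or> nested G U V)"
proof -
  note aU = tame_nontriv[OF U] and aX = tame_nontriv[OF X]
  note UG = nontrivD(3)[OF aU] and XG = nontrivD(3)[OF aX]
  obtain P Y where P: "coboundary_in J S A P U Y" "coset_finite G (stab U) P" "P \<subseteq> carrier G"
    using tame_coboundary[OF J A U] .
  obtain Q Z where Q: "coboundary_in J S A Q X Z" "coset_finite G (stab X) Q" "Q \<subseteq> carrier G"
    using tame_coboundary[OF J A X] .
  obtain \<V>1 where V1: "finite \<V>1" "\<V>1 \<subseteq> orbit X"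
    "\<forall>V\<in>orbit X. (\<exists>h\<in>stab U. h <# V \<in> \<V>1) \<or> P \<subseteq> V \<or> P \<inter> V = {}"
    using finite_orbits_cutting_tame[OF U aX P(2)] by blast
  obtain \<V>2 where V2: "finite \<V>2" "\<V>2 \<subseteq> orbit U"
    "\<forall>V\<in>orbit U. (\<exists>h\<in>stab X. h <# V \<in> \<V>2) \<or> Q \<subseteq> V \<or> Q \<inter> V = {}"
    using finite_orbits_cutting_tame[OF X aU Q(2)] by blast
  obtain \<Gamma> where Ga: "finite \<Gamma>" "\<Gamma> \<subseteq> carrier G" "\<V>2 = (\<lambda>g. g <# U) ` \<Gamma>"
    using finite_subset_image[OF V2(1,2)] by blast
  obtain E where E: "finite E" "E \<subseteq> carrier G" "P \<subseteq> (\<Union>f\<in>E. stab U #> f)"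
    using P(2) unfolding coset_finite_def by blast
  obtain F where F: "finite F" "F \<subseteq> carrier G" "Q \<subseteq> (\<Union>f\<in>F. stab X #> f)"
    using Q(2) unfolding coset_finite_def by blast
  \<comment> \<open>One family for each way in which V = g X can fail the criterion: V cuts P; U
    cuts g Q, that is, a translate of U cuts Q; or P and g Q meet. In the last two cases the
    equation between the translates yields an element of \<open>stab U\<close> that carries V to a
    listed set.\<close>
  define \<V> where "\<V> = \<V>1 \<union> (\<lambda>\<gamma>. inv \<gamma> <# X) ` \<Gamma> \<union> (\<lambda>(e, f). (e \<otimes> inv f) <# X) ` (E \<times> F)"
  have "finite \<V>" unfolding \<V>_def using V1 Ga E F by simp
  moreover have "nested G U V" if V: "V \<in> orbit X" and n: "\<not> (\<exists>h\<in>stab U. h <# V \<in> \<V>)" for V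
  proof -
    obtain g where g: "g \<in> carrier G" "V = g <# X" using V by blast
    have 1: "P \<subseteq> V \<or> P \<inter> V = {}" using V1(3) V n unfolding \<V>_def by blast
    have 2: "g <# Q \<subseteq> U \<or> (g <# Q) \<inter> U = {}"
    proof -
      have o: "inv g <# U \<in> orbit U" using g by blast
      have "\<not> (\<exists>k\<in>stab X. k <# (inv g <# U) \<in> \<V>2)"
      proof
        assume "\<exists>k\<in>stab X. k <# (inv g <# U) \<in> \<V>2"
        then obtain k \<gamma> where k: "k \<in> stab X" "\<gamma> \<in> \<Gamma>" "k <# (inv g <# U) = \<gamma> <# U" using Ga by blast
        have G: "k \<in> carrier G" "\<gamma> \<in> carrier G" using k Ga nontrivD(8)[OF aX] by auto
        let ?h = "inv \<gamma> \<otimes> (k \<otimes> inv g)"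
        have "?h <# U = inv \<gamma> <# (k <# (inv g <# U))" using G g UG by (simp add: lcos_lcos)
        also have "\<dots> = U" using k(3) G UG by (simp add: lcos_inv)
        finally have h: "?h \<in> stab U" using G g unfolding stab_def by simp
        have "?h <# V = inv \<gamma> <# (k <# X)" using G g XG by (simp add: lcos_lcos m_assoc)
        also have "\<dots> = inv \<gamma> <# X" using k(1) unfolding stab_def by simp
        finally show False using n h k(2) unfolding \<V>_def by blast
      qed
      then have "Q \<subseteq> inv g <# U \<or> Q \<inter> (inv g <# U) = {}" using V2(3) o by blast
      moreover have "x \<in> inv g <# U \<longleftrightarrow> g \<otimes> x \<in> U" if "x \<in> Q" for x
        using that g UG Q(3) by (subst lcos_iff) auto
      ultimately show ?thesis unfolding l_coset_def[of G g Q] by blast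
    qed
    have 3: "P \<inter> (g <# Q) = {}"
    proof (rule ccontr)
      assume "P \<inter> (g <# Q) \<noteq> {}"
      then obtain q where q: "q \<in> Q" "g \<otimes> q \<in> P" unfolding l_coset_def by blast
      obtain f k where f: "f \<in> F" "k \<in> stab X" "q = k \<otimes> f" using q(1) F(3) unfolding r_coset_def by blast
      obtain e h where e: "e \<in> E" "h \<in> stab U" "g \<otimes> q = h \<otimes> e" using q(2) E(3) unfolding r_coset_def by blast
      have G: "f \<in> carrier G" "k \<in> carrier G" "e \<in> carrier G" "h \<in> carrier G"
        using f e E F nontrivD(8)[OF aU] nontrivD(8)[OF aX] by auto
      have "h \<otimes> e = g \<otimes> (k \<otimes> f)" using e f by simp
      then have "e = inv h \<otimes> (g \<otimes> (k \<otimes> f))" using G g by (metis inv_mult_cancel(1) m_closed)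
      then have "e \<otimes> inv f = inv h \<otimes> (g \<otimes> k)" using G g by (simp add: m_assoc)
      then have "(e \<otimes> inv f) <# X = inv h <# (g <# (k <# X))" using G g XG by (simp add: lcos_lcos)
      also have "\<dots> = inv h <# V" using f(2) g unfolding stab_def by simp
      finally have "inv h <# V \<in> \<V>" using e f unfolding \<V>_def by force
      then show False using n subgroup.m_inv_closed[OF nontrivD(4)[OF aU] e(2)] by blast
    qed
    have SG: "\<forall>j\<in>J. S j \<subseteq> carrier G" using S subgroup.subset by blast
    have c: "coboundary_in J S A (g <# Q) V (\<lambda>j. g <# Z j)"
      using coboundary_in_lcos[OF A(2) SG g(1) Q(1)] g(2) by simp
    show ?thesis
      by (rule nested_if_uncut[OF S A(2) gen P(1) c P(3) lcos_sub[OF g(1) Q(3)] 1 2 3 nontrivD(9,10)[OF aU]])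
  qed
  ultimately show ?thesis by (intro exI[of _ "\<V>"] conjI ballI) (assumption, rule disj_imp[THEN iffD2], rule impI)
qed

text \<open>If \<open>U \<inter> V\<close> were empty, U would be finite modulo its stabilizer; if
  the complements were disjoint, so would be the complement of V. The two corners that remain mean
  inclusion.\<close>

lemma nested_almost_le_subset:
  assumes U: "nontriv U" and V: "nontriv V" and n: "nested G U V" and l: "almost_le U V"
  shows "U \<subseteq> V \<or> V \<subseteq> U"
proof -
  note UG = nontrivD(3)[OF U] and VG = nontrivD(3)[OF V]
  have 1: "U \<inter> V \<noteq> {}"
  proof
    assume "U \<inter> V = {}"
    then have "U - V = U" by blast
    then show False using l nontrivD(5)[OF U] unfolding almost_le_def by simp
  qed
  have 2: "compl U \<inter> compl V \<noteq> {}"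
  proof
    assume "compl U \<inter> compl V = {}"
    then have "U - V = compl V" using UG by blast
    then show False using l nontrivD(6)[OF V] almost_le_iff_right[OF U V] by simp
  qed
  consider "compl U \<inter> V = {}" | "U \<inter> compl V = {}"
    using n 1 2 unfolding nested_def corners_def by auto
  then show ?thesis using UG VG by cases blast+
qed

lemma saturate:
  assumes "coset_finite G H B" "subgroup H G"
  shows "\<exists>C. coset_finite G H C \<and> B \<subseteq> C \<and> invariant H C"
proof -
  have HG: "H \<subseteq> carrier G" using subgroup.subset[OF assms(2)] .
  obtain F where F: "finite F" "F \<subseteq> carrier G" "B \<subseteq> (\<Union>f\<in>F. H #> f)"
    using assms unfolding coset_finite_def by blast
  have *: "h \<otimes> x \<in> H #> f" if h: "h \<in> H" and x: "x \<in> H #> f" and f: "f \<in> F" for h x f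
  proof -
    obtain k where k: "k \<in> H" "x = k \<otimes> f" using x unfolding r_coset_def by blast
    then have "h \<otimes> x = (h \<otimes> k) \<otimes> f" using HG h f F(2) by (simp add: m_assoc subsetD)
    then show ?thesis using subgroup.m_closed[OF assms(2) h k(1)] unfolding r_coset_def by blast
  qed
  have "h \<otimes> x \<in> (\<Union>f\<in>F. H #> f) \<longleftrightarrow> x \<in> (\<Union>f\<in>F. H #> f)" if h: "h \<in> H" and x: "x \<in> carrier G" for h x
  proof
    assume "h \<otimes> x \<in> (\<Union>f\<in>F. H #> f)"
    then obtain f where f: "f \<in> F" "h \<otimes> x \<in> H #> f" by blast
    have "inv h \<otimes> (h \<otimes> x) \<in> H #> f"
      using *[OF subgroup.m_inv_closed[OF assms(2) h] f(2,1)] .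
    then show "x \<in> (\<Union>f\<in>F. H #> f)" using f h x HG by (auto simp: subsetD)
  qed (use * h in blast)
  then have "invariant H (\<Union>f\<in>F. H #> f)" unfolding invariant_def by simp
  moreover have "coset_finite G H (\<Union>f\<in>F. H #> f)" unfolding coset_finite_def using F by blast
  ultimately show ?thesis using F(3) by (intro exI[of _ "\<Union>f\<in>F. H #> f"] conjI)
qed

section \<open>Tameness under complements and equivalence\<close>

lemma family_adapted_equivalent:
  assumes "equivalent G X Y" "family_adapted G J S X" shows "family_adapted G J S Y"
proof -
  have "adapted G Y (S j)" if j: "j \<in> J" for j
  proof -
    obtain H Z where Z: "almost_invariant G H Z" "strictly_adapted G Z (S j)" "equivalent G X Z"
      using assms(2) j unfolding family_adapted_def adapted_def by blast
    have "equivalent G Y Z"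
      using assms(1) Z(3) sim_trans[of Y X Z] sim_sym unfolding equivalent_iff_sim by blast
    then show ?thesis using Z unfolding adapted_def by blast
  qed
  then show ?thesis unfolding family_adapted_def by blast
qed

lemma tame_compl:
  assumes X: "tame J S X" shows "tame J S (compl X)"
proof -
  have "adapted G (compl X) (S j)" if j: "j \<in> J" for j
  proof -
    obtain Z where Z: "strictly_adapted G Z (S j)" "equivalent G X Z"
      using X j unfolding tame_def family_adapted_def adapted_def by blast
    have a: "nontriv X" "nontriv Z" "sim X Z" using Z(2) equivalent_iff_sim by auto
    have "equivalent G (compl X) (compl Z)"
      using a nontriv_compl almost_le_compl unfolding equivalent_iff_sim sim_def by blast
    moreover have "strictly_adapted G (compl Z) (S j)" using strictly_adapted_compl Z(1) nontrivD(3)[OF a(2)] by blast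
    moreover have "almost_invariant G (stab (compl Z)) (compl Z)" using nontrivD(2) nontriv_compl a(2) by blast
    ultimately show ?thesis unfolding adapted_def by blast
  qed
  moreover have "\<exists>H. finitely_generated_in G H \<and> nontrivial_almost_invariant G H (compl X)"
    using X nontrivial_almost_invariant_compl unfolding tame_def by blast
  ultimately show ?thesis unfolding tame_def family_adapted_def by blast
qed

text \<open>An equivalent set need not be invariant under the finitely generated subgroup of X. The
  inclusion of stabilizers guarantees that this subgroup serves Y as well.\<close>

lemma tame_equivalent:
  assumes X: "tame J S X" and e: "equivalent G X Y" and s: "stab X \<subseteq> stab Y"
  shows "tame J S Y"
proof -
  obtain H where H: "finitely_generated_in G H" "nontrivial_almost_invariant G H X"
    using X unfolding tame_def by blast
  have aX: "nontriv X" and aY: "nontriv Y" and sm: "sim X Y" using e unfolding equivalent_iff_sim by auto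
  note YG = nontrivD(3)[OF aY]
  have iff: "coset_finite G H B \<longleftrightarrow> coset_finite G (stab Y) B" for B
    using nontrivial_almost_invariant_stab(2)[OF H(2)] sim_coset_finite[OF aX aY sm] sim_coset_finite[OF aY aX sim_sym[OF sm]] by blast
  have HY: "H \<subseteq> stab Y" using subset_stab[OF nontrivial_ne(3)[OF H(2)]] s by blast
  have sH: "subgroup H G" using nontrivial_ne(3)[OF H(2)] unfolding almost_invariant_def by blast
  have "H <#> Y = Y"
  proof
    show "H <#> Y \<subseteq> Y" using stab_mem[OF YG] HY YG unfolding set_mult_def by blast
    show "Y \<subseteq> H <#> Y" using subgroup.one_closed[OF sH] YG unfolding set_mult_def by force
  qed
  then have "nontrivial_almost_invariant G H Y"
    using nontrivD(5,6,7)[OF aY] YG sH iff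
    unfolding nontrivial_almost_invariant_def almost_invariant_def almost_equal_def by simp
  then show ?thesis using H(1) family_adapted_equivalent[OF e] X unfolding tame_def by blast
qed

subsection \<open>Nested representatives of isolated sets\<close>

text \<open>In the tree dual to a nested family, the terminal vertex of the oriented edge \<open>U\<close> lies on
  the \<open>V\<close> side of the edge \<open>{V, V\<^sup>*}\<close>.\<close>

definition towards :: "'a set \<Rightarrow> 'a set \<Rightarrow> bool" where
  "towards U V \<longleftrightarrow> tree_le U V \<or> (tree_le (compl U) V \<and> \<not> tree_le V (compl U))"

definition tree_side :: "'a set \<Rightarrow> 'a set \<Rightarrow> 'a set" where
  "tree_side U V = {g \<in> carrier G. towards (g <# U) V}"

text \<open>Totality supplies one of four comparisons, and the excluded pairs would each place a set
  below its own complement. The strict second clause of \<open>towards\<close> breaks the tie in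
  which U and the complement of V are below each other: U then points to that complement
  only.\<close>

lemma towards_compl:
  assumes U: "nontriv U" and V: "nontriv V" and c: "\<not> crosses G U V"
  shows "towards U (compl V) \<longleftrightarrow> \<not> towards U V"
proof -
  note cU = nontriv_compl[OF U] and cV = nontriv_compl[OF V]
  have r: "tree_le (compl U) V \<longleftrightarrow> tree_le (compl V) U" "tree_le V (compl U) \<longleftrightarrow> tree_le U (compl V)"
    "tree_le (compl U) (compl V) \<longleftrightarrow> tree_le V U" "tree_le (compl V) (compl U) \<longleftrightarrow> tree_le U V"
    using tree_le_compl[OF U cV] tree_le_compl[OF V cU] tree_le_compl[OF V U] tree_le_compl[OF U V] tree_le_compl[OF cU V]
      tree_le_compl[OF cV U] U V by simp_all
  have n: "\<not> (tree_le U V \<and> tree_le U (compl V))" "\<not> (tree_le U V \<and> tree_le (compl V) U)"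
    "\<not> (tree_le V U \<and> tree_le U (compl V))" "\<not> (tree_le V U \<and> tree_le (compl V) U)"
    using tree_le_trans[OF U V cU] tree_le_trans[OF cV U V] tree_le_trans[OF V U cV] tree_le_trans[OF cU cV U]
      not_tree_le_compl[OF U] not_tree_le_compl[OF cV] not_tree_le_compl[OF V] not_tree_le_compl[OF cU] r U V by auto
  show ?thesis using tree_le_total[OF U V c] n unfolding towards_def r by blast
qed

lemma towards_mono:
  assumes U: "nontriv U" and V: "nontriv V" and W: "nontriv W" and s: "tree_le V W" and t: "towards U V"
  shows "towards U W"
  using t tree_le_trans[OF U V W _ s] tree_le_trans[OF nontriv_compl[OF U] V W _ s] tree_le_trans[OF V W nontriv_compl[OF U] s]
  unfolding towards_def by blast

lemma towards_lcos:
  assumes "g \<in> carrier G" "nontriv U" "nontriv V"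
  shows "towards (g <# U) (g <# V) \<longleftrightarrow> towards U V"
  using tree_le_lcos[OF assms] tree_le_lcos[OF assms(1) nontriv_compl[OF assms(2)] assms(3)]
    tree_le_lcos[OF assms(1,3) nontriv_compl[OF assms(2)]] lcos_compl[OF assms(1) nontrivD(3)[OF assms(2)]]
  unfolding towards_def by simp

lemma tree_side_lcos:
  assumes h: "h \<in> carrier G" and U: "nontriv U" and V: "nontriv V"
  shows "tree_side U (h <# V) = h <# tree_side U V"
proof (rule Set.set_eqI)
  fix x
  have "towards (x <# U) (h <# V) \<longleftrightarrow> towards ((inv h \<otimes> x) <# U) V" if x: "x \<in> carrier G"
  proof -
    have "x <# U = h <# ((inv h \<otimes> x) <# U)" using h x nontrivD(3)[OF U] by (simp add: lcos_lcos)
    then show ?thesis using towards_lcos[OF h nontriv_lcos[OF _ U] V] h x by simp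
  qed
  then show "x \<in> tree_side U (h <# V) \<longleftrightarrow> x \<in> h <# tree_side U V"
    using h by (subst lcos_iff) (auto simp: tree_side_def)
qed

text \<open>\<open>tree_side U\<close> turns comparison in the tree order into honest inclusion and
  respects complements, so the four cases of \<open>tree_le_total\<close> become the four possible
  empty corners.\<close>

lemma tree_side_nested:
  assumes U: "nontriv U" and V: "nontriv V" and W: "nontriv W" and c: "\<not> crosses G V W"
    and cV: "\<And>g. g \<in> carrier G \<Longrightarrow> \<not> crosses G (g <# U) V"
    and cW: "\<And>g. g \<in> carrier G \<Longrightarrow> \<not> crosses G (g <# U) W"
  shows "nested G (tree_side U V) (tree_side U W)"
proof -
  have mono: "tree_side U V' \<subseteq> tree_side U W'" if "nontriv V'" "nontriv W'" "tree_le V' W'" for V' W'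
    using towards_mono[OF nontriv_lcos[OF _ U] that] unfolding tree_side_def by blast
  have co: "tree_side U (compl W) = compl (tree_side U W)"
    using towards_compl[OF nontriv_lcos[OF _ U] W cW] unfolding tree_side_def by auto
  show ?thesis
    using tree_le_total[OF V W c] mono[OF V W] mono[OF W V] mono[OF V nontriv_compl[OF W]] mono[OF nontriv_compl[OF W] V] co
    unfolding nested_def corners_def by auto
qed

text \<open>Translates of X correspond to cosets of its stabilizer: \<open>inv g <# X\<close>
  determines \<open>stab X #> g\<close>.\<close>

lemma finite_translates_coset_finite:
  assumes X: "X \<subseteq> carrier G" and D: "finite D"
  shows "coset_finite G (stab X) {g \<in> carrier G. inv g <# X \<in> D}"
proof -
  have "coset_finite G (stab X) {g \<in> carrier G. inv g <# X = W}" for W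
  proof (cases "\<exists>g\<in>carrier G. inv g <# X = W")
    case True
    then obtain f where f: "f \<in> carrier G" "inv f <# X = W" by blast
    have "g \<in> stab X #> f" if g: "g \<in> carrier G" "inv g <# X = W" for g
    proof -
      have "(g \<otimes> inv f) <# X = g <# (inv f <# X)" using f(1) g(1) X by (simp add: lcos_lcos)
      also have "\<dots> = g <# (inv g <# X)" using f(2) g(2) by simp
      also have "\<dots> = X" using lcos_inv(2)[OF g(1) X] .
      finally have "g \<otimes> inv f \<in> stab X" using f(1) g(1) by (simp add: stab_def)
      moreover have "stab X \<subseteq> carrier G" unfolding stab_def by blast
      ultimately show ?thesis using f g by (simp add: rcos_iff)
    qed
    then have "{g \<in> carrier G. inv g <# X = W} \<subseteq> (\<Union>g\<in>{f}. stab X #> g)" by blast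
    then show ?thesis using f(1) unfolding coset_finite_def by (intro exI[of _ "{f}"]) simp
  next
    case False
    then have "{g \<in> carrier G. inv g <# X = W} = {}" by blast
    then show ?thesis by (simp only: coset_finite_empty)
  qed
  then have "coset_finite G (stab X) (\<Union>W\<in>D. {g \<in> carrier G. inv g <# X = W})"
    using D by (intro coset_finite_UN)
  moreover have "{g \<in> carrier G. inv g <# X \<in> D} = (\<Union>W\<in>D. {g \<in> carrier G. inv g <# X = W})" by blast
  ultimately show ?thesis by simp
qed

lemma equivalent_if_almost_equal:
  assumes X: "nontriv X" and Y: "Y \<subseteq> carrier G" "stab X \<subseteq> stab Y"
    and d: "coset_finite G (stab X) (sym_diff X Y)"
  shows "equivalent G X Y"
proof -
  let ?H = "stab X"
  note XG = nontrivD(3)[OF X] and H = nontrivD(4)[OF X]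
  have "coset_finite G ?H (sym_diff Y (Y #> g))" if g: "g \<in> carrier G" for g
  proof -
    have "coset_finite G ?H (sym_diff X Y #> g)" using coset_finite_rcoset[OF is_group H d g] .
    then have "coset_finite G ?H (sym_diff X Y \<union> sym_diff X (X #> g) \<union> (sym_diff X Y #> g))"
      using d nontrivD(7)[OF X g] coset_finite_Un by metis
    moreover have "sym_diff Y (Y #> g) \<subseteq> sym_diff X Y \<union> sym_diff X (X #> g) \<union> (sym_diff X Y #> g)"
    proof -
      have "sym_diff X Y \<subseteq> carrier G" using XG Y by blast
      then show ?thesis using g XG Y by (auto simp: rcos_iff)
    qed
    ultimately show ?thesis by (rule coset_finite_subset)
  qed
  moreover have "?H <#> Y = Y"
  proof
    show "?H <#> Y \<subseteq> Y" using stab_mem[OF Y(1)] Y unfolding set_mult_def by blast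
    show "Y \<subseteq> ?H <#> Y" using subgroup.one_closed[OF H] Y unfolding set_mult_def by force
  qed
  moreover have "\<not> coset_finite G ?H Y"
  proof
    assume "coset_finite G ?H Y"
    from coset_finite_Un[OF this d] show False
      using nontrivD(5)[OF X] coset_finite_subset[of G ?H _ X] by blast
  qed
  moreover have "\<not> coset_finite G ?H (compl Y)"
  proof
    assume "coset_finite G ?H (compl Y)"
    from coset_finite_Un[OF this d] show False
      using nontrivD(6)[OF X] coset_finite_subset[of G ?H _ "compl X"] by blast
  qed
  ultimately have "nontrivial_almost_invariant G ?H Y"
    using Y H unfolding nontrivial_almost_invariant_def almost_invariant_def almost_equal_def by blast
  then show ?thesis using nontrivD(1)[OF X] d unfolding equivalent_def almost_equal_def by blast
qed

subsection \<open>Families of translates and cross-connected components\<close>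

lemma translates_nontriv:
  assumes Y: "\<forall>i\<in>I. nontriv (Y i)" and V: "V \<in> translates G I Y"
  shows "nontriv V"
  using V Y nontriv_compl nontriv_lcos unfolding translates_def by auto

lemma translates_self: "i \<in> I \<Longrightarrow> nontriv (Y i) \<Longrightarrow> Y i \<in> translates G I Y"
  unfolding translates_def by (force simp: lcos_mult_one nontrivD(3))

lemma translates_compl:
  assumes Y: "\<forall>i\<in>I. nontriv (Y i)" and V: "V \<in> translates G I Y"
  shows "compl V \<in> translates G I Y"
proof -
  obtain i g where i: "i \<in> I" "g \<in> carrier G" "V = g <# Y i \<or> V = g <# compl (Y i)"
    using V unfolding translates_def by blast
  have "compl (g <# Y i) = g <# compl (Y i)" "compl (g <# compl (Y i)) = g <# Y i"
    using i Y nontrivD(3) lcos_compl[of g "Y i"] lcos_compl[of g "compl (Y i)"] by auto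
  then have "compl V = g <# compl (Y i) \<or> compl V = g <# Y i" using i(3) by auto
  then show ?thesis using i(1,2) unfolding translates_def by blast
qed

lemma translates_lcos:
  assumes Y: "\<forall>i\<in>I. nontriv (Y i)" and V: "V \<in> translates G I Y" and h: "h \<in> carrier G"
  shows "h <# V \<in> translates G I Y"
proof -
  obtain i g where i: "i \<in> I" "g \<in> carrier G" "V = g <# Y i \<or> V = g <# compl (Y i)"
    using V unfolding translates_def by blast
  have "h <# (g <# Y i) = (h \<otimes> g) <# Y i" "h <# (g <# compl (Y i)) = (h \<otimes> g) <# compl (Y i)"
    using i Y nontrivD(3)[of "Y i"] h by (simp_all add: lcos_lcos)
  then have "h <# V = (h \<otimes> g) <# Y i \<or> h <# V = (h \<otimes> g) <# compl (Y i)" using i(3) by auto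
  moreover have "h \<otimes> g \<in> carrier G" using h i(2) by simp
  ultimately show ?thesis using i(1) unfolding translates_def by blast
qed

lemma translates_Union_orbit:
  "translates G I Y = (\<Union>B\<in>Y ` I \<union> (\<lambda>i. compl (Y i)) ` I. orbit B)"
  unfolding translates_def by blast

lemma full_family_nontriv:
  assumes "\<forall>i\<in>I. nontriv (Y i)" "V \<in> full_family G I Y" shows "nontriv V"
  using assms translates_nontriv unfolding full_family_def equivalent_iff_sim by blast

lemma crosses_cong:
  assumes "nontriv U" "nontriv V" "nontriv U'" "nontriv V'" "sim U U'" "sim V V'"
  shows "crosses G U V \<longleftrightarrow> crosses G U' V'"
  using assms crosses_sim crosses_sym sim_sym by meson

text \<open>A member that is not a translate comes with a translate that crosses both it and Z. So U
  and Z always lie in the same component, and an isolated element must itself be a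
  translate.\<close>

lemma full_family_representative:
  assumes Y: "\<forall>i\<in>I. nontriv (Y i)" and U: "U \<in> full_family G I Y"
  obtains Z where "Z \<in> translates G I Y" "nontriv Z" "sim U Z"
    "U = Z \<or> (\<exists>W\<in>translates G I Y. crosses G U W \<and> crosses G Z W)"
proof (cases "U \<in> translates G I Y")
  case True
  then show ?thesis using that[OF True translates_nontriv[OF Y True]] subset_almost_le unfolding sim_def by blast
next
  case False
  then obtain Z W where Z: "Z \<in> translates G I Y" "equivalent G U Z" "W \<in> translates G I Y" "crosses G Z W"
    using U unfolding full_family_def by blast
  have a: "nontriv U" "nontriv Z" "sim U Z" using Z(2) unfolding equivalent_iff_sim by auto
  have "crosses G U W" using crosses_sim[OF a(2) translates_nontriv[OF Y Z(3)] a(1) sim_sym[OF a(3)] Z(4)] .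
  then show ?thesis using that[OF Z(1) a(2,3)] Z(3,4) by blast
qed

text \<open>Crossing only depends on equivalence classes, so isolation can be tested on
  translates.\<close>

lemma full_family_crosses:
  assumes Y: "\<forall>i\<in>I. nontriv (Y i)" and U: "nontriv U" and V: "V \<in> full_family G I Y" and c: "crosses G U V"
  shows "\<exists>W\<in>translates G I Y. crosses G U W"
proof -
  obtain Z where Z: "Z \<in> translates G I Y" "nontriv Z" "sim V Z" using full_family_representative[OF Y V] by metis
  have "sim U U" unfolding sim_def using subset_almost_le by blast
  then have "crosses G U Z" using crosses_cong[OF U full_family_nontriv[OF Y V] U Z(2) _ Z(3)] c by blast
  then show ?thesis using Z(1) by blast
qed

lemma full_family_compl:
  assumes Y: "\<forall>i\<in>I. nontriv (Y i)" and U: "U \<in> full_family G I Y"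
  shows "compl U \<in> full_family G I Y"
proof -
  note aU = full_family_nontriv[OF Y U]
  obtain Z where Z: "Z \<in> translates G I Y" "nontriv Z" "sim U Z"
    "U = Z \<or> (\<exists>W\<in>translates G I Y. crosses G U W \<and> crosses G Z W)"
    using full_family_representative[OF Y U] by blast
  have cZ: "compl Z \<in> translates G I Y" using translates_compl[OF Y Z(1)] .
  show ?thesis
  proof (cases "U = Z")
    case True
    then show ?thesis using cZ unfolding full_family_def by blast
  next
    case False
    then obtain W where W: "W \<in> translates G I Y" "crosses G Z W" using Z(4) by blast
    have "crosses G (compl Z) W" using crosses_compl[OF Z(2) translates_nontriv[OF Y W(1)]] W(2) by blast
    moreover have "equivalent G (compl U) (compl Z)"
      using aU Z(2,3) nontriv_compl almost_le_compl unfolding equivalent_iff_sim sim_def by blast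
    ultimately show ?thesis using cZ W(1) unfolding full_family_def by blast
  qed
qed

section \<open>Cross-connected components\<close>

abbreviation linked :: "'a set set \<Rightarrow> 'a set \<Rightarrow> 'a set \<Rightarrow> bool" where
  "linked \<F> \<equiv> equivclp (\<lambda>A B. A \<in> \<F> \<and> B \<in> \<F> \<and> (crosses G A B \<or> B = carrier G - A))"

lemma equiv_linked: "equiv \<F> {(U, V) \<in> \<F> \<times> \<F>. linked \<F> U V}"
  by (rule equivI) (auto simp: refl_on_def sym_def trans_def intro: equivclp_sym equivclp_trans)

lemma cccsD:
  assumes x: "x \<in> cccs G \<F>" and U: "U \<in> x"
  shows "U \<in> \<F>" "V \<in> x \<longleftrightarrow> V \<in> \<F> \<and> linked \<F> U V" "x = {(U, V) \<in> \<F> \<times> \<F>. linked \<F> U V} `` {U}"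
proof -
  let ?Q = "{(U, V) \<in> \<F> \<times> \<F>. linked \<F> U V}"
  obtain W where W: "W \<in> \<F>" "x = ?Q `` {W}" using x unfolding cccs_def by (rule quotientE)
  have "(W, U) \<in> ?Q" using U W by blast
  then show *: "x = ?Q `` {U}" using equiv_class_eq[OF equiv_linked] W by simp
  show "U \<in> \<F>" using \<open>(W, U) \<in> ?Q\<close> by blast
  then show "V \<in> x \<longleftrightarrow> V \<in> \<F> \<and> linked \<F> U V" unfolding * by simp
qed

lemma cccs_eq:
  assumes "x \<in> cccs G \<F>" "y \<in> cccs G \<F>" "U \<in> x" "U \<in> y" shows "x = y"
  using cccsD(3)[OF assms(1,3)] cccsD(3)[OF assms(2,4)] by simp

lemma cccs_crosses:
  assumes "x \<in> cccs G \<F>" "U \<in> x" "V \<in> \<F>" "crosses G U V" shows "V \<in> x"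
  using assms cccsD(1,2)[OF assms(1,2)] by (simp add: r_into_equivclp)

lemma cccs_compl:
  assumes "x \<in> cccs G \<F>" "U \<in> x" "compl U \<in> \<F>" shows "compl U \<in> x"
  using assms cccsD(1,2)[OF assms(1,2)] by (simp add: r_into_equivclp)

lemma cccs_ne: "x \<in> cccs G \<F> \<Longrightarrow> \<exists>U. U \<in> x"
  unfolding cccs_def using in_quotient_imp_non_empty[OF equiv_linked] by blast

text \<open>As A does not cross Y, they are comparable up to complements. If Y were below A or its
  complement, B would be too, although B crosses A.\<close>

lemma almost_le_side_crosses:
  assumes B: "nontriv B" and A: "nontriv A" and Y: "nontriv Y" and l: "almost_le B Y" and c: "crosses G B A" and n: "\<not> crosses G A Y"
  shows "almost_le A Y \<or> almost_le (compl A) Y"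
proof -
  have "\<not> almost_le A (compl Y)"
  proof
    assume "almost_le A (compl Y)"
    then have "almost_le Y (compl A)" using almost_le_compl_right[OF A Y] by blast
    then have "almost_le B (compl A)" using almost_le_trans[OF B Y nontriv_compl[OF A] l] by blast
    then show False using c crosses_iff_almost_le[OF B A] by blast
  qed
  moreover have "\<not> almost_le (compl A) (compl Y)"
  proof
    assume "almost_le (compl A) (compl Y)"
    then have "almost_le Y A" using almost_le_compl[OF Y A] by blast
    then have "almost_le B A" using almost_le_trans[OF B Y A l] by blast
    then show False using c crosses_iff_almost_le[OF B A] by blast
  qed
  ultimately show ?thesis using n crosses_iff_almost_le[OF A Y] by blast
qed

text \<open>The comparison with Y1 is carried along a chain of crossings and complements from X1 to
  X0. The chain stays in x, and none of its members crosses Y1, which lies in another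
  component.\<close>

lemma ccc_almost_le_side:
  assumes Y: "\<forall>i\<in>I. nontriv (Y i)" and \<F>: "\<F> = full_family G I Y"
    and x: "x \<in> cccs G \<F>" and y: "y \<in> cccs G \<F>" and ne: "x \<noteq> y"
    and X1: "X1 \<in> x" and Y1: "Y1 \<in> y" and X1Y1: "almost_le X1 Y1" and X0: "X0 \<in> x"
  shows "almost_le X0 Y1 \<or> almost_le (compl X0) Y1"
proof -
  have aF: "nontriv U" if "U \<in> \<F>" for U using that full_family_nontriv[OF Y] unfolding \<F> by blast
  have aY1: "nontriv Y1" using aF cccsD(1)[OF y Y1] by blast
  have "linked \<F> X1 X0" using cccsD(2)[OF x X1] X0 by blast
  then show ?thesis
  proof (induction rule: equivclp_induct)
    case base
    then show ?case using X1Y1 by blast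
  next
    case (step A B)
    have F: "A \<in> \<F>" "B \<in> \<F>" using step(2) by auto
    have "linked \<F> X1 B" by (rule equivclp_into_equivclp[OF step(1,2)])
    then have Bx: "B \<in> x" using cccsD(2)[OF x X1] F(2) by simp
    have aA: "nontriv A" and aB: "nontriv B" using F aF by auto
    have n: "\<not> crosses G B Y1"
      using cccs_crosses[OF x Bx cccsD(1)[OF y Y1]] cccs_eq[OF x y _ Y1] ne by blast
    consider "crosses G A B" | "B = compl A" | "A = compl B"
      using step(2) crosses_sym[OF aA aB] by blast
    then show ?case
    proof cases
      case 1
      then have "crosses G (compl A) B" using crosses_compl[OF aA aB] by blast
      then show ?thesis
        using step(3) almost_le_side_crosses[OF aA aB aY1 _ 1 n] almost_le_side_crosses[OF nontriv_compl[OF aA] aB aY1 _ _ n] by blast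
    next
      case 2
      then show ?thesis using step(3) aA by auto
    next
      case 3
      then show ?thesis using step(3) aB by auto
    qed
  qed
qed

text \<open>Without crossings, complementation is the only move left in a chain.\<close>

lemma ccc_isolated:
  assumes Y: "\<forall>i\<in>I. nontriv (Y i)" and \<F>: "\<F> = full_family G I Y"
    and x: "x \<in> cccs G \<F>" and X0: "X0 \<in> x" and n: "\<forall>W\<in>translates G I Y. \<not> crosses G X0 W"
    and X1: "X1 \<in> x"
  shows "X1 = X0 \<or> X1 = compl X0"
proof -
  have aF: "nontriv U" if "U \<in> \<F>" for U using that full_family_nontriv[OF Y] unfolding \<F> by blast
  have aX0: "nontriv X0" using aF cccsD(1)[OF x X0] by blast
  have n': "\<not> crosses G X0 W" "\<not> crosses G (compl X0) W" if "W \<in> \<F>" for W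
    using full_family_crosses[OF Y aX0] n crosses_compl[OF aX0 aF[OF that]] that unfolding \<F> by blast+
  have "linked \<F> X0 X1" using cccsD(2)[OF x X0] X1 by blast
  then show ?thesis
  proof (induction rule: equivclp_induct)
    case base
    then show ?case by blast
  next
    case (step A B)
    have F: "A \<in> \<F>" "B \<in> \<F>" using step(2) by auto
    have aA: "nontriv A" and aB: "nontriv B" using F aF by auto
    have "\<not> crosses G A B" using n' F step(3) by blast
    then consider "B = compl A" | "A = compl B" using step(2) crosses_sym[OF aA aB] by blast
    then have "B = compl A" using compl_compl[OF aB] by cases simp_all
    then show ?case using step(3) compl_compl[OF aX0] by metis
  qed
qed

lemma corner_symmetric_nontriv:
  assumes F: "\<And>U. U \<in> \<F> \<Longrightarrow> nontriv U"
  shows "corner_symmetric G \<F>"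
  unfolding corner_symmetric_def
proof (intro ballI allI impI)
  fix U V H K C
  assume UV: "U \<in> \<F>" "V \<in> \<F>" and HK: "almost_invariant G H U \<and> almost_invariant G K V"
    and C: "C \<in> corners G U V"
  note aU = F[OF UV(1)] and aV = F[OF UV(2)]
  note UG = nontrivD(3)[OF aU] and VG = nontrivD(3)[OF aV]
  have "coset_finite G (stab U) C \<longleftrightarrow> coset_finite G (stab V) C"
    using C coset_finite_Int_iff[OF aU aV] coset_finite_Int_iff[OF nontriv_compl[OF aU] aV]
      coset_finite_Int_iff[OF aU nontriv_compl[OF aV]] coset_finite_Int_iff[OF nontriv_compl[OF aU] nontriv_compl[OF aV]]
      stab_compl[OF UG] stab_compl[OF VG]
    unfolding corners_def by auto
  then show "coset_finite G H C \<longleftrightarrow> coset_finite G K C"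
    using almost_invariant_coset_finite_iff[OF is_group _ nontrivD(2)[OF aU] nontrivD(9,10)[OF aU]]
      almost_invariant_coset_finite_iff[OF is_group _ nontrivD(2)[OF aV] nontrivD(9,10)[OF aV]] HK by blast
qed

text \<open>Replacing the sets of a family by equivalent ones creates no new isolated sets.\<close>

lemma orbit_crosses_sim:
  assumes "\<forall>i\<in>I. nontriv (X i)" "\<forall>i\<in>I. nontriv (Y i)" "\<forall>i\<in>I. sim (X i) (Y i)"
    and i: "i \<in> I" and W: "W \<in> translates G I X" "crosses G (X i) W"
  shows "\<exists>V\<in>translates G I Y. crosses G (Y i) V"
proof -
  obtain j g where j: "j \<in> I" "g \<in> carrier G" "W = g <# X j \<or> W = g <# compl (X j)"
    using W(1) unfolding translates_def by blast
  have a: "nontriv (X i)" "nontriv (Y i)" "sim (X i) (Y i)" "nontriv (X j)" "nontriv (Y j)" "sim (X j) (Y j)"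
    using assms i j by auto
  note g = nontriv_lcos[OF j(2)]
  have aX: "nontriv (g <# X j)" "nontriv (g <# compl (X j))" "nontriv (g <# Y j)" using g a nontriv_compl by auto
  have c: "g <# compl (X j) = compl (g <# X j)" using lcos_compl[OF j(2) nontrivD(3)[OF a(4)]] .
  have "crosses G (X i) (g <# X j)"
    using W(2) j(3) crosses_sym[OF a(1) aX(1)] crosses_sym[OF a(1) aX(2)] crosses_compl[OF aX(1) a(1)] c
    by auto
  moreover have "sim (g <# X j) (g <# Y j)"
    using a(6) almost_le_lcos[OF j(2) a(4,5)] almost_le_lcos[OF j(2) a(5,4)] unfolding sim_def by blast
  ultimately have "crosses G (Y i) (g <# Y j)"
    using crosses_cong[OF a(1) aX(1) a(2) aX(3) a(3)] by blast
  moreover have "g <# Y j \<in> translates G I Y" using j unfolding translates_def by blast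
  ultimately show ?thesis by blast
qed

end

subsection \<open>Uniform estimates and discreteness\<close>

locale relatively_finitely_generated = group G for G :: "('a, 'b) monoid_scheme" (structure) +
  fixes J :: "'j set" and S :: "'j \<Rightarrow> 'a set" and A :: "'a set"
  assumes finite_J: "finite J" and subgroup_S: "\<forall>j\<in>J. subgroup (S j) G"
    and finite_A: "finite A" and A_subset: "A \<subseteq> carrier G"
    and generated: "carrier G = generate G ((\<Union>j\<in>J. S j) \<union> A)"
begin

lemma uniform_difference:
  assumes U: "tame J S U" and X: "tame J S X"
  shows "\<exists>D. coset_finite G (stab U) D \<and> (\<forall>V\<in>orbit X. almost_le U V \<and> \<not> almost_le V U \<longrightarrow> U - V \<subseteq> D)"
proof -
  note aU = tame_nontriv[OF U] and aX = tame_nontriv[OF X]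
  note UG = nontrivD(3)[OF aU]
  obtain \<V> where V: "finite \<V>" "\<forall>V\<in>orbit X. (\<exists>h\<in>stab U. h <# V \<in> \<V>) \<or> nested G U V"
    using finite_orbits_not_nested[OF finite_J subgroup_S finite_A A_subset generated U X] by blast
  \<comment> \<open>The bound is saturated under \<open>stab U\<close>, so that the bound for a
    representative \<open>h <# V\<close> applies to V itself. The default \<open>{}\<close> serves
    those V that are not above U.\<close>
  have "\<exists>C. coset_finite G (stab U) C \<and> (almost_le U V \<longrightarrow> U - V \<subseteq> C) \<and> invariant (stab U) C" for V
  proof (cases "almost_le U V")
    case True
    then show ?thesis using saturate[OF _ nontrivD(4)[OF aU], of "U - V"] unfolding almost_le_def by blast
  next
    case False
    then show ?thesis using coset_finite_empty[of G "stab U"]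
      by (intro exI[of _ "{}"]) (simp add: invariant_def)
  qed
  then obtain C where C: "\<And>V. coset_finite G (stab U) (C V)" "\<And>V. almost_le U V \<Longrightarrow> U - V \<subseteq> C V"
    "\<And>V. invariant (stab U) (C V)" by metis
  have "coset_finite G (stab U) (\<Union>V\<in>\<V>. C V)" using V(1) C(1) by (rule coset_finite_UN)
  moreover have "U - V \<subseteq> (\<Union>V\<in>\<V>. C V)" if o: "V \<in> orbit X" and l: "almost_le U V" "\<not> almost_le V U" for V
  proof (cases "nested G U V")
    case True
    have "\<not> V \<subseteq> U" using l(2) subset_almost_le by blast
    then show ?thesis using nested_almost_le_subset[OF aU nontriv_orbit[OF aX o] True l(1)] by blast
  next
    case False
    then obtain h where h: "h \<in> stab U" "h <# V \<in> \<V>" using V(2) o by blast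
    have hG: "h \<in> carrier G" "h <# U = U" using h unfolding stab_def by auto
    have aV: "nontriv V" using nontriv_orbit[OF aX o] .
    have "almost_le U (h <# V)" using almost_le_lcos[OF hG(1) aU aV] l(1) hG(2) by simp
    then have "h <# (U - V) \<subseteq> C (h <# V)" using C(2) lcos_diff[OF hG(1) UG nontrivD(3)[OF aV]] hG(2) by simp
    then have "h \<otimes> x \<in> C (h <# V)" if "x \<in> U - V" for x using that unfolding l_coset_def by blast
    then have "x \<in> C (h <# V)" if "x \<in> U - V" for x
      using C(3)[of "h <# V"] that h(1) UG unfolding invariant_def by blast
    then show ?thesis using h(2) by blast
  qed
  ultimately show ?thesis by blast
qed

lemma uniform_point:
  assumes U: "tame J S U" and \<B>: "finite \<B>" "\<forall>X\<in>\<B>. tame J S X"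
  shows "\<exists>a\<in>U. \<forall>X\<in>\<B>. \<forall>V\<in>orbit X. almost_le U V \<and> \<not> almost_le V U \<longrightarrow> a \<in> V"
proof -
  note aU = tame_nontriv[OF U]
  have "\<exists>D. coset_finite G (stab U) D \<and> (\<forall>V\<in>orbit X. almost_le U V \<and> \<not> almost_le V U \<longrightarrow> U - V \<subseteq> D)"
    if "X \<in> \<B>" for X
    using uniform_difference[OF U] \<B>(2) that by blast
  then obtain D where D: "\<And>X. X \<in> \<B> \<Longrightarrow> coset_finite G (stab U) (D X)"
    "\<And>X V. X \<in> \<B> \<Longrightarrow> V \<in> orbit X \<Longrightarrow> almost_le U V \<Longrightarrow> \<not> almost_le V U \<Longrightarrow> U - V \<subseteq> D X" by metis
  have "coset_finite G (stab U) (\<Union>X\<in>\<B>. D X)" using \<B>(1) D(1) by (rule coset_finite_UN)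
  then have "\<not> U \<subseteq> (\<Union>X\<in>\<B>. D X)" using nontrivD(5)[OF aU] coset_finite_subset by metis
  then obtain a where a: "a \<in> U" "a \<notin> (\<Union>X\<in>\<B>. D X)" by blast
  have "a \<in> V" if "X \<in> \<B>" "V \<in> orbit X" "almost_le U V" "\<not> almost_le V U" for X V
    using D(2)[OF that] a that(1) by blast
  then show ?thesis using a(1) by blast
qed

text \<open>Translates strictly above U contain the common point a and so separate it from q, as do
  equivalent ones that contain U. An equivalent one inside U equals U by the coset count. Equivalent
  ones not nested with U fall into finitely many orbits of \<open>stab U\<close>, each of them
  finite.\<close>

lemma finite_above:
  assumes U: "tame J S U" and X: "tame J S X" and q: "q \<in> carrier G"
  shows "finite {V \<in> orbit X. tree_le U V \<and> q \<notin> V}"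
proof -
  note aU = tame_nontriv[OF U] and aX = tame_nontriv[OF X]
  note UG = nontrivD(3)[OF aU]
  obtain \<V> where V: "finite \<V>" "\<forall>V\<in>orbit X. (\<exists>h\<in>stab U. h <# V \<in> \<V>) \<or> nested G U V"
    using finite_orbits_not_nested[OF finite_J subgroup_S finite_A A_subset generated U X] by blast
  obtain a where a: "a \<in> U" "\<forall>V\<in>orbit X. almost_le U V \<and> \<not> almost_le V U \<longrightarrow> a \<in> V"
    using uniform_point[OF U, of "{X}"] X by auto
  have aG: "a \<in> carrier G" using a UG by blast
  define Q where "Q W = {V \<in> orbit X. sim U V \<and> (\<exists>h\<in>stab U. h <# V = W)}" for W
  have fQ: "finite (Q W)" if "W \<in> \<V>" for W
  proof (cases "nontriv W \<and> sim U W")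
    case True
    \<comment> \<open>The coset of the identity is \<open>stab U\<close> itself. By equivalence it
      is finite modulo \<open>stab W\<close>, so its elements move W to only finitely many
      sets.\<close>
    have "coset_finite G (stab U) (stab U #> \<one>)"
      unfolding coset_finite_def by (intro exI[of _ "{\<one>}"]) auto
    then have "coset_finite G (stab W) (stab U #> \<one>)" using sim_coset_finite[OF aU] True by blast
    then obtain F where F: "finite F" "F \<subseteq> carrier G" "stab U #> \<one> \<subseteq> (\<Union>f\<in>F. stab W #> f)"
      unfolding coset_finite_def by blast
    have WG: "W \<subseteq> carrier G" using True nontrivD(3) by blast
    have "Q W \<subseteq> (\<lambda>f. inv f <# W) ` F"
    proof
      fix V assume "V \<in> Q W"
      then obtain h where h: "h \<in> stab U" "h <# V = W" "V \<in> orbit X" unfolding Q_def by blast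
      have VG: "V \<subseteq> carrier G" using nontrivD(3)[OF nontriv_orbit[OF aX h(3)]] .
      have hG: "h \<in> carrier G" using nontrivD(8)[OF aU h(1)] .
      then have "h \<in> stab U #> \<one>" using h(1) unfolding r_coset_def by (auto intro!: bexI[of _ h])
      then obtain f k where f: "f \<in> F" "k \<in> stab W" "h = k \<otimes> f" using F(3) unfolding r_coset_def by blast
      have G: "k \<in> carrier G" "f \<in> carrier G" "k <# W = W" using f F unfolding stab_def by auto
      have "inv k <# W = W" using lcos_inv(1)[OF G(1) WG] G(3) by simp
      moreover have "V = inv h <# W" using lcos_inv(1)[OF hG VG] h(2) by simp
      moreover have "inv h <# W = inv f <# (inv k <# W)"
        using f(3) G WG by (simp add: inv_mult_group lcos_lcos)
      ultimately show "V \<in> (\<lambda>f. inv f <# W) ` F" using f(1) by simp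
    qed
    then show ?thesis using F(1) finite_surj by blast
  next
    case False
    have "Q W = {}"
    proof (rule ccontr)
      assume "Q W \<noteq> {}"
      then obtain V h where h: "V \<in> orbit X" "sim U V" "h \<in> stab U" "h <# V = W" unfolding Q_def by blast
      have hG: "h \<in> carrier G" "h <# U = U" using h(3) unfolding stab_def by auto
      have aV: "nontriv V" using nontriv_orbit[OF aX h(1)] .
      have "nontriv W" using nontriv_lcos[OF hG(1) aV] h(4) by simp
      moreover have "sim U W"
        using h(2,4) almost_le_lcos[OF hG(1) aU aV] almost_le_lcos[OF hG(1) aV aU] hG(2) unfolding sim_def by simp
      ultimately show False using False by blast
    qed
    then show ?thesis by simp
  qed
  have "{V \<in> orbit X. tree_le U V \<and> q \<notin> V} \<subseteq> {V \<in> orbit X. a \<in> V \<and> q \<notin> V} \<union> {U} \<union> (\<Union>W\<in>\<V>. Q W)"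
  proof
    fix V assume "V \<in> {V \<in> orbit X. tree_le U V \<and> q \<notin> V}"
    then have o: "V \<in> orbit X" and s: "tree_le U V" and q: "q \<notin> V" by auto
    note aV = nontriv_orbit[OF aX o]
    have l: "almost_le U V" using s unfolding tree_le_def by blast
    show "V \<in> {V \<in> orbit X. a \<in> V \<and> q \<notin> V} \<union> {U} \<union> (\<Union>W\<in>\<V>. Q W)"
    proof (cases "almost_le V U")
      case False
      then have "a \<in> V" using a(2)[rule_format, OF o] l by blast
      then show ?thesis using o q by blast
    next
      case True
      then have sm: "sim U V" using l unfolding sim_def by blast
      show ?thesis
      proof (cases "nested G U V")
        case n: True
        have "U = V" if "V \<subseteq> U"
          using count_le_subset_eq[OF aU aV sm that] s True unfolding tree_le_def by blast
        then show ?thesis using nested_almost_le_subset[OF aU aV n l] a(1) o q by blast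
      next
        case False
        then obtain h where "h \<in> stab U" "h <# V \<in> \<V>" using V(2) o by blast
        then have "V \<in> Q (h <# V)" "h <# V \<in> \<V>" unfolding Q_def using o sm by auto
        then show ?thesis by blast
      qed
    qed
  qed
  moreover have "finite ({V \<in> orbit X. a \<in> V \<and> q \<notin> V} \<union> {U} \<union> (\<Union>W\<in>\<V>. Q W))"
    using finite_separating[OF aX aG q] V(1) fQ by simp
  ultimately show ?thesis by (rule finite_subset)
qed

text \<open>If g is in the new set but not in X, then \<open>inv g <# X\<close> is above U or its
  complement in the tree order and misses the identity. Only finitely many translates do so, and
  each determines a coset of \<open>stab X\<close>. The complement of X gives the other
  difference.\<close>

lemma tree_side_equivalent:
  assumes U: "tame J S U" and X: "tame J S X" and c: "\<And>g. g \<in> carrier G \<Longrightarrow> \<not> crosses G (g <# U) X"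
  shows "equivalent G X (tree_side U X)" "tame J S (tree_side U X)"
proof -
  note aU = tame_nontriv[OF U] and aX = tame_nontriv[OF X]
  note XG = nontrivD(3)[OF aX]
  have fin: "coset_finite G (stab Y) (tree_side U Y - Y)" if Y: "tame J S Y" for Y
  proof -
    note aY = tame_nontriv[OF Y]
    note YG = nontrivD(3)[OF aY]
    define D where "D = {V \<in> orbit Y. tree_le U V \<and> \<one> \<notin> V} \<union> {V \<in> orbit Y. tree_le (compl U) V \<and> \<one> \<notin> V}"
    have "finite D" unfolding D_def
      using finite_above[OF U Y one_closed] finite_above[OF tame_compl[OF U] Y one_closed] by simp
    then have "coset_finite G (stab Y) {g \<in> carrier G. inv g <# Y \<in> D}"
      by (rule finite_translates_coset_finite[OF YG])
    moreover have "tree_side U Y - Y \<subseteq> {g \<in> carrier G. inv g <# Y \<in> D}"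
    proof
      fix g assume "g \<in> tree_side U Y - Y"
      then have g: "g \<in> carrier G" "towards (g <# U) Y" "g \<notin> Y" unfolding tree_side_def by auto
      have "towards U (inv g <# Y)"
        using towards_lcos[of "inv g" "g <# U" Y] g aU aY nontriv_lcos by (simp add: lcos_inv nontrivD(3))
      moreover have "\<one> \<notin> inv g <# Y" using g YG by (simp add: lcos_iff)
      ultimately show "g \<in> {g \<in> carrier G. inv g <# Y \<in> D}"
        using g(1) unfolding D_def towards_def by auto
    qed
    ultimately show ?thesis by (rule coset_finite_subset)
  qed
  have co: "tree_side U (compl X) = compl (tree_side U X)"
    using towards_compl[OF nontriv_lcos[OF _ aU] aX c] unfolding tree_side_def by auto
  have sub: "tree_side U X \<subseteq> carrier G" unfolding tree_side_def by blast
  have "tree_side U (compl X) - compl X = X - tree_side U X" unfolding co using XG by blast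
  then have "coset_finite G (stab X) (X - tree_side U X)"
    using fin[OF tame_compl[OF X]] XG by (simp add: stab_compl)
  then have d: "coset_finite G (stab X) (sym_diff X (tree_side U X))"
    using fin[OF X] coset_finite_Un by blast
  have s: "stab X \<subseteq> stab (tree_side U X)"
  proof
    fix h assume "h \<in> stab X"
    then have h: "h \<in> carrier G" "h <# X = X" unfolding stab_def by auto
    then show "h \<in> stab (tree_side U X)" using tree_side_lcos[OF h(1) aU aX] unfolding stab_def by simp
  qed
  show e: "equivalent G X (tree_side U X)" by (rule equivalent_if_almost_equal[OF aX sub s d])
  show "tame J S (tree_side U X)" by (rule tame_equivalent[OF X e s])
qed

text \<open>Let B be whichever of X0 and its complement is below V. If strictly, p B is in V by the
  choice of p. If B and V are equivalent, nothing in E crosses either, for it would lie in both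
  components; then Y1 is V, x consists of X0 and its complement, and the honest inclusion of X1 in
  Y1 supplies the point.\<close>

lemma between_point:
  assumes Y: "\<forall>i\<in>I. tame J S (Y i)" and \<F>: "\<F> = full_family G I Y" and E: "E = translates G I Y"
    and p: "\<And>U. U \<in> E \<Longrightarrow> p U \<in> U \<and> (\<forall>V\<in>E. almost_le U V \<and> \<not> almost_le V U \<longrightarrow> p U \<in> V)"
    and x: "x \<in> cccs G \<F>" and y: "y \<in> cccs G \<F>" and ne: "x \<noteq> y"
    and X1: "X1 \<in> x" and Y1: "Y1 \<in> y" and sub: "X1 \<subseteq> Y1" and X0: "X0 \<in> x" "X0 \<in> E"
    and V: "V \<in> E" "V \<in> y" "sim Y1 V" "Y1 = V \<or> (\<exists>W\<in>E. crosses G Y1 W \<and> crosses G V W)"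
  shows "p X0 \<in> V \<or> p (compl X0) \<in> V"
proof -
  have aY: "\<forall>i\<in>I. nontriv (Y i)" using Y tame_nontriv by blast
  have EF: "E \<subseteq> \<F>" unfolding E \<F> full_family_def by blast
  have aF: "nontriv U" if "U \<in> \<F>" for U using that full_family_nontriv[OF aY] unfolding \<F> by blast
  have aX0: "nontriv X0" and aV: "nontriv V" and aY1: "nontriv Y1"
    using aF EF X0 V(1) cccsD(1)[OF y Y1] by auto
  have cX0: "compl X0 \<in> E" using translates_compl[OF aY] X0(2) unfolding E by blast
  have cx: "compl X0 \<in> x" using cccs_compl[OF x X0(1)] cX0 EF by blast
  have "almost_le X0 Y1 \<or> almost_le (compl X0) Y1"
    using ccc_almost_le_side[OF aY \<F> x y ne X1 Y1 subset_almost_le[OF sub] X0(1)] .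
  then obtain B where B: "B = X0 \<or> B = compl X0" "almost_le B Y1" by blast
  have BE: "B \<in> E" "B \<in> x" using B(1) X0 cX0 cx by auto
  have aB: "nontriv B" using BE(1) EF aF by blast
  have lB: "almost_le B V" using almost_le_trans[OF aB aY1 aV B(2)] V(3) unfolding sim_def by blast
  show ?thesis
  proof (cases "almost_le V B")
    case False
    then show ?thesis using p[OF BE(1)] V(1) lB B(1) by blast
  next
    case True
    then have s: "sim V B" using lB unfolding sim_def by blast
    have nV: "\<not> crosses G V W" if W: "W \<in> E" for W
    proof
      assume c: "crosses G V W"
      have WF: "W \<in> \<F>" using W EF by blast
      have "crosses G B W" using crosses_sim[OF aV aF[OF WF] aB s c] .
      then have "W \<in> x" using cccs_crosses[OF x BE(2) WF] by blast
      moreover have "W \<in> y" using cccs_crosses[OF y V(2) WF c] .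
      ultimately show False using cccs_eq[OF x y] ne by blast
    qed
    then have eq: "Y1 = V" using V(4) by blast
    have "\<not> crosses G B W" if W: "W \<in> E" for W
      using crosses_sim[OF aB _ aV sim_sym[OF s]] nV[OF W] aF EF W by blast
    then have "\<forall>W\<in>translates G I Y. \<not> crosses G X0 W"
      using B(1) crosses_compl[OF aX0] aF EF unfolding E by blast
    then have "X1 = X0 \<or> X1 = compl X0" using ccc_isolated[OF aY \<F> x X0(1) _ X1] by blast
    then show ?thesis using p[OF X0(2)] p[OF cX0] sub eq by blast
  qed
qed

lemma discrete_cccs:
  assumes I: "finite I" and Y: "\<forall>i\<in>I. tame J S (Y i)"
  shows "discrete_betweenness (cccs G (full_family G I Y))"
proof -
  define \<F> where "\<F> = full_family G I Y"
  define E where "E = translates G I Y"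
  define \<B> where "\<B> = Y ` I \<union> (\<lambda>i. compl (Y i)) ` I"
  have aY: "\<forall>i\<in>I. nontriv (Y i)" using Y tame_nontriv by blast
  have B: "finite \<B>" "\<forall>X\<in>\<B>. tame J S X" unfolding \<B>_def using I Y tame_compl by auto
  have EB: "E = (\<Union>B\<in>\<B>. orbit B)" unfolding E_def \<B>_def by (rule translates_Union_orbit)
  have aE: "nontriv U" if "U \<in> E" for U using that translates_nontriv[OF aY] unfolding E_def by blast
  have EF: "E \<subseteq> \<F>" unfolding E_def \<F>_def full_family_def by blast
  have cE: "compl U \<in> E" if "U \<in> E" for U using that translates_compl[OF aY] unfolding E_def by blast
  \<comment> \<open>Points are found for the finitely many representatives B and translated along
    with B to the other members of E.\<close>
  have "\<exists>a. a \<in> U \<and> (\<forall>V\<in>E. almost_le U V \<and> \<not> almost_le V U \<longrightarrow> a \<in> V)" if U: "U \<in> E" for U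
  proof -
    obtain B g where Bg: "B \<in> \<B>" "g \<in> carrier G" "U = g <# B" using U unfolding EB by blast
    have aB: "nontriv B" using Bg(1) B(2) tame_nontriv by blast
    obtain a where a: "a \<in> B" "\<forall>X\<in>\<B>. \<forall>V\<in>orbit X. almost_le B V \<and> \<not> almost_le V B \<longrightarrow> a \<in> V"
      using uniform_point[of B \<B>] B Bg(1) by blast
    have aG: "a \<in> carrier G" using a(1) nontrivD(3)[OF aB] by blast
    have "g \<otimes> a \<in> V" if V: "V \<in> E" "almost_le U V" "\<not> almost_le V U" for V
    proof -
      have VG: "V \<subseteq> carrier G" using nontrivD(3)[OF aE[OF V(1)]] .
      have i: "inv g \<in> carrier G" using Bg(2) by simp
      have UB: "inv g <# U = B" using lcos_inv(1)[OF Bg(2) nontrivD(3)[OF aB]] Bg(3) by simp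
      have "inv g <# V \<in> E" using translates_lcos[OF aY _ i] V(1) unfolding E_def by blast
      moreover have "almost_le B (inv g <# V)" "\<not> almost_le (inv g <# V) B"
        using almost_le_lcos[OF i aE[OF U] aE[OF V(1)]] almost_le_lcos[OF i aE[OF V(1)] aE[OF U]] UB V(2,3) by auto
      ultimately have "a \<in> inv g <# V" using a(2) unfolding EB by blast
      then show ?thesis using lcos_iff[OF i VG] Bg(2) by simp
    qed
    moreover have "g \<otimes> a \<in> U" using a(1) Bg(3) unfolding l_coset_def by blast
    ultimately show ?thesis by blast
  qed
  then obtain p where p: "\<And>U. U \<in> E \<Longrightarrow> p U \<in> U \<and> (\<forall>V\<in>E. almost_le U V \<and> \<not> almost_le V U \<longrightarrow> p U \<in> V)" by metis
  have pG: "p U \<in> carrier G" if "U \<in> E" for U using p[OF that] nontrivD(3)[OF aE[OF that]] by blast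
  have sep: "finite {V \<in> E. a \<in> V \<and> b \<notin> V}" if "a \<in> carrier G" "b \<in> carrier G" for a b
  proof -
    have "{V \<in> E. a \<in> V \<and> b \<notin> V} = (\<Union>B\<in>\<B>. {V \<in> orbit B. a \<in> V \<and> b \<notin> V})" unfolding EB by blast
    moreover have "finite \<dots>"
    proof (rule finite_UN_I[OF B(1)])
      fix B assume "B \<in> \<B>"
      then have "nontriv B" using B(2) tame_nontriv by blast
      then show "finite {V \<in> orbit B. a \<in> V \<and> b \<notin> V}" using that by (rule finite_separating)
    qed
    ultimately show ?thesis by simp
  qed
  have rep: "\<exists>V. V \<in> E \<and> V \<in> y \<and> sim U V \<and> (U = V \<or> (\<exists>W\<in>E. crosses G U W \<and> crosses G V W))"
    if y: "y \<in> cccs G \<F>" and U: "U \<in> y" for y U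
  proof -
    have UF: "U \<in> \<F>" using cccsD(1)[OF y U] .
    obtain V where V: "V \<in> E" "nontriv V" "sim U V" "U = V \<or> (\<exists>W\<in>E. crosses G U W \<and> crosses G V W)"
      using full_family_representative[OF aY UF[unfolded \<F>_def]] unfolding E_def by metis
    have "V \<in> y"
    proof (cases "U = V")
      case False
      then obtain W where W: "W \<in> E" "crosses G U W" "crosses G V W" using V(4) by blast
      have "W \<in> y" using cccs_crosses[OF y U _ W(2)] W(1) EF by blast
      moreover have "crosses G W V" using W(3) crosses_sym[OF V(2) aE[OF W(1)]] by blast
      ultimately show ?thesis using cccs_crosses[OF y] V(1) EF by blast
    qed (use U in simp)
    then show ?thesis using V by blast
  qed
  have fin: "finite {y \<in> cccs G \<F>. ccc_between x y z}" if x: "x \<in> cccs G \<F>" and z: "z \<in> cccs G \<F>" for x z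
  proof -
    obtain X0 where X0: "X0 \<in> E" "X0 \<in> x" using rep[OF x] cccs_ne[OF x] by blast
    obtain Z0 where Z0: "Z0 \<in> E" "Z0 \<in> z" using rep[OF z] cccs_ne[OF z] by blast
    \<comment> \<open>Every component between x and z contains a translate that separates one of two
      points for x from one of two points for z. The points do not depend on that component, so N is
      finite.\<close>
    define N where "N = (\<Union>a\<in>{p X0, p (compl X0)}. \<Union>b\<in>{p Z0, p (compl Z0)}. {V \<in> E. a \<in> V \<and> b \<notin> V})"
    have "finite N" unfolding N_def using sep pG X0(1) Z0(1) cE by simp
    moreover have "{y \<in> cccs G \<F>. ccc_between x y z} \<subseteq>
      (\<lambda>V. {(U, V) \<in> \<F> \<times> \<F>. linked \<F> U V} `` {V}) ` N"
    proof
      fix y assume "y \<in> {y \<in> cccs G \<F>. ccc_between x y z}"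
      then obtain X1 Y1 Z1 where y: "y \<in> cccs G \<F>" "y \<noteq> x" "y \<noteq> z"
        and m: "X1 \<in> x" "Y1 \<in> y" "Z1 \<in> z" and sub: "X1 \<subseteq> Y1" "Y1 \<subseteq> Z1"
        unfolding ccc_between_def by blast
      obtain V where V: "V \<in> E" "V \<in> y" "sim Y1 V" "Y1 = V \<or> (\<exists>W\<in>E. crosses G Y1 W \<and> crosses G V W)"
        using rep[OF y(1) m(2)] by blast
      have F: "Y1 \<in> \<F>" "Z1 \<in> \<F>" using cccsD(1) y(1) z m by auto
      have cF: "compl U \<in> \<F>" if "U \<in> \<F>" for U
        using that full_family_compl[OF aY] unfolding \<F>_def by blast
      have aY1: "nontriv Y1" using F(1) full_family_nontriv[OF aY] unfolding \<F>_def by blast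
      have aV: "nontriv V" using aE V(1) by blast
      have 1: "p X0 \<in> V \<or> p (compl X0) \<in> V"
        by (rule between_point[OF Y \<F>_def E_def p x y(1) y(2)[symmetric] m(1,2) sub(1) X0(2,1) V])
      have c: "compl Z1 \<in> z" "compl Y1 \<in> y" "compl V \<in> y" "compl V \<in> E"
        using cccs_compl[OF z m(3)] cccs_compl[OF y(1) m(2)] cccs_compl[OF y(1) V(2)] cF F cE V(1) EF by auto
      have s: "sim (compl Y1) (compl V)"
        using V(3) almost_le_compl[OF aY1 aV] almost_le_compl[OF aV aY1] unfolding sim_def by blast
      have d: "compl Y1 = compl V \<or> (\<exists>W\<in>E. crosses G (compl Y1) W \<and> crosses G (compl V) W)"
        using V(4) crosses_compl[OF aY1 aE] crosses_compl[OF aV aE] by blast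
      \<comment> \<open>The same argument from the other end: complements reverse the inclusions,
        and z takes the place of x.\<close>
      have zy: "compl Z1 \<subseteq> compl Y1" using sub(2) by blast
      have "p Z0 \<in> compl V \<or> p (compl Z0) \<in> compl V"
        by (rule between_point[OF Y \<F>_def E_def p z y(1) y(3)[symmetric] c(1,2) zy Z0(2,1) c(4,3) s d])
      then have "V \<in> N" using 1 V(1) unfolding N_def by blast
      then show "y \<in> (\<lambda>V. {(U, V) \<in> \<F> \<times> \<F>. linked \<F> U V} `` {V}) ` N"
        using cccsD(3)[OF y(1) V(2)] by blast
    qed
    ultimately show ?thesis using finite_surj by blast
  qed
  show ?thesis using fin unfolding discrete_betweenness_def \<F>_def by blast
qed

theorem regular_neighbourhood_exists_tame:
  assumes I: "finite I" and X: "\<forall>i\<in>I. tame J S (X i)"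
  shows "regular_neighbourhood_exists G I X"
proof -
  define iso where "iso V \<longleftrightarrow> (\<forall>W\<in>translates G I X. \<not> crosses G V W)" for V
  \<comment> \<open>Any isolated member can provide the reference edge. If there is none, k is
    arbitrary and every \<open>X i\<close> is kept.\<close>
  define k where "k = (SOME i. i \<in> I \<and> iso (X i))"
  define U where "U = X k"
  define Y where "Y i = (if iso (X i) then tree_side U (X i) else X i)" for i
  have aX: "\<forall>i\<in>I. nontriv (X i)" using X tame_nontriv by blast
  have aE: "nontriv V" if "V \<in> translates G I X" for V using that translates_nontriv[OF aX] by blast
  have U: "tame J S U" "iso U" "U \<in> translates G I X" if "i \<in> I" "iso (X i)" for i
  proof -
    have "k \<in> I \<and> iso (X k)"
      unfolding k_def using that by (intro someI[of "\<lambda>i. i \<in> I \<and> iso (X i)" i] conjI)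
    then have k: "k \<in> I" "iso (X k)" by auto
    show "tame J S U" "iso U" unfolding U_def using k X by auto
    show "U \<in> translates G I X" unfolding U_def using translates_self[OF k(1)] aX k(1) by simp
  qed
  have iso_lcos: "iso (g <# V)" if g: "g \<in> carrier G" and V: "nontriv V" "iso V" for g V
    unfolding iso_def
  proof (intro ballI notI)
    fix W assume W: "W \<in> translates G I X" and c: "crosses G (g <# V) W"
    have gi: "inv g \<in> carrier G" using g by simp
    have "crosses G (inv g <# (g <# V)) (inv g <# W)"
      using crosses_lcos[OF gi nontriv_lcos[OF g V(1)] aE[OF W]] c by blast
    then show False using translates_lcos[OF aX W gi] V lcos_inv(1)[OF g nontrivD(3)[OF V(1)]]
      unfolding iso_def by simp
  qed
  have iso_compl: "iso (compl V)" if "nontriv V" "iso V" for V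
    using that crosses_compl[OF that(1)] aE unfolding iso_def by blast
  have eqtm: "equivalent G (X i) (Y i) \<and> tame J S (Y i)" if i: "i \<in> I" for i
  proof (cases "iso (X i)")
    case True
    have c: "\<not> crosses G (g <# U) (X i)" if "g \<in> carrier G" for g
      using iso_lcos[OF that tame_nontriv[OF U(1)[OF i True]] U(2)[OF i True]] translates_self[of i I X] i aX
      unfolding iso_def by blast
    show ?thesis using tree_side_equivalent[OF U(1)[OF i True] X[rule_format, OF i] c] True
      unfolding Y_def by simp
  next
    case False
    then show ?thesis using X i aX subset_almost_le unfolding Y_def equivalent_iff_sim sim_def by auto
  qed
  have tY: "\<forall>i\<in>I. tame J S (Y i)" and aY: "\<forall>i\<in>I. nontriv (Y i)" and sY: "\<forall>i\<in>I. sim (X i) (Y i)"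
    using eqtm unfolding equivalent_iff_sim by auto
  have iso_tree: "\<exists>V\<in>translates G I X. iso V \<and> iso U \<and> nontriv U \<and> W = tree_side U V"
    if W: "W \<in> isolated_elements G (full_family G I Y)" for W
  proof -
    have WF: "W \<in> full_family G I Y" and n: "\<And>V. V \<in> full_family G I Y \<Longrightarrow> \<not> crosses G W V"
      using W unfolding isolated_elements_def by auto
    have EF: "translates G I Y \<subseteq> full_family G I Y" unfolding full_family_def by blast
    obtain Z where Z: "Z \<in> translates G I Y" "W = Z \<or> (\<exists>V\<in>translates G I Y. crosses G W V \<and> crosses G Z V)"
      using full_family_representative[OF aY WF] by metis
    \<comment> \<open>Otherwise W would cross the translate that comes with its
      representative.\<close>
    then have "W \<in> translates G I Y" using n EF by blast
    then obtain i g where i: "i \<in> I" "g \<in> carrier G" "W = g <# Y i \<or> W = g <# compl (Y i)"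
      unfolding translates_def by blast
    note aYi = aY[rule_format, OF i(1)] and aXi = aX[rule_format, OF i(1)]
    have nY: "\<not> crosses G (Y i) V" if V: "V \<in> translates G I Y" for V
    proof
      assume c: "crosses G (Y i) V"
      note aV = translates_nontriv[OF aY V]
      have "crosses G (compl (Y i)) V" using c crosses_compl[OF aYi aV] by blast
      then have "crosses G W (g <# V)"
        using c i(3) crosses_lcos[OF i(2) aYi aV] crosses_lcos[OF i(2) nontriv_compl[OF aYi] aV] by blast
      then show False using n EF translates_lcos[OF aY V i(2)] by blast
    qed
    \<comment> \<open>Isolation passes back from \<open>Y i\<close> to \<open>X i\<close>, so
      \<open>Y i\<close> is a side in the tree and not merely \<open>X i\<close>.\<close>
    have iX: "iso (X i)"
      using orbit_crosses_sim[OF aX aY sY i(1)] nY unfolding iso_def by blast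
    note Ui = U[OF i(1) iX]
    note aU = tame_nontriv[OF Ui(1)]
    have Yi: "Y i = tree_side U (X i)" using iX unfolding Y_def by simp
    have "\<not> crosses G (h <# U) (X i)" if "h \<in> carrier G" for h
      using iso_lcos[OF that aU Ui(2)] translates_self[OF i(1), of X] aXi unfolding iso_def by blast
    then have co: "tree_side U (compl (X i)) = compl (Y i)"
      using towards_compl[OF nontriv_lcos[OF _ aU] aXi] unfolding Yi tree_side_def by auto
    have "W = tree_side U (g <# X i) \<or> W = tree_side U (g <# compl (X i))"
      using i(3) tree_side_lcos[OF i(2) aU aXi] tree_side_lcos[OF i(2) aU nontriv_compl[OF aXi]] Yi co by simp
    moreover have "iso (g <# X i)" "iso (g <# compl (X i))"
      using iso_lcos[OF i(2) aXi iX] iso_lcos[OF i(2) nontriv_compl[OF aXi] iso_compl[OF aXi iX]] by auto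
    moreover have "g <# X i \<in> translates G I X" "g <# compl (X i) \<in> translates G I X"
      using i unfolding translates_def by blast+
    ultimately show ?thesis using Ui(2) aU by blast
  qed
  have "nested G W1 W2" if W1: "W1 \<in> isolated_elements G (full_family G I Y)"
    and W2: "W2 \<in> isolated_elements G (full_family G I Y)" for W1 W2
  proof -
    obtain V1 where V1: "V1 \<in> translates G I X" "iso V1" "iso U" "nontriv U" "W1 = tree_side U V1"
      using iso_tree[OF W1] by blast
    obtain V2 where V2: "V2 \<in> translates G I X" "W2 = tree_side U V2"
      using iso_tree[OF W2] by blast
    have "\<not> crosses G V1 V2" using V1(2) V2(1) unfolding iso_def by blast
    moreover have "\<not> crosses G (g <# U) V" if "g \<in> carrier G" "V \<in> translates G I X" for g V
      using iso_lcos[OF that(1) V1(4,3)] that(2) unfolding iso_def by blast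
    ultimately show ?thesis
      unfolding V1(5) V2(2) using tree_side_nested[OF V1(4) aE[OF V1(1)] aE[OF V2(1)]] V1(1) V2(1) by blast
  qed
  moreover have "corner_symmetric G (full_family G I Y)"
    using corner_symmetric_nontriv full_family_nontriv[OF aY] by blast
  moreover have "\<forall>i\<in>I. \<exists>H. nontrivial_almost_invariant G H (Y i)" using aY unfolding nontriv_def by blast
  ultimately have "rn_ready G I Y" unfolding rn_ready_def by blast
  then show ?thesis
    using eqtm discrete_cccs[OF I tY] unfolding regular_neighbourhood_exists_def by blast
qed

end

theorem theorem9p13:
  fixes G :: "('a, 'b) monoid_scheme"
    and n :: nat
    and H X :: "nat \<Rightarrow> 'a set"
    and J :: "'j set"
    and S :: "'j \<Rightarrow> 'a set"
  assumes "group G"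
    and "\<forall>i\<in>{1..n}. subgroup (H i) G \<and> finitely_generated_in G (H i)"
    and "\<forall>i\<in>{1..n}. nontrivial_almost_invariant G (H i) (X i)"
  shows "(finitely_generated_in G (carrier G) \<longrightarrow> regular_neighbourhood_exists G {1..n} X) \<and>
         (group_system G J S \<and> finite_type G J S \<and> (\<forall>i\<in>{1..n}. family_adapted G J S (X i)) \<longrightarrow>
            regular_neighbourhood_exists G {1..n} X)"
proof (intro conjI impI)
  interpret group G by fact
  have tame: "\<forall>i\<in>{1..n}. tame K T (X i)" if "\<forall>i\<in>{1..n}. family_adapted G K T (X i)"
    for K :: "'j set" and T
    using that assms(2,3) unfolding tame_def by blast
  assume "finitely_generated_in G (carrier G)"
  then obtain A where A: "finite A" "A \<subseteq> carrier G" "carrier G = generate G A"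
    unfolding finitely_generated_in_def by blast
  \<comment> \<open>Ordinary finite generation is the relative case with an empty family of
    subgroups, where adaptedness is vacuous.\<close>
  have "relatively_finitely_generated G ({} :: 'j set) S A"
    by unfold_locales (simp_all add: A(1,2) A(3)[symmetric])
  moreover have "\<forall>i\<in>{1..n}. tame ({} :: 'j set) S (X i)"
    by (rule tame) (simp add: family_adapted_def)
  ultimately show "regular_neighbourhood_exists G {1..n} X"
    by (intro relatively_finitely_generated.regular_neighbourhood_exists_tame finite_atLeastAtMost)
next
  interpret group G by fact
  assume *: "group_system G J S \<and> finite_type G J S \<and> (\<forall>i\<in>{1..n}. family_adapted G J S (X i))"
  then obtain A where A: "finite A" "A \<subseteq> carrier G" "carrier G = generate G ((\<Union>j\<in>J. S j) \<union> A)"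
    unfolding finite_type_def by blast
  have J: "finite J" "\<forall>j\<in>J. subgroup (S j) G"
    using * unfolding finite_type_def group_system_def by blast+
  have "relatively_finitely_generated G J S A"
    by unfold_locales (fact A J)+
  moreover have "\<forall>i\<in>{1..n}. tame J S (X i)"
    using * assms(2,3) unfolding tame_def by blast
  ultimately show "regular_neighbourhood_exists G {1..n} X"
    by (intro relatively_finitely_generated.regular_neighbourhood_exists_tame finite_atLeastAtMost)
qed

end
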